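(* Let $G$ be a discrete countable infinite group. Let $\mathcal T=(C_n,F_{n-1})_{n=1}^\infty$ and $\widetilde{\mathcal T}=(\widetilde C_n,\widetilde F_{n-1})_{n=1}^\infty$ be two $(C,F)$-sequences in $G$ whose $(C,F)$-spaces $X$ and $\widetilde X$ are non-compact and satisfy $X^G=X$ and $\widetilde X^G=\widetilde X$. Let $T=(T_g)_{g\in G}$ and $\widetilde T=(\widetilde T_g)_{g\in G}$ be the associated continuous $(C,F)$-actions on the locally compact Cantor spaces $X$ and $\widetilde X$, and let $\mu,\widetilde\mu$ be the corresponding invariant Haar measures (possibly infinite). Then there exists a homeomorphism $\phi:X\to\widetilde X$ such that $$\phi(\{T_gx\mid g\in G\})=\{\widetilde T_g\phi(x)\mid g\in G\}\quad\text{for each }x\in X$$ if and only if there is $c>0$ with $$\mathcal D(\mathcal T)=c\cdot\mathcal D(\widetilde{\mathcal T})\qquad\text{and}\qquad\mu(X)=c\,\widetilde\mu(\widetilde X).$$ Moreover, in the "if" case (that is, given $c>0$ satisfying these two equalities), $\phi$ is constructed explicitly and algorithmically in terms of $\mathcal T$, $\widetilde{\mathcal T}$ and $c$. Furthermore, this $\phi$ satisfies $\mu\circ\phi^{-1}=c\,\widetilde\mu$.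
   Context: A $(C,F)$-sequence in a countable discrete group $G$ is a sequence $\mathcal T=(C_n,F_{n-1})_{n=1}^\infty$ of pairs of finite subsets of $G$ with $\#F_0=1$ and $\#C_n>1$ for all $n\ge1$, such that for all $n\ge0$: $F_nC_{n+1}\subset F_{n+1}$, and $F_nc\cap F_nc'=\emptyset$ for distinct $c,c'\in C_{n+1}$. Put $X_n:=F_n\times C_{n+1}\times C_{n+2}\times\cdots$ with the product topology (a compact space). The map $(f_n,c_{n+1},c_{n+2},\dots)\mapsto(f_nc_{n+1},c_{n+2},\dots)$ is a continuous open embedding $X_n\to X_{n+1}$. The $(C,F)$-space $X$ associated with $\mathcal T$ is the topological inductive limit of $(X_n)_{n\ge0}$; it is a locally compact Cantor space, and we view $X=\bigcup_{n\ge0}X_n$ as an increasing union of compact open subsets. The Haar measure $\mu$ on $X$ is the unique $\sigma$-finite Radon measure whose restriction to each $X_n$ is $\nu_n\otimes\bigotimes_{k>n}\kappa_k$, where $\kappa_k$ is the uniform probability measure on $C_k$ and $\nu_n(\{f\})=1/\prod_{k=1}^n\#C_k$ for each $f\in F_n$ (so $\mu(X_0)=1$). For $g\in G$ let $X_n^g:=\{(f_n,c_{n+1},\dots)\in X_n\mid gf_n\in F_n\}$, $X^g:=\bigcup_{n\ge0}X_n^g$ and $X^G:=\bigcap_{g\in G}X^g$. For $x\in X^G$ and $g\in G$ choose $n$ with $x=(f_n,c_{n+1},\dots)\in X_n$ and $gf_n\in F_n$, and set $T_gx:=(gf_n,c_{n+1},\dots)\in X_n\subset X$. This gives a well-defined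 free continuous $G$-action $T=(T_g)_{g\in G}$ on $X^G$, the $(C,F)$-action associated with $\mathcal T$. (One has $X^G=X$ if and only if for each $g\in G$ and $n>0$ there is $m>n$ with $gF_nC_{n+1}\cdots C_m\subset F_m$.) Put $p_0(\mathcal T):=1$, $p_n(\mathcal T):=\#C_1\cdots\#C_n$ for $n\ge1$, and $\mathcal D(\mathcal T):=\bigcup_{n\ge0}\frac1{p_n(\mathcal T)}\mathbb Z\subset\mathbb Q$. For $c>0$, $c\cdot\mathcal D=\{cd\mid d\in\mathcal D\}$, and $c\cdot\infty=\infty$. All objects associated with $\widetilde{\mathcal T}$ are defined in the same way and carry tildes. "Explicitly and algorithmically" is meant in a finite-stage sense: after enumerations of the finite parameter sets have been fixed, the levels, subsets, injections and bijections entering each stage of the inductive construction of $\phi$ are specified by finite searches (taking the first admissible choice at every stage). *)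

theory Defs
  imports
    "HOL-Probability.Probability"
    "HOL-Algebra.Coset"
    "HOL-Library.Monad_Syntax"
begin

text \<open>A sequence $(C_n, F_{n-1})_{n \ge 1}$ is given by two functions on the naturals; the value of
  \<open>C\<close> at \<open>0\<close> is never used.\<close>

definition cf_sequence ::
    "('g, 'b) monoid_scheme \<Rightarrow> (nat \<Rightarrow> 'g set) \<Rightarrow> (nat \<Rightarrow> 'g set) \<Rightarrow> bool" where
  "cf_sequence G C F \<longleftrightarrow>
     (\<forall>n\<ge>1. finite (C n) \<and> C n \<subseteq> carrier G \<and> card (C n) > 1) \<and>
     (\<forall>n. finite (F n) \<and> F n \<subseteq> carrier G) \<and>
     card (F 0) = 1 \<and>
     (\<forall>n. F n <#>\<^bsub>G\<^esub> C (Suc n) \<subseteq> F (Suc n)) \<and>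
     (\<forall>n. \<forall>c\<in>C (Suc n). \<forall>c'\<in>C (Suc n). c \<noteq> c' \<longrightarrow>
        (F n #>\<^bsub>G\<^esub> c) \<inter> (F n #>\<^bsub>G\<^esub> c') = {})"

definition cf_p :: "(nat \<Rightarrow> 'g set) \<Rightarrow> nat \<Rightarrow> nat" where
  "cf_p C n = (\<Prod>k=1..n. card (C k))"

definition cf_D :: "(nat \<Rightarrow> 'g set) \<Rightarrow> real set" where
  "cf_D C = (\<Union>n. {real_of_int z / real (cf_p C n) | z. True})"

text \<open>A point $(f_n, c_{n+1}, c_{n+2}, \dots)$ of $X_n$ is a function that sends $n$ to $f_n$ and
  $k > n$ to $c_k$, and is \<open>undefined\<close> below $n$.\<close>

definition cf_level_top ::
    "(nat \<Rightarrow> 'g set) \<Rightarrow> (nat \<Rightarrow> 'g set) \<Rightarrow> nat \<Rightarrow> (nat \<Rightarrow> 'g) topology" where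
  "cf_level_top C F n =
     product_topology (\<lambda>k. discrete_topology (if k = n then F n else C k)) {n..}"

abbreviation cf_level :: "(nat \<Rightarrow> 'g set) \<Rightarrow> (nat \<Rightarrow> 'g set) \<Rightarrow> nat \<Rightarrow> (nat \<Rightarrow> 'g) set" where
  "cf_level C F n \<equiv> topspace (cf_level_top C F n)"

definition cf_embed :: "('g, 'b) monoid_scheme \<Rightarrow> nat \<Rightarrow> (nat \<Rightarrow> 'g) \<Rightarrow> (nat \<Rightarrow> 'g)" where
  "cf_embed G n x = (\<lambda>k\<in>{Suc n..}. if k = Suc n then x n \<otimes>\<^bsub>G\<^esub> x (Suc n) else x k)"

primrec cf_embeds :: "('g, 'b) monoid_scheme \<Rightarrow> nat \<Rightarrow> nat \<Rightarrow> (nat \<Rightarrow> 'g) \<Rightarrow> (nat \<Rightarrow> 'g)" where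
  "cf_embeds G n 0 x = x"
| "cf_embeds G n (Suc j) x = cf_embed G (n + j) (cf_embeds G n j x)"

text \<open>The inductive limit: the disjoint union of the $X_n$, modulo identification of points with a
  common image, carrying the final topology for the canonical maps \<open>cf_in n\<close>.\<close>

definition cf_rel ::
    "('g, 'b) monoid_scheme \<Rightarrow> (nat \<Rightarrow> 'g set) \<Rightarrow> (nat \<Rightarrow> 'g set) \<Rightarrow> (nat \<times> (nat \<Rightarrow> 'g)) rel" where
  "cf_rel G C F = {((n, x), (m, y)). x \<in> cf_level C F n \<and> y \<in> cf_level C F m \<and>
     (\<exists>i j. n + i = m + j \<and> cf_embeds G n i x = cf_embeds G m j y)}"

definition cf_in ::
    "('g, 'b) monoid_scheme \<Rightarrow> (nat \<Rightarrow> 'g set) \<Rightarrow> (nat \<Rightarrow> 'g set) \<Rightarrow>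
     nat \<Rightarrow> (nat \<Rightarrow> 'g) \<Rightarrow> (nat \<times> (nat \<Rightarrow> 'g)) set" where
  "cf_in G C F n x = cf_rel G C F `` {(n, x)}"

definition cf_points ::
    "('g, 'b) monoid_scheme \<Rightarrow> (nat \<Rightarrow> 'g set) \<Rightarrow> (nat \<Rightarrow> 'g set) \<Rightarrow>
     (nat \<times> (nat \<Rightarrow> 'g)) set set" where
  "cf_points G C F = (SIGMA n:UNIV. cf_level C F n) // cf_rel G C F"

definition cf_top ::
    "('g, 'b) monoid_scheme \<Rightarrow> (nat \<Rightarrow> 'g set) \<Rightarrow> (nat \<Rightarrow> 'g set) \<Rightarrow>
     (nat \<times> (nat \<Rightarrow> 'g)) set topology" where
  "cf_top G C F = topology (\<lambda>U. U \<subseteq> cf_points G C F \<and>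
     (\<forall>n. openin (cf_level_top C F n) {x \<in> cf_level C F n. cf_in G C F n x \<in> U}))"

lemma openin_cf_top:
  "openin (cf_top G C F) U \<longleftrightarrow> U \<subseteq> cf_points G C F \<and>
     (\<forall>n. openin (cf_level_top C F n) {x \<in> cf_level C F n. cf_in G C F n x \<in> U})"
proof -
  let ?P = "\<lambda>n U. {x \<in> cf_level C F n. cf_in G C F n x \<in> U}"
  have inter: "?P n (S \<inter> T) = ?P n S \<inter> ?P n T" for n S T by auto
  have un: "?P n (\<Union>\<K>) = \<Union>(?P n ` \<K>)" for n \<K> by auto
  have "istopology (\<lambda>U. U \<subseteq> cf_points G C F \<and> (\<forall>n. openin (cf_level_top C F n) (?P n U)))"
    unfolding istopology_def inter un by (auto intro!: openin_Inter openin_Union)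
  then show ?thesis unfolding cf_top_def by (simp add: topology_inverse')
qed

lemma topspace_cf_top: "topspace (cf_top G C F) = cf_points G C F"
proof -
  have "cf_in G C F n x \<in> cf_points G C F" if "x \<in> cf_level C F n" for n x
    using that unfolding cf_in_def cf_points_def by (auto intro!: quotientI)
  then have "{x \<in> cf_level C F n. cf_in G C F n x \<in> cf_points G C F} = cf_level C F n" for n
    by auto
  then have "openin (cf_top G C F) (cf_points G C F)" by (simp add: openin_cf_top)
  then show ?thesis
    by (meson openin_cf_top openin_subset openin_topspace subset_antisym)
qed

definition cf_dom ::
    "('g, 'b) monoid_scheme \<Rightarrow> (nat \<Rightarrow> 'g set) \<Rightarrow> (nat \<Rightarrow> 'g set) \<Rightarrow>
     'g \<Rightarrow> (nat \<times> (nat \<Rightarrow> 'g)) set set" where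
  "cf_dom G C F g =
     (\<Union>n. cf_in G C F n ` {x \<in> cf_level C F n. g \<otimes>\<^bsub>G\<^esub> x n \<in> F n})"

definition cf_dom_all ::
    "('g, 'b) monoid_scheme \<Rightarrow> (nat \<Rightarrow> 'g set) \<Rightarrow> (nat \<Rightarrow> 'g set) \<Rightarrow>
     (nat \<times> (nat \<Rightarrow> 'g)) set set" where
  "cf_dom_all G C F = (\<Inter>g\<in>carrier G. cf_dom G C F g)"

definition cf_act ::
    "('g, 'b) monoid_scheme \<Rightarrow> (nat \<Rightarrow> 'g set) \<Rightarrow> (nat \<Rightarrow> 'g set) \<Rightarrow>
     'g \<Rightarrow> (nat \<times> (nat \<Rightarrow> 'g)) set \<Rightarrow> (nat \<times> (nat \<Rightarrow> 'g)) set" where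
  "cf_act G C F g x = (THE y. \<exists>n. \<exists>z\<in>cf_level C F n.
     x = cf_in G C F n z \<and> g \<otimes>\<^bsub>G\<^esub> z n \<in> F n \<and> y = cf_in G C F n (z(n := g \<otimes>\<^bsub>G\<^esub> z n)))"

definition cf_orbit ::
    "('g, 'b) monoid_scheme \<Rightarrow> (nat \<Rightarrow> 'g set) \<Rightarrow> (nat \<Rightarrow> 'g set) \<Rightarrow>
     (nat \<times> (nat \<Rightarrow> 'g)) set \<Rightarrow> (nat \<times> (nat \<Rightarrow> 'g)) set set" where
  "cf_orbit G C F x = {cf_act G C F g x | g. g \<in> carrier G}"

definition cf_borel ::
    "('g, 'b) monoid_scheme \<Rightarrow> (nat \<Rightarrow> 'g set) \<Rightarrow> (nat \<Rightarrow> 'g set) \<Rightarrow>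
     (nat \<times> (nat \<Rightarrow> 'g)) set measure" where
  "cf_borel G C F = sigma (cf_points G C F) {U. openin (cf_top G C F) U}"

definition cf_level_measure ::
    "(nat \<Rightarrow> 'g set) \<Rightarrow> (nat \<Rightarrow> 'g set) \<Rightarrow> nat \<Rightarrow> ('g \<times> (nat \<Rightarrow> 'g)) measure" where
  "cf_level_measure C F n =
     point_measure (F n) (\<lambda>_. ennreal (1 / real (cf_p C n))) \<Otimes>\<^sub>M
     (\<Pi>\<^sub>M k\<in>{n<..}. uniform_count_measure (C k))"

definition radon_on :: "'a topology \<Rightarrow> 'a measure \<Rightarrow> bool" where
  "radon_on X M \<longleftrightarrow>
     (\<forall>K. compactin X K \<longrightarrow> emeasure M K < \<infinity>) \<and>
     (\<forall>B\<in>sets M. emeasure M B = (SUP K\<in>{K. compactin X K \<and> K \<subseteq> B}. emeasure M K))"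

definition cf_haar ::
    "('g, 'b) monoid_scheme \<Rightarrow> (nat \<Rightarrow> 'g set) \<Rightarrow> (nat \<Rightarrow> 'g set) \<Rightarrow>
     (nat \<times> (nat \<Rightarrow> 'g)) set measure \<Rightarrow> bool" where
  "cf_haar G C F M \<longleftrightarrow>
     sets M = sets (cf_borel G C F) \<and> sigma_finite_measure M \<and> radon_on (cf_top G C F) M \<and>
     (\<forall>n. let S = cf_in G C F n ` cf_level C F n in
        restrict_space M S =
        distr (cf_level_measure C F n) (restrict_space (cf_borel G C F) S)
          (\<lambda>(f, c). cf_in G C F n (c(n := f))))"

text \<open>The orbit equivalence \<open>cf_phi\<close> below is built by finite searches from enumerations \<open>Fl n\<close>,
  \<open>Cl n\<close> of the finite sets of the two sequences and from the constant \<open>c\<close>. If $D = c D'$ then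
  $1 \in D$ forces \<open>c\<close> to be rational, so all conditions that are tested are decidable.\<close>

definition cf_enum ::
    "(nat \<Rightarrow> 'g set) \<Rightarrow> (nat \<Rightarrow> 'g set) \<Rightarrow> (nat \<Rightarrow> 'g list) \<Rightarrow> (nat \<Rightarrow> 'g list) \<Rightarrow> bool" where
  "cf_enum C F Cl Fl \<longleftrightarrow>
     (\<forall>n\<ge>1. distinct (Cl n) \<and> set (Cl n) = C n) \<and> (\<forall>n. distinct (Fl n) \<and> set (Fl n) = F n)"

text \<open>The products $c_{n+1} \cdots c_{n+j}$.\<close>

primrec cf_words ::
    "('g, 'b) monoid_scheme \<Rightarrow> (nat \<Rightarrow> 'g list) \<Rightarrow> nat \<Rightarrow> nat \<Rightarrow> 'g list" where
  "cf_words G Cl n 0 = [\<one>\<^bsub>G\<^esub>]"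
| "cf_words G Cl n (Suc j) =
     map (\<lambda>(w, c). w \<otimes>\<^bsub>G\<^esub> c) (List.product (cf_words G Cl n j) (Cl (Suc (n + j))))"

text \<open>All maps from \<open>xs\<close> to \<open>ys\<close>, as a list of association lists.\<close>

definition all_maps :: "'a list \<Rightarrow> 'b list \<Rightarrow> ('a \<times> 'b) list list" where
  "all_maps xs ys = map (zip xs) (List.n_lists (length xs) ys)"

definition app_map :: "('a \<times> 'b) list \<Rightarrow> 'a \<Rightarrow> 'b" where
  "app_map al x = the (map_of al x)"

text \<open>A level \<open>m\<close> of the target and a multiplicity \<open>s\<close> are admissible for the level \<open>n\<close> of the source
  if a level-\<open>n\<close> cylinder has the \<open>d\<close>-scaled measure of \<open>s\<close> cylinders of level \<open>m\<close>, that is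
  $1/p_n = d\, s/p'_m$, and the target has room for \<open>s\<close> copies of each level-\<open>n\<close> cylinder.\<close>

definition cf_fits ::
    "(nat \<Rightarrow> 'g list) \<Rightarrow> (nat \<Rightarrow> 'g list) \<Rightarrow> (nat \<Rightarrow> 'g list) \<Rightarrow> (nat \<Rightarrow> 'g list) \<Rightarrow>
     real \<Rightarrow> nat \<Rightarrow> nat \<Rightarrow> nat \<Rightarrow> bool" where
  "cf_fits Cl Fl Cl' Fl' d n m s \<longleftrightarrow>
     s \<le> length (Fl' m) \<and>
     real (cf_p (set \<circ> Cl') m) = d * real (cf_p (set \<circ> Cl) n) * real s \<and>
     length (Fl n) * s \<le> length (Fl' m)"

definition search_level :: "(nat \<Rightarrow> nat \<Rightarrow> bool) \<Rightarrow> (nat \<times> nat) option" where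
  "search_level P =
     (if \<exists>m s. P m s then let m = LEAST m. \<exists>s. P m s in Some (m, LEAST s. P m s) else None)"

text \<open>A stage maps the cylinders of level \<open>src\<close> of one space, each cut into \<open>mult\<close> pieces,
  injectively to the cylinders of level \<open>tgt\<close> of the other space. The result of a stage is \<open>None\<close>
  if a search fails; otherwise every choice is the first admissible one.\<close>

record 'g cf_stage =
  src :: nat
  tgt :: nat
  mult :: nat
  inj_map :: "(('g \<times> nat) \<times> 'g) list"

definition cf_first_stage ::
    "(nat \<Rightarrow> 'g list) \<Rightarrow> (nat \<Rightarrow> 'g list) \<Rightarrow> (nat \<Rightarrow> 'g list) \<Rightarrow> (nat \<Rightarrow> 'g list) \<Rightarrow>
     real \<Rightarrow> 'g cf_stage option" where
  "cf_first_stage Cl Fl Cl' Fl' d = do {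
     (m, s) \<leftarrow> search_level (cf_fits Cl Fl Cl' Fl' d 0);
     \<alpha> \<leftarrow> find (\<lambda>\<alpha>. distinct (map snd \<alpha>)) (all_maps (List.product (Fl 0) [0..<s]) (Fl' m));
     Some \<lparr>src = 0, tgt = m, mult = s, inj_map = \<alpha>\<rparr> }"

text \<open>The previous stage \<open>st\<close> goes in the opposite direction. The bijection \<open>\<theta>\<close> identifies the pairs
  of piece numbers of the two stages with the words leading from level \<open>src st\<close> to the new level
  \<open>m\<close>, so that the composition of the two stages is the canonical inclusion of cylinders.\<close>

definition cf_next_stage ::
    "('g, 'b) monoid_scheme \<Rightarrow>
     (nat \<Rightarrow> 'g list) \<Rightarrow> (nat \<Rightarrow> 'g list) \<Rightarrow> (nat \<Rightarrow> 'g list) \<Rightarrow> (nat \<Rightarrow> 'g list) \<Rightarrow>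
     real \<Rightarrow> 'g cf_stage \<Rightarrow> 'g cf_stage option" where
  "cf_next_stage G Cl Fl Cl' Fl' d st = do {
     (m, s) \<leftarrow> search_level (\<lambda>m s. src st < m \<and> cf_fits Cl Fl Cl' Fl' d (tgt st) m s);
     let W = cf_words G Cl' (src st) (m - src st);
     \<theta> \<leftarrow> find (\<lambda>\<theta>. distinct (map snd \<theta>) \<and> set (map snd \<theta>) = set W)
            (all_maps (List.product [0..<mult st] [0..<s]) W);
     \<alpha> \<leftarrow> find (\<lambda>\<alpha>. distinct (map snd \<alpha>) \<and>
              (\<forall>((f, l), a)\<in>set (inj_map st). \<forall>k<s.
                 app_map \<alpha> (a, k) = f \<otimes>\<^bsub>G\<^esub> app_map \<theta> (l, k)))
            (all_maps (List.product (Fl (tgt st)) [0..<s]) (Fl' m));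
     Some \<lparr>src = tgt st, tgt = m, mult = s, inj_map = \<alpha>\<rparr> }"

text \<open>Even stages lead from the first space to the second one, odd stages lead back.\<close>

primrec cf_stages ::
    "('g, 'b) monoid_scheme \<Rightarrow>
     (nat \<Rightarrow> 'g list) \<Rightarrow> (nat \<Rightarrow> 'g list) \<Rightarrow> (nat \<Rightarrow> 'g list) \<Rightarrow> (nat \<Rightarrow> 'g list) \<Rightarrow>
     real \<Rightarrow> nat \<Rightarrow> 'g cf_stage option" where
  "cf_stages G Cl Fl Cl' Fl' c 0 = cf_first_stage Cl Fl Cl' Fl' c"
| "cf_stages G Cl Fl Cl' Fl' c (Suc i) = do {
     st \<leftarrow> cf_stages G Cl Fl Cl' Fl' c i;
     if even i then cf_next_stage G Cl' Fl' Cl Fl (1 / c) st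
     else cf_next_stage G Cl Fl Cl' Fl' c st }"

definition cf_cyl ::
    "('g, 'b) monoid_scheme \<Rightarrow> (nat \<Rightarrow> 'g set) \<Rightarrow> (nat \<Rightarrow> 'g set) \<Rightarrow>
     nat \<Rightarrow> 'g \<Rightarrow> (nat \<times> (nat \<Rightarrow> 'g)) set set" where
  "cf_cyl G C F n f = cf_in G C F n ` {x \<in> cf_level C F n. x n = f}"

text \<open>An odd stage assigns to \<open>(a, l)\<close> the \<open>l\<close>-th of the cylinders \<open>f\<close> of the first space that are to be
  mapped into the cylinder \<open>a\<close> of the second one.\<close>

definition cf_phi ::
    "('g, 'b) monoid_scheme \<Rightarrow>
     (nat \<Rightarrow> 'g list) \<Rightarrow> (nat \<Rightarrow> 'g list) \<Rightarrow> (nat \<Rightarrow> 'g list) \<Rightarrow> (nat \<Rightarrow> 'g list) \<Rightarrow>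
     real \<Rightarrow> (nat \<times> (nat \<Rightarrow> 'g)) set \<Rightarrow> (nat \<times> (nat \<Rightarrow> 'g)) set" where
  "cf_phi G Cl Fl Cl' Fl' c x =
     (THE y. y \<in> cf_points G (set \<circ> Cl') (set \<circ> Fl') \<and>
        (\<forall>i st. odd i \<longrightarrow> cf_stages G Cl Fl Cl' Fl' c i = Some st \<longrightarrow>
           (\<forall>((a, l), f)\<in>set (inj_map st).
              x \<in> cf_cyl G (set \<circ> Cl) (set \<circ> Fl) (tgt st) f \<longrightarrow>
              y \<in> cf_cyl G (set \<circ> Cl') (set \<circ> Fl') (src st) a)))"

end

theory Submission
  imports Defs
begin

text \<open>When $X^G = X$, the orbit of a point is its tail equivalence class, so everything is expressed by the
  cylinders $[f]_n$ with $f \in F_n$: the cylinder $[f]_n$ is the disjoint union of the cylinders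
  $[f w]_{n+j}$ over the words $w \in C_{n+1} \cdots C_{n+j}$, and $\mu([f]_n) = 1/p_n$.

  A homeomorphism that maps orbits to orbits transports $\mu$ to a measure that gives the same value to
  all cylinders of a level, hence to $c\,\widetilde\mu$ for some $c > 0$. Since $\mathcal D$ is generated by
  the measures of the compact open sets, this gives both equalities.

  Conversely, by non-compactness $\mu(X_n) < \mu(X)$ for all $n$, so every level of one space, cut into
  pieces, fits into a level of the other one, with room to spare. This lets the stages go back and forth
  such that two consecutive ones compose to the inclusion of cylinders. A point and its image are then the
  intersections of the even and of the odd members of one alternating sequence of cylinders; points with
  the same tail run through the same piece numbers, so their images have the same tail as well.\<close>

text \<open>Nothing is known about which group elements realize an orbit equivalence, so invariance
  of the transported measure has to be extracted from the orbits alone. An exchange of two cylinders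
  of the second space, conjugated with \<open>\<phi>\<close>, is a homeomorphism of the first space
  that moves each point within its orbit; piecewise it agrees with countably many such exchanges and
  thus preserves \<open>\<mu>\<close>. The constant c is the measure of the preimage of the base
  cylinder of the second space.

  For the converse, two demands must be met at once. Arithmetic: \<open>1 / p_n\<close> lies in
  \<open>c D'\<close>, so a cylinder of level n has the scaled measure of a whole number of
  cylinders of every late level. Room: all these pieces must fit into one level of the target. If
  the scaled measures of the target levels only approached that of the source level from below, they
  never would; strictness excludes this. As the scale factors alternate between c and
  \<open>1 / c\<close>, the pairs of piece numbers of consecutive stages are exactly as many as the
  words between the two levels, so their composition can be made the inclusion.\<close>

primrec cf_W :: "('g, 'b) monoid_scheme \<Rightarrow> (nat \<Rightarrow> 'g set) \<Rightarrow> nat \<Rightarrow> nat \<Rightarrow> 'g set" where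
  "cf_W G C n 0 = {\<one>\<^bsub>G\<^esub>}"
| "cf_W G C n (Suc j) = cf_W G C n j <#>\<^bsub>G\<^esub> C (Suc (n + j))"

text \<open>The word read off the coordinates of a point. It ignores the coordinate n itself, so
  points that differ only in the head have the same tail words.\<close>

primrec cf_tail_word :: "('g, 'b) monoid_scheme \<Rightarrow> nat \<Rightarrow> nat \<Rightarrow> (nat \<Rightarrow> 'g) \<Rightarrow> 'g" where
  "cf_tail_word G n 0 x = \<one>\<^bsub>G\<^esub>"
| "cf_tail_word G n (Suc j) x = cf_tail_word G n j x \<otimes>\<^bsub>G\<^esub> x (Suc (n + j))"

locale cf_space = group G for G :: "('g, 'b) monoid_scheme" (structure) +
  fixes C F :: "nat \<Rightarrow> 'g set"
  assumes cf_sequence: "cf_sequence G C F"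
begin

abbreviation "lev \<equiv> cf_level C F"
abbreviation "inn \<equiv> cf_in G C F"
abbreviation "cyl \<equiv> cf_cyl G C F"
abbreviation "pts \<equiv> cf_points G C F"
abbreviation "emb \<equiv> cf_embeds G"
abbreviation "W \<equiv> cf_W G C"
abbreviation "tw \<equiv> cf_tail_word G"
abbreviation "p \<equiv> cf_p C"
abbreviation "X \<equiv> cf_top G C F"

subsection \<open>Words\<close>

lemma C_finite: "finite (C (Suc n))" and C_carrier: "C (Suc n) \<subseteq> carrier G"
  and C_card: "card (C (Suc n)) > 1" and F_finite: "finite (F n)"
  and F_carrier: "F n \<subseteq> carrier G" and F_0_card: "card (F 0) = 1"
  using cf_sequence unfolding cf_sequence_def by auto

lemma C_closed: "c \<in> C (Suc n) \<Longrightarrow> c \<in> carrier G"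
  using C_carrier by auto

lemma F_closed: "f \<in> F n \<Longrightarrow> f \<in> carrier G"
  using F_carrier by auto

lemma FC: "f \<in> F n \<Longrightarrow> c \<in> C (Suc n) \<Longrightarrow> f \<otimes> c \<in> F (Suc n)"
  using cf_sequence unfolding cf_sequence_def set_mult_def by blast

lemma FC_inj:
  assumes "f \<in> F n" "f' \<in> F n" "c \<in> C (Suc n)" "c' \<in> C (Suc n)" "f \<otimes> c = f' \<otimes> c'"
  shows "f = f' \<and> c = c'"
proof -
  have "c = c'"
  proof (rule ccontr)
    assume "c \<noteq> c'"
    then have "(F n #> c) \<inter> (F n #> c') = {}"
      using cf_sequence assms unfolding cf_sequence_def by blast
    moreover have "f \<otimes> c \<in> F n #> c" using assms(1-4) by (auto simp: r_coset_def)
    moreover have "f \<otimes> c \<in> F n #> c'" unfolding assms(5) using assms(1-4) by (auto simp: r_coset_def)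
    ultimately show False by blast
  qed
  then show ?thesis using assms F_closed C_closed by (metis right_cancel)
qed

lemma F_nonempty: "F n \<noteq> {}"
proof (induction n)
  case 0
  then show ?case using F_0_card by force
next
  case (Suc n)
  obtain c where "c \<in> C (Suc n)" using C_card[of n] by (metis card.empty equals0I not_less_zero)
  with Suc FC show ?case by blast
qed

lemma W_closed: "w \<in> W n j \<Longrightarrow> w \<in> carrier G"
  by (induction j arbitrary: w) (auto simp: set_mult_def C_closed)

lemma W_finite: "finite (W n j)"
proof (induction j)
  case (Suc j)
  have "W n (Suc j) = (\<lambda>(w, c). w \<otimes> c) ` (W n j \<times> C (Suc (n + j)))"
    by (auto simp: set_mult_def)
  then show ?case using Suc C_finite by simp
qed simp

lemma W_SucE:
  assumes "w \<in> W n (Suc j)"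
  obtains v c where "v \<in> W n j" "c \<in> C (Suc (n + j))" "w = v \<otimes> c"
  using assms by (auto simp: set_mult_def)

lemma W_SucI: "v \<in> W n j \<Longrightarrow> c \<in> C (Suc (n + j)) \<Longrightarrow> v \<otimes> c \<in> W n (Suc j)"
  by (auto simp: set_mult_def)

lemma FW: "f \<in> F n \<Longrightarrow> w \<in> W n j \<Longrightarrow> f \<otimes> w \<in> F (n + j)"
proof (induction j arbitrary: w)
  case 0
  then show ?case by (simp add: F_closed)
next
  case (Suc j)
  from Suc.prems(2) obtain v c where "v \<in> W n j" "c \<in> C (Suc (n + j))" "w = v \<otimes> c"
    by (rule W_SucE)
  with Suc FC[of "f \<otimes> v" "n + j" c] show ?case
    by (simp add: m_assoc F_closed W_closed C_closed)
qed

text \<open>Unique factorization: the last letters are compared by \<open>FC_inj\<close>, which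
  applies because \<open>FW\<close> puts the remaining products into \<open>F (n + j)\<close>. Most
  comparisons of cylinders below reduce to this.\<close>

lemma FW_inj:
  "\<lbrakk>f \<in> F n; f' \<in> F n; w \<in> W n j; w' \<in> W n j; f \<otimes> w = f' \<otimes> w'\<rbrakk> \<Longrightarrow> f = f' \<and> w = w'"
proof (induction j arbitrary: w w')
  case 0
  then show ?case by (simp add: F_closed)
next
  case (Suc j)
  obtain v c where vc: "v \<in> W n j" "c \<in> C (Suc (n + j))" "w = v \<otimes> c"
    using Suc.prems(3) by (rule W_SucE)
  obtain v' c' where vc': "v' \<in> W n j" "c' \<in> C (Suc (n + j))" "w' = v' \<otimes> c'"
    using Suc.prems(4) by (rule W_SucE)
  have "(f \<otimes> v) \<otimes> c = (f' \<otimes> v') \<otimes> c'"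
    using Suc.prems vc vc' by (simp add: m_assoc F_closed W_closed C_closed)
  then have "f \<otimes> v = f' \<otimes> v' \<and> c = c'"
    using FC_inj FW Suc.prems(1,2) vc vc' by blast
  then show ?case using Suc vc vc' by blast
qed

lemma W_append: "w \<in> W n i \<Longrightarrow> v \<in> W (n + i) j \<Longrightarrow> w \<otimes> v \<in> W n (i + j)"
proof (induction j arbitrary: v)
  case 0
  then show ?case by (simp add: W_closed)
next
  case (Suc j)
  obtain u c where uc: "u \<in> W (n + i) j" "c \<in> C (Suc (n + i + j))" "v = u \<otimes> c"
    using Suc.prems(2) by (rule W_SucE)
  have "(w \<otimes> u) \<otimes> c \<in> W n (Suc (i + j))"
    using Suc uc W_SucI[of "w \<otimes> u" n "i + j" c] by (simp add: add.assoc)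
  then show ?case using Suc.prems uc by (simp add: m_assoc W_closed C_closed)
qed

lemma p_pos: "p n > 0"
proof -
  have "card (C k) > 0" if "k \<in> {1..n}" for k
    using C_card[of "k - 1"] that by auto
  then show ?thesis unfolding cf_p_def by (simp add: prod_pos)
qed

lemma p_Suc: "p (Suc n) = p n * card (C (Suc n))"
  unfolding cf_p_def by simp

lemma card_W: "p n * card (W n j) = p (n + j)"
proof (induction j)
  case (Suc j)
  have "inj_on (\<lambda>(w, c). w \<otimes> c) (W n j \<times> C (Suc (n + j)))"
  proof (rule inj_onI, clarify)
    fix w c w' c'
    assume a: "w \<in> W n j" "c \<in> C (Suc (n + j))" "w' \<in> W n j" "c' \<in> C (Suc (n + j))"
      "w \<otimes> c = w' \<otimes> c'"
    \<comment> \<open>Disjointness is given only for translates of \<open>F n\<close>, so the two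
      words are compared after multiplying both by some \<open>f\<close> on the left.\<close>
    obtain f where f: "f \<in> F n" using F_nonempty by blast
    have "(f \<otimes> w) \<otimes> c = (f \<otimes> w') \<otimes> c'"
      using a f by (simp add: m_assoc F_closed W_closed C_closed)
    then show "w = w' \<and> c = c'" using FC_inj FW_inj FW a f by blast
  qed
  moreover have "W n (Suc j) = (\<lambda>(w, c). w \<otimes> c) ` (W n j \<times> C (Suc (n + j)))"
    by (auto simp: set_mult_def)
  ultimately have "card (W n (Suc j)) = card (W n j) * card (C (Suc (n + j)))"
    by (simp only: card_image card_cartesian_product)
  then show ?case using Suc p_Suc by (metis add_Suc_right mult.assoc)
qed simp

subsection \<open>Levels and embeddings\<close>

lemma lev_iff:
  "x \<in> lev n \<longleftrightarrow> x \<in> extensional {n..} \<and> x n \<in> F n \<and> (\<forall>k>n. x k \<in> C k)"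
  unfolding cf_level_top_def by (auto simp: topspace_product_topology PiE_iff)

lemma lev_C: "x \<in> lev n \<Longrightarrow> x (Suc (n + j)) \<in> C (Suc (n + j))"
  by (simp add: lev_iff)

lemma lev_upd: "x \<in> lev n \<Longrightarrow> h \<in> F n \<Longrightarrow> x(n := h) \<in> lev n"
  by (auto simp: lev_iff extensional_def)

lemma tw_W: "x \<in> lev n \<Longrightarrow> tw n j x \<in> W n j"
proof (induction j)
  case (Suc j)
  then show ?case using W_SucI lev_C by auto
qed simp

lemma tw_upd: "tw n j (x(n := h)) = tw n j x"
  by (induction j) auto

lemma embed_lev: "x \<in> lev n \<Longrightarrow> cf_embed G n x \<in> lev (Suc n)"
  using FC[of "x n" n "x (Suc n)"] by (auto simp: lev_iff cf_embed_def)

lemma emb_lev: "x \<in> lev n \<Longrightarrow> emb n j x \<in> lev (n + j)"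
  by (induction j) (auto intro: embed_lev)

lemma embed_inj: "inj_on (cf_embed G n) (lev n)"
proof (rule inj_onI)
  fix x y assume xy: "x \<in> lev n" "y \<in> lev n" and e: "cf_embed G n x = cf_embed G n y"
  have e': "cf_embed G n x k = cf_embed G n y k" for k using e by simp
  have 1: "x n \<otimes> x (Suc n) = y n \<otimes> y (Suc n)"
    using e'[of "Suc n"] by (simp add: cf_embed_def)
  have 2: "x k = y k" if "k > Suc n" for k
    using e'[of k] that by (auto simp: cf_embed_def)
  have "x n = y n \<and> x (Suc n) = y (Suc n)"
    using FC_inj[of "x n" n "y n", OF _ _ _ _ 1] xy by (simp add: lev_iff)
  with 2 have "x k = y k" if "k \<in> {n..}" for k
    using that by (metis Suc_lessI atLeast_iff le_neq_implies_less)
  moreover have "x \<in> extensional {n..}" "y \<in> extensional {n..}" using xy by (auto simp: lev_iff)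
  ultimately show "x = y" by (meson extensionalityI)
qed

lemma emb_inj: "x \<in> lev n \<Longrightarrow> y \<in> lev n \<Longrightarrow> emb n j x = emb n j y \<Longrightarrow> x = y"
proof (induction j)
  case (Suc j)
  then show ?case using inj_onD[OF embed_inj _ emb_lev emb_lev] by simp
qed simp

lemma emb_add: "emb n (i + j) x = emb (n + i) j (emb n i x)"
  by (induction j) (auto simp: add.assoc)

lemma emb_tail: "k > n + j \<Longrightarrow> emb n j x k = x k"
  by (induction j) (auto simp: cf_embed_def)

lemma emb_head: "x \<in> lev n \<Longrightarrow> emb n j x (n + j) = x n \<otimes> tw n j x"
proof (induction j)
  case 0
  then have "x n \<in> carrier G" using F_closed lev_iff by blast
  then show ?case by simp
next
  case (Suc j)
  have "emb n (Suc j) x (n + Suc j) = emb n j x (n + j) \<otimes> x (Suc (n + j))"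
    by (simp add: cf_embed_def emb_tail)
  also have "\<dots> = x n \<otimes> tw n (Suc j) x"
    using Suc C_closed[OF lev_C[of x n j]] W_closed[OF tw_W[of x n j]] F_closed[of "x n" n]
    by (simp add: lev_iff m_assoc)
  finally show ?case .
qed

lemma emb_head_Suc: "emb n (Suc j) x (n + Suc j) = emb n j x (n + j) \<otimes> x (Suc (n + j))"
  by (simp add: cf_embed_def emb_tail)

text \<open>The head of the embedded point is the product of the old head and the next j letters,
  and unique factorization recovers all of them. Below n both points are
  \<open>undefined\<close>.\<close>

lemma heads_eq_agree:
  assumes x: "x \<in> lev n" and y: "y \<in> lev n"
  shows "emb n j x (n + j) = emb n j y (n + j) \<Longrightarrow> k \<le> n + j \<Longrightarrow> x k = y k"
proof (induction j)
  case 0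
  then show ?case using x y by (cases "k = n") (auto simp: lev_iff extensional_def)
next
  case (Suc j)
  have "emb n j x (n + j) \<in> F (n + j)" "emb n j y (n + j) \<in> F (n + j)"
    using emb_lev[OF x, of j] emb_lev[OF y, of j] by (simp_all add: lev_iff)
  then have "emb n j x (n + j) = emb n j y (n + j) \<and> x (Suc (n + j)) = y (Suc (n + j))"
    using FC_inj lev_C[OF x] lev_C[OF y] Suc.prems(1) unfolding emb_head_Suc by blast
  then show ?case using Suc by (cases "k = Suc (n + j)") auto
qed

lemma agree_heads_eq:
  assumes "\<And>k. k \<le> n + j \<Longrightarrow> x k = y k"
  shows "emb n j x (n + j) = emb n j y (n + j)"
  using assms
proof (induction j)
  case (Suc j)
  then show ?case by (simp del: cf_embeds.simps add_Suc_right add: emb_head_Suc)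
qed simp

lemma eq_if_heads_eq:
  assumes "x \<in> lev n" "y \<in> lev n" and h: "\<And>j. emb n j x (n + j) = emb n j y (n + j)"
  shows "x = y"
proof
  fix k show "x k = y k" using heads_eq_agree[OF assms(1,2) h, of k k] by simp
qed

subsection \<open>Points\<close>

lemma rel_equiv: "equiv (SIGMA n:UNIV. lev n) (cf_rel G C F)"
proof (rule equivI)
  show "cf_rel G C F \<subseteq> (SIGMA n:UNIV. lev n) \<times> (SIGMA n:UNIV. lev n)"
    by (auto simp: cf_rel_def)
  show "refl_on (SIGMA n:UNIV. lev n) (cf_rel G C F)"
    by (auto simp: refl_on_def cf_rel_def)
  show "sym (cf_rel G C F)"
    unfolding sym_def cf_rel_def by (auto; metis)
  show "trans (cf_rel G C F)"
  proof (rule transI, clarify)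
    fix a x b y c z
    assume "((a, x), (b, y)) \<in> cf_rel G C F" "((b, y), (c, z)) \<in> cf_rel G C F"
    then obtain i j k l where lv: "x \<in> lev a" "y \<in> lev b" "z \<in> lev c"
      and 1: "a + i = b + j" "emb a i x = emb b j y" and 2: "b + k = c + l" "emb b k y = emb c l z"
      by (auto simp: cf_rel_def)
    \<comment> \<open>Both identifications are pushed to the common level a + i + k = b + j + k = c
      + l + j.\<close>
    have "emb a (i + k) x = emb c (l + j) z"
    proof -
      have "emb a (i + k) x = emb b (j + k) y" by (simp add: emb_add 1)
      also have "\<dots> = emb b (k + j) y" by (simp add: add.commute)
      also have "\<dots> = emb c (l + j) z" by (simp only: emb_add[of b] emb_add[of c] 2)
      finally show ?thesis .
    qed
    moreover have "a + (i + k) = c + (l + j)" using 1 2 by simp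
    ultimately show "((a, x), (c, z)) \<in> cf_rel G C F" using lv unfolding cf_rel_def by blast
  qed
qed

lemma in_eq_iff:
  assumes "x \<in> lev n" "y \<in> lev m"
  shows "inn n x = inn m y \<longleftrightarrow> (\<exists>i j. n + i = m + j \<and> emb n i x = emb m j y)"
  unfolding cf_in_def using eq_equiv_class_iff[OF rel_equiv, of "(n, x)" "(m, y)"] assms
  by (auto simp: cf_rel_def)

lemma in_emb:
  assumes "x \<in> lev n"
  shows "inn (n + j) (emb n j x) = inn n x"
proof -
  have "n + j + 0 = n + j \<and> emb (n + j) 0 (emb n j x) = emb n j x" by simp
  then show ?thesis using in_eq_iff[OF emb_lev[OF assms] assms] by blast
qed

lemma in_inj: "x \<in> lev n \<Longrightarrow> y \<in> lev n \<Longrightarrow> inn n x = inn n y \<Longrightarrow> x = y"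
  using in_eq_iff[of x n y n] emb_inj by auto

lemma pts_eq: "pts = (\<Union>n. inn n ` lev n)"
  unfolding cf_points_def quotient_def cf_in_def by force

lemma in_pts: "x \<in> lev n \<Longrightarrow> inn n x \<in> pts"
  by (auto simp: pts_eq)

lemma in_lev_mono: "n \<le> m \<Longrightarrow> inn n ` lev n \<subseteq> inn m ` lev m"
proof
  fix y assume "n \<le> m" "y \<in> inn n ` lev n"
  then obtain x j where "x \<in> lev n" "y = inn n x" "m = n + j" by (auto simp: le_iff_add)
  then show "y \<in> inn m ` lev m" using in_emb emb_lev by (metis imageI)
qed

text \<open>Representatives are provided at every late level, so that several points can be
  represented at one common level.\<close>

lemma pts_rep:
  assumes "x \<in> pts"
  obtains N where "\<And>n. n \<ge> N \<Longrightarrow> \<exists>z\<in>lev n. x = inn n z"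
proof -
  obtain N where "x \<in> inn N ` lev N" using assms by (auto simp: pts_eq)
  then have "\<exists>z\<in>lev n. x = inn n z" if "n \<ge> N" for n using in_lev_mono[OF that] by blast
  then show ?thesis using that by blast
qed

subsection \<open>Cylinders\<close>

lemma cylI: "z \<in> lev n \<Longrightarrow> inn n z \<in> cyl n (z n)"
  by (auto simp: cf_cyl_def)

lemma cylE:
  assumes "x \<in> cyl n f"
  obtains z where "z \<in> lev n" "x = inn n z" "z n = f" "f \<in> F n"
  using assms by (auto simp: cf_cyl_def lev_iff)

lemma cyl_F: "x \<in> cyl n f \<Longrightarrow> f \<in> F n"
  by (auto simp: cf_cyl_def lev_iff)

lemma cyl_pts: "cyl n f \<subseteq> pts"
  by (auto simp: cf_cyl_def in_pts)

lemma cyl_cover: "(\<Union>f\<in>F n. cyl n f) = inn n ` lev n"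
  by (auto simp: cf_cyl_def lev_iff)

lemma cyl_unique: "x \<in> cyl n f \<Longrightarrow> x \<in> cyl n f' \<Longrightarrow> f = f'"
  by (elim cylE) (use in_inj in blast)

lemma pts_cyl:
  assumes "x \<in> pts"
  obtains N where "\<And>n. n \<ge> N \<Longrightarrow> \<exists>f\<in>F n. x \<in> cyl n f"
proof -
  obtain N where N: "\<And>n. n \<ge> N \<Longrightarrow> \<exists>z\<in>lev n. x = inn n z" using pts_rep[OF assms] by blast
  have "\<exists>f\<in>F n. x \<in> cyl n f" if "n \<ge> N" for n
    using N[OF that] cylI cyl_F by blast
  then show ?thesis using that by blast
qed

lemma cyl_tail: "z \<in> lev n \<Longrightarrow> inn n z \<in> cyl (n + j) (z n \<otimes> tw n j z)"
  using cylI[OF emb_lev, of z n j] in_emb[of z n j] emb_head[of z n j] by simp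

lemma cyl_sub_Suc: "c \<in> C (Suc n) \<Longrightarrow> f \<in> F n \<Longrightarrow> cyl (Suc n) (f \<otimes> c) \<subseteq> cyl n f"
proof
  fix x assume c: "c \<in> C (Suc n)" and f: "f \<in> F n" and x: "x \<in> cyl (Suc n) (f \<otimes> c)"
  obtain y where y: "y \<in> lev (Suc n)" "x = inn (Suc n) y" "y (Suc n) = f \<otimes> c"
    using x by (rule cylE)
  \<comment> \<open>\<open>z\<close> splits the head of \<open>y\<close> back into its factors
    \<open>f\<close> and \<open>c\<close>; one embedding step returns \<open>y\<close>.\<close>
  define z where "z = y(n := f, Suc n := c)"
  have z: "z \<in> lev n" using y c f by (auto simp: z_def lev_iff extensional_def)
  have "emb n 1 z = y"
  proof
    fix k
    show "emb n 1 z k = y k"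
      using y by (auto simp: z_def cf_embed_def lev_iff extensional_def)
  qed
  then have "x = inn n z" using in_emb[OF z, of 1] y by simp
  then show "x \<in> cyl n f" using cylI[OF z] by (simp add: z_def)
qed

lemma cyl_sub: "w \<in> W n j \<Longrightarrow> f \<in> F n \<Longrightarrow> cyl (n + j) (f \<otimes> w) \<subseteq> cyl n f"
proof (induction j arbitrary: w)
  case 0
  then show ?case by (simp add: F_closed)
next
  case (Suc j)
  obtain v c where vc: "v \<in> W n j" "c \<in> C (Suc (n + j))" "w = v \<otimes> c"
    using Suc.prems(1) by (rule W_SucE)
  have "cyl (Suc (n + j)) ((f \<otimes> v) \<otimes> c) \<subseteq> cyl (n + j) (f \<otimes> v)"
    using cyl_sub_Suc vc FW Suc.prems by blast
  then show ?case using Suc vc by (simp add: m_assoc F_closed W_closed C_closed) blast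
qed

lemma cyl_refine: "f \<in> F n \<Longrightarrow> cyl n f = (\<Union>w\<in>W n j. cyl (n + j) (f \<otimes> w))"
proof (intro equalityI subsetI)
  fix x assume "x \<in> cyl n f"
  then obtain z where z: "z \<in> lev n" "x = inn n z" "z n = f" by (rule cylE)
  then have "x \<in> cyl (n + j) (f \<otimes> tw n j z)" using cyl_tail by blast
  then show "x \<in> (\<Union>w\<in>W n j. cyl (n + j) (f \<otimes> w))" using tw_W[OF z(1)] by blast
qed (use cyl_sub in blast)

lemma cyl_refineE:
  assumes "x \<in> cyl n f"
  obtains w where "w \<in> W n j" "x \<in> cyl (n + j) (f \<otimes> w)"
  using assms cyl_refine[OF cyl_F[OF assms], of j] by blast

text \<open>Cylinders form a tree: the word that refines \<open>f\<close> around \<open>x\<close>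
  has to give \<open>h\<close>, since \<open>x\<close> lies in at most one cylinder of each
  level.\<close>

lemma cyl_nested:
  assumes "x \<in> cyl n f" "x \<in> cyl m h" "n \<le> m"
  obtains w where "w \<in> W n (m - n)" "h = f \<otimes> w" "cyl m h \<subseteq> cyl n f"
proof -
  obtain w where w: "w \<in> W n (m - n)" "x \<in> cyl (n + (m - n)) (f \<otimes> w)"
    using cyl_refineE[OF assms(1)] by blast
  then have "h = f \<otimes> w" using cyl_unique assms by (metis le_add_diff_inverse)
  then show ?thesis using that w cyl_sub[OF w(1) cyl_F[OF assms(1)]] assms(3) by simp
qed

lemma cyl_nonempty: "f \<in> F n \<Longrightarrow> cyl n f \<noteq> {}"
proof -
  assume f: "f \<in> F n"
  define z where "z k = (if k < n then undefined else if k = n then f else SOME c. c \<in> C k)" for k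
  have "(SOME c. c \<in> C k) \<in> C k" if "k > n" for k
  proof -
    have "C k \<noteq> {}" using C_card[of "k - 1"] that by (metis Suc_diff_1 bot_nat_0.not_eq_extremum card.empty not_less_zero)
    then show ?thesis by (simp add: some_in_eq)
  qed
  then have "z \<in> lev n" using f by (auto simp: z_def lev_iff extensional_def)
  then have "inn n z \<in> cyl n f" using cylI by (fastforce simp: z_def)
  then show ?thesis by blast
qed

text \<open>Cofinally many common cylinders suffice: a common cylinder of a late level forces a
  common one at each earlier level where both points are represented, and these determine all
  coordinates.\<close>

lemma separation:
  assumes "x \<in> pts" "y \<in> pts" and i: "\<And>N. \<exists>n\<ge>N. \<exists>f. x \<in> cyl n f \<and> y \<in> cyl n f"
  shows "x = y"
proof -
  obtain N where N: "\<And>n. n \<ge> N \<Longrightarrow> \<exists>z\<in>lev n. x = inn n z" using pts_rep assms(1) by blast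
  obtain M where M: "\<And>n. n \<ge> M \<Longrightarrow> \<exists>z\<in>lev n. y = inn n z" using pts_rep assms(2) by blast
  obtain n u v where uv: "u \<in> lev n" "x = inn n u" "v \<in> lev n" "y = inn n v"
    using N[of "max N M"] M[of "max N M"] by auto
  have "u = v"
  proof (rule eq_if_heads_eq[OF uv(1,3)])
    fix j
    have a: "x \<in> cyl (n + j) (emb n j u (n + j))" "y \<in> cyl (n + j) (emb n j v (n + j))"
      using cylI[OF emb_lev[OF uv(1)], of j] cylI[OF emb_lev[OF uv(3)], of j]
      by (simp_all add: in_emb uv)
    obtain m f where m: "m \<ge> n + j" "x \<in> cyl m f" "y \<in> cyl m f" using i by blast
    have "y \<in> cyl (n + j) (emb n j u (n + j))"
      using cyl_nested[OF a(1) m(2,1)] m(3) by blast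
    then show "emb n j u (n + j) = emb n j v (n + j)" using cyl_unique a(2) by blast
  qed
  then show ?thesis using uv by simp
qed

subsection \<open>Topology\<close>

text \<open>A basic open box restricts finitely many coordinates, all of index at most some N; as
  the factors are discrete, these coordinates may be fixed completely.\<close>

lemma openin_lev:
  "openin (cf_level_top C F n) S \<longleftrightarrow>
     S \<subseteq> lev n \<and> (\<forall>x\<in>S. \<exists>N. \<forall>y\<in>lev n. (\<forall>k\<le>N. y k = x k) \<longrightarrow> y \<in> S)" (is "?L \<longleftrightarrow> ?R")
proof
  let ?T = "\<lambda>k. discrete_topology (if k = n then F n else C k)"
  assume L: ?L
  then have "S \<subseteq> lev n" by (rule openin_subset)
  moreover have "\<exists>N. \<forall>y\<in>lev n. (\<forall>k\<le>N. y k = x k) \<longrightarrow> y \<in> S" if x: "x \<in> S" for x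
  proof -
    obtain U where U: "finite {k \<in> {n..}. U k \<noteq> topspace (?T k)}" "x \<in> Pi\<^sub>E {n..} U" "Pi\<^sub>E {n..} U \<subseteq> S"
      using L x unfolding cf_level_top_def openin_product_topology_alt by meson
    obtain N where "{k \<in> {n..}. U k \<noteq> topspace (?T k)} \<subseteq> {..N}"
      using U(1) finite_nat_iff_bounded_le by blast
    then have N: "\<And>k. k \<ge> n \<Longrightarrow> U k \<noteq> topspace (?T k) \<Longrightarrow> k \<le> N" by blast
    have "y \<in> S" if y: "y \<in> lev n" "\<forall>k\<le>N. y k = x k" for y
    proof -
      have "y k \<in> U k" if "k \<ge> n" for k
        using N[OF that] y U(2) that by (cases "k \<le> N") (auto simp: cf_level_top_def PiE_iff)
      then have "y \<in> Pi\<^sub>E {n..} U" using y(1) by (auto simp: PiE_iff lev_iff)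
      then show ?thesis using U(3) by blast
    qed
    then show ?thesis by blast
  qed
  ultimately show ?R by blast
next
  let ?T = "\<lambda>k. discrete_topology (if k = n then F n else C k)"
  assume R: ?R
  show ?L unfolding cf_level_top_def openin_product_topology_alt
  proof (intro ballI)
    fix x assume x: "x \<in> S"
    with R obtain N where N: "\<And>y. y \<in> lev n \<Longrightarrow> (\<And>k. k \<le> N \<Longrightarrow> y k = x k) \<Longrightarrow> y \<in> S" by blast
    define U where "U k = (if k \<le> N then {x k} else topspace (?T k))" for k
    have xl: "x \<in> Pi\<^sub>E {n..} (\<lambda>k. topspace (?T k))" using x R by (auto simp: cf_level_top_def)
    have "{k \<in> {n..}. U k \<noteq> topspace (?T k)} \<subseteq> {..N}" by (auto simp: U_def split: if_splits)
    then have 1: "finite {k \<in> {n..}. U k \<noteq> topspace (?T k)}" using finite_subset by blast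
    have xk: "x k \<in> topspace (?T k)" if "k \<in> {n..}" for k using xl that by (rule PiE_mem)
    have 2: "\<forall>k\<in>{n..}. openin (?T k) (U k)"
    proof
      fix k assume "k \<in> {n..}"
      from xk[OF this] show "openin (?T k) (U k)" by (auto simp: U_def split: if_splits)
    qed
    have 3: "x \<in> Pi\<^sub>E {n..} U" using xl xk by (simp add: U_def PiE_iff)
    have 4: "Pi\<^sub>E {n..} U \<subseteq> S"
    proof
      fix y assume y: "y \<in> Pi\<^sub>E {n..} U"
      have "y k \<in> topspace (?T k)" if "k \<ge> n" for k
        using y xl that by (cases "k \<le> N") (force simp: U_def PiE_iff)+
      then have yl: "y \<in> lev n" using y by (auto simp: cf_level_top_def PiE_iff)
      have "y k = x k" if "k \<le> N" for k
      proof (cases "n \<le> k")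
        case True
        then show ?thesis using y that by (force simp: U_def PiE_iff)
      next
        case False
        then show ?thesis using y xl by (simp add: PiE_iff extensional_def)
      qed
      then show "y \<in> S" using N yl by blast
    qed
    show "\<exists>U. finite {k \<in> {n..}. U k \<noteq> topspace (?T k)} \<and> (\<forall>k\<in>{n..}. openin (?T k) (U k)) \<and>
        x \<in> Pi\<^sub>E {n..} U \<and> Pi\<^sub>E {n..} U \<subseteq> S"
      using 1 2 3 4 by blast
  qed
qed

text \<open>The cylinder is available at arbitrarily late levels, so later arguments can start above
  any given level. For building open sets, \<open>openin_X_I\<close> accepts any level.\<close>

lemma openin_X:
  "openin X U \<longleftrightarrow> U \<subseteq> pts \<and> (\<forall>x\<in>U. \<forall>N. \<exists>n\<ge>N. \<exists>f. x \<in> cyl n f \<and> cyl n f \<subseteq> U)" (is "?L \<longleftrightarrow> ?R")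
proof
  assume L: ?L
  then have U: "U \<subseteq> pts" by (simp add: openin_cf_top)
  moreover have "\<exists>n\<ge>N. \<exists>f. x \<in> cyl n f \<and> cyl n f \<subseteq> U" if x: "x \<in> U" for x N
  proof -
    obtain M where M: "\<And>m. m \<ge> M \<Longrightarrow> \<exists>z\<in>lev m. x = inn m z" using pts_rep x U by blast
    obtain m z where m: "m \<ge> N" and z: "z \<in> lev m" "x = inn m z" using M[OF max.cobounded2] max.cobounded1 by blast
    have "openin (cf_level_top C F m) {u \<in> lev m. inn m u \<in> U}" using L by (simp add: openin_cf_top)
    then obtain K where K: "\<And>u. u \<in> lev m \<Longrightarrow> (\<And>k. k \<le> K \<Longrightarrow> u k = z k) \<Longrightarrow> inn m u \<in> U"
      using z x unfolding openin_lev by blast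
    \<comment> \<open>Lying in the cylinder of \<open>x\<close> of level m + K forces agreement with
      \<open>z\<close> up to coordinate K, so this cylinder is contained in U.\<close>
    have zc: "x \<in> cyl (m + K) (emb m K z (m + K))"
      using cylI[OF emb_lev[OF z(1)]] by (simp add: in_emb z)
    have "y \<in> U" if y: "y \<in> cyl (m + K) (emb m K z (m + K))" for y
    proof -
      have "cyl (m + K) (emb m K z (m + K)) \<subseteq> cyl m (z m)"
        using cyl_nested[OF _ zc] cylI[OF z(1)] z by (metis le_add1)
      then obtain u where u: "u \<in> lev m" "y = inn m u" using y by (blast elim: cylE)
      have "y \<in> cyl (m + K) (emb m K u (m + K))"
        using cylI[OF emb_lev[OF u(1)]] by (simp add: in_emb u)
      then have "emb m K u (m + K) = emb m K z (m + K)" using y cyl_unique by blast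
      then have "u k = z k" if "k \<le> K" for k using heads_eq_agree u z that by simp
      then show ?thesis using K u by blast
    qed
    then show ?thesis using zc m by (meson subsetI trans_le_add1)
  qed
  ultimately show ?R by blast
next
  assume R: ?R
  have "\<exists>N. \<forall>u\<in>lev m. (\<forall>k\<le>N. u k = z k) \<longrightarrow> inn m u \<in> U" if z: "z \<in> lev m" "inn m z \<in> U" for m z
  proof -
    obtain n f where nf: "n \<ge> m" "inn m z \<in> cyl n f" "cyl n f \<subseteq> U" using R z by blast
    then obtain j where n: "n = m + j" using le_Suc_ex by blast
    have "inn m u \<in> U" if u: "u \<in> lev m" "\<forall>k\<le>n. u k = z k" for u
    proof -
      have "emb m j u (m + j) = emb m j z (m + j)" using u(2) n agree_heads_eq by blast
      then have "inn m u \<in> cyl n (emb m j z n)"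
        using cylI[OF emb_lev[OF u(1)], of j] by (simp add: in_emb u n)
      moreover have "inn m z \<in> cyl n (emb m j z n)"
        using cylI[OF emb_lev[OF z(1)], of j] by (simp add: in_emb z n)
      ultimately show ?thesis using nf cyl_unique by blast
    qed
    then show ?thesis by blast
  qed
  then have "openin (cf_level_top C F m) {u \<in> lev m. inn m u \<in> U}" for m
    unfolding openin_lev by (smt (verit, ccfv_threshold) mem_Collect_eq subsetI)
  then show ?L using R by (simp add: openin_cf_top)
qed

lemma openin_X_I:
  assumes "U \<subseteq> pts" "\<And>x. x \<in> U \<Longrightarrow> \<exists>n f. x \<in> cyl n f \<and> cyl n f \<subseteq> U"
  shows "openin X U"
  unfolding openin_X
proof (intro conjI ballI allI)
  fix x N assume "x \<in> U"
  then obtain n f where nf: "x \<in> cyl n f" "cyl n f \<subseteq> U" using assms by blast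
  obtain w where "w \<in> W n N" "x \<in> cyl (n + N) (f \<otimes> w)" using nf(1) by (rule cyl_refineE)
  then show "\<exists>n\<ge>N. \<exists>f. x \<in> cyl n f \<and> cyl n f \<subseteq> U"
    using cyl_sub[OF _ cyl_F[OF nf(1)]] nf(2) by (meson le_add2 order_trans)
qed (use assms in blast)

lemma topspace_X: "topspace X = pts"
  by (rule topspace_cf_top)

lemma cyl_open: "openin X (cyl n f)"
  by (rule openin_X_I) (use cyl_pts in blast)+

text \<open>A point outside a cylinder of level n has a cylinder of some level at least n around it,
  and two cylinders that meet are nested, so the later one stays outside.\<close>

lemma cyl_closed: "closedin X (cyl n f)"
  unfolding closedin_def topspace_X
proof (intro conjI cyl_pts openin_X_I)
  fix y assume y: "y \<in> pts - cyl n f"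
  obtain N where N: "\<And>m. m \<ge> N \<Longrightarrow> \<exists>f\<in>F m. y \<in> cyl m f" using pts_cyl y by blast
  obtain m h where m: "m \<ge> n" "y \<in> cyl m h" using N[OF max.cobounded2] max.cobounded1 by blast
  have "x \<notin> cyl n f" if "x \<in> cyl m h" for x
    using cyl_nested[OF _ that m(1), of f] m y by blast
  then have "cyl m h \<subseteq> pts - cyl n f" using cyl_pts by blast
  then show "\<exists>n' f'. y \<in> cyl n' f' \<and> cyl n' f' \<subseteq> pts - cyl n f" using m(2) by blast
qed auto

lemma separationE:
  assumes "x \<in> pts" "y \<in> pts" "x \<noteq> y"
  obtains N where "\<And>n. n \<ge> N \<Longrightarrow> \<exists>f h. f \<noteq> h \<and> x \<in> cyl n f \<and> y \<in> cyl n h"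
proof -
  obtain K where K: "\<And>n f. n \<ge> K \<Longrightarrow> \<not> (x \<in> cyl n f \<and> y \<in> cyl n f)"
    using separation assms by metis
  obtain N where N: "\<And>n. n \<ge> N \<Longrightarrow> \<exists>f\<in>F n. x \<in> cyl n f" using pts_cyl assms by blast
  obtain M where M: "\<And>n. n \<ge> M \<Longrightarrow> \<exists>f\<in>F n. y \<in> cyl n f" using pts_cyl assms by blast
  have "\<exists>f h. f \<noteq> h \<and> x \<in> cyl n f \<and> y \<in> cyl n h" if "n \<ge> max K (max N M)" for n
    using K[of n] N[of n] M[of n] that by force
  then show ?thesis using that by blast
qed

lemma Hausdorff: "Hausdorff_space X"
  unfolding Hausdorff_space_def topspace_X
proof clarify
  fix x y assume "x \<in> pts" "y \<in> pts" "x \<noteq> y"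
  then obtain n f h where "f \<noteq> h" "x \<in> cyl n f" "y \<in> cyl n h" using separationE by (metis order_refl)
  moreover have "disjnt (cyl n f) (cyl n h)"
    using \<open>f \<noteq> h\<close> cyl_unique unfolding disjnt_def by blast
  ultimately show "\<exists>U V. openin X U \<and> openin X V \<and> x \<in> U \<and> y \<in> V \<and> disjnt U V"
    using cyl_open by blast
qed

lemma continuous_in: "continuous_map (cf_level_top C F n) X (inn n)"
  unfolding continuous_map_def topspace_X by (auto simp: in_pts openin_cf_top)

lemma compact_lev: "compact_space (cf_level_top C F n)"
proof -
  have "finite (C k)" if "n < k" for k using C_finite[of "k - 1"] that by simp
  then show ?thesis unfolding cf_level_top_def compact_space_product_topology
    by (auto simp: compact_space_discrete_topology F_finite)
qed

lemma compact_in_lev: "compactin X (inn n ` lev n)"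
  using image_compactin[OF _ continuous_in] compact_lev compact_space_def by blast

lemma compact_cyl: "compactin X (cyl n f)"
proof -
  have "cyl n f \<subseteq> inn n ` lev n" by (auto simp: cf_cyl_def)
  then show ?thesis using closed_compactin[OF compact_in_lev _ cyl_closed] by blast
qed

lemma nested_cylinders:
  assumes ne: "\<And>j. cyl (m j) (a j) \<noteq> {}" and dec: "\<And>j. cyl (m (Suc j)) (a (Suc j)) \<subseteq> cyl (m j) (a j)"
  obtains x where "x \<in> pts" "\<And>j. x \<in> cyl (m j) (a j)"
proof -
  let ?K = "\<lambda>j. cyl (m j) (a j)"
  let ?T = "subtopology X (?K 0)"
  have d: "decseq ?K" using dec by (simp add: decseq_Suc_iff)
  then have sub: "?K j \<subseteq> ?K 0" for j by (simp add: decseq_def)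
  have "compact_space ?T" using compact_cyl by (simp add: compact_space_subtopology)
  moreover have "closedin ?T (?K j)" for j
    by (rule closedin_subset_topspace[OF cyl_closed sub])
  ultimately have "(\<Inter>j. ?K j) \<noteq> {}" using ne d by (rule compact_space_imp_nest)
  then obtain x where x: "\<And>j. x \<in> ?K j" by blast
  then have "x \<in> pts" using cyl_pts by (meson subsetD)
  then show ?thesis using that x by simp
qed

text \<open>Compactness gives a finite cover by cylinders inside K; refining them to any level m
  above those that occur expresses K at level m.\<close>

lemma compact_open_cylinders:
  assumes K: "compactin X K" "openin X K"
  obtains N where "\<And>m. m \<ge> N \<Longrightarrow> K = (\<Union>h\<in>{h \<in> F m. cyl m h \<subseteq> K}. cyl m h)"
proof -
  let ?U = "{(n, f). cyl n f \<subseteq> K}"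
  have "K \<subseteq> \<Union>((\<lambda>(n, f). cyl n f) ` ?U)"
  proof
    fix x assume "x \<in> K"
    then obtain n f where "x \<in> cyl n f" "cyl n f \<subseteq> K" using K(2) unfolding openin_X by blast
    then show "x \<in> \<Union>((\<lambda>(n, f). cyl n f) ` ?U)" by blast
  qed
  moreover have "\<forall>V\<in>(\<lambda>(n, f). cyl n f) ` ?U. openin X V" using cyl_open by auto
  ultimately obtain \<F> where \<F>: "finite \<F>" "\<F> \<subseteq> (\<lambda>(n, f). cyl n f) ` ?U" "K \<subseteq> \<Union>\<F>"
    using K(1) unfolding compactin_def by (metis (no_types, lifting))
  obtain V where V: "finite V" "V \<subseteq> ?U" "\<F> = (\<lambda>(n, f). cyl n f) ` V"
    using finite_subset_image[OF \<F>(1,2)] by metis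
  obtain N where N: "\<And>n f. (n, f) \<in> V \<Longrightarrow> n \<le> N"
    using finite_nat_set_iff_bounded_le[of "fst ` V"] V(1) by force
  have "K = (\<Union>h\<in>{h \<in> F m. cyl m h \<subseteq> K}. cyl m h)" if m: "m \<ge> N" for m
  proof (intro equalityI subsetI)
    fix x assume "x \<in> K"
    then obtain n f where nf: "(n, f) \<in> V" "x \<in> cyl n f" using \<F> V by blast
    then have "n \<le> m" using N m by force
    then obtain j where j: "m = n + j" using le_Suc_ex by blast
    obtain w where w: "w \<in> W n j" "x \<in> cyl m (f \<otimes> w)" using cyl_refineE[OF nf(2), of j] j by blast
    then have "cyl m (f \<otimes> w) \<subseteq> K" using cyl_sub[OF w(1) cyl_F[OF nf(2)]] j V(2) nf(1) by blast
    then show "x \<in> (\<Union>h\<in>{h \<in> F m. cyl m h \<subseteq> K}. cyl m h)" using w cyl_F by blast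
  qed blast
  then show ?thesis using that by blast
qed

subsection \<open>Orbits\<close>

text \<open>Keeping the level n explicit allows the relation to be moved to later levels, in
  particular to the levels used by the stages.\<close>

definition tail_eq where
  "tail_eq n x y \<longleftrightarrow> (\<exists>z\<in>lev n. \<exists>h\<in>F n. x = inn n z \<and> y = inn n (z(n := h)))"

lemma emb_upd:
  assumes "z \<in> lev n" "h \<in> F n"
  shows "emb n j (z(n := h)) = (emb n j z)(n + j := h \<otimes> tw n j z)"
proof
  fix k
  have u: "z(n := h) \<in> lev n" using assms by (rule lev_upd)
  consider "k < n + j" | "k = n + j" | "k > n + j" by linarith
  then show "emb n j (z(n := h)) k = ((emb n j z)(n + j := h \<otimes> tw n j z)) k"
  proof cases
    case 1
    then show ?thesis using emb_lev[OF u, of j] emb_lev[OF assms(1), of j]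
      by (simp add: lev_iff extensional_def)
  next
    case 2
    then show ?thesis using emb_head[OF u, of j] by (simp add: tw_upd)
  next
    case 3
    then show ?thesis by (simp add: emb_tail)
  qed
qed

lemma tail_eq_cyl:
  assumes "tail_eq n x y"
  obtains f h where "f \<in> F n" "h \<in> F n" "x \<in> cyl n f" "y \<in> cyl n h"
    "\<forall>j. \<exists>w\<in>W n j. x \<in> cyl (n + j) (f \<otimes> w) \<and> y \<in> cyl (n + j) (h \<otimes> w)"
proof -
  obtain z h where z: "z \<in> lev n" "h \<in> F n" "x = inn n z" "y = inn n (z(n := h))"
    using assms by (auto simp: tail_eq_def)
  have u: "z(n := h) \<in> lev n" using z lev_upd by blast
  have "x \<in> cyl (n + j) (z n \<otimes> tw n j z)" "y \<in> cyl (n + j) (h \<otimes> tw n j z)" for j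
    using cyl_tail[OF z(1)] cyl_tail[OF u, of j] z by (simp_all add: tw_upd)
  then show ?thesis
    using that[of "z n" h] cylI[OF z(1)] cylI[OF u] tw_W[OF z(1)] z cyl_F by (metis fun_upd_same)
qed

text \<open>Agreement for arbitrarily large j is enough: the point with head \<open>h\<close> and
  the tail of \<open>x\<close> then shares cofinally many cylinders with \<open>y\<close>. The
  back-and-forth construction controls only a sparse set of levels.\<close>

lemma tail_eqI:
  assumes f: "x \<in> cyl n f" and h: "y \<in> cyl n h"
    and t: "\<And>N. \<exists>j\<ge>N. \<exists>w\<in>W n j. x \<in> cyl (n + j) (f \<otimes> w) \<and> y \<in> cyl (n + j) (h \<otimes> w)"
  shows "tail_eq n x y"
proof -
  obtain z where z: "z \<in> lev n" "x = inn n z" "z n = f" "f \<in> F n" using f by (rule cylE)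
  have u: "z(n := h) \<in> lev n" using z h cyl_F lev_upd by blast
  have "y = inn n (z(n := h))"
  proof (rule separation)
    show "y \<in> pts" "inn n (z(n := h)) \<in> pts" using h cyl_pts in_pts[OF u] by auto
    fix N
    obtain j w where j: "j \<ge> N" "w \<in> W n j" "x \<in> cyl (n + j) (f \<otimes> w)" "y \<in> cyl (n + j) (h \<otimes> w)"
      using t by blast
    have "x \<in> cyl (n + j) (f \<otimes> tw n j z)" using cyl_tail[OF z(1)] z by simp
    then have "w = tw n j z" using cyl_unique j FW_inj[OF z(4) z(4) j(2) tw_W[OF z(1)]] by blast
    then have "inn n (z(n := h)) \<in> cyl (n + j) (h \<otimes> w)"
      using cyl_tail[OF u, of j] by (simp add: tw_upd)
    then show "\<exists>n'\<ge>N. \<exists>f. y \<in> cyl n' f \<and> inn n (z(n := h)) \<in> cyl n' f" using j by (meson trans_le_add2)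
  qed
  then show ?thesis using z h cyl_F unfolding tail_eq_def by blast
qed

lemma tail_eq_add: "tail_eq n x y \<Longrightarrow> tail_eq (n + j) x y"
proof -
  assume "tail_eq n x y"
  then obtain z h where z: "z \<in> lev n" "h \<in> F n" "x = inn n z" "y = inn n (z(n := h))"
    by (auto simp: tail_eq_def)
  have u: "z(n := h) \<in> lev n" using z lev_upd by blast
  have "x = inn (n + j) (emb n j z)" using in_emb[OF z(1)] z by simp
  moreover have "y = inn (n + j) ((emb n j z)(n + j := h \<otimes> tw n j z))"
    using in_emb[OF u, of j] z emb_upd[OF z(1,2), of j] by simp
  ultimately show ?thesis
    unfolding tail_eq_def using emb_lev[OF z(1)] FW[OF z(2) tw_W[OF z(1)]] by blast
qed

lemma tail_eq_mono: "tail_eq n x y \<Longrightarrow> n \<le> m \<Longrightarrow> tail_eq m x y"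
  using tail_eq_add le_Suc_ex by blast

text \<open>Independence of the representative: two of them agree after embedding into a common
  level, and left multiplication by g commutes with appending words on the right.\<close>

lemma act_in:
  assumes z: "z \<in> lev n" and g: "g \<in> carrier G" "g \<otimes> z n \<in> F n"
  shows "cf_act G C F g (inn n z) = inn n (z(n := g \<otimes> z n))"
  unfolding cf_act_def
proof (rule the_equality)
  fix y assume "\<exists>m. \<exists>u\<in>lev m. inn n z = inn m u \<and> g \<otimes> u m \<in> F m \<and> y = inn m (u(m := g \<otimes> u m))"
  then obtain m u where u: "u \<in> lev m" "inn n z = inn m u" "g \<otimes> u m \<in> F m"
    "y = inn m (u(m := g \<otimes> u m))" by blast
  obtain i j where ij: "n + i = m + j" "emb n i z = emb m j u"
    using in_eq_iff[OF z u(1)] u(2) by blast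
  have step: "inn n (z(n := g \<otimes> z n)) = inn (n + i) ((emb n i z)(n + i := g \<otimes> emb n i z (n + i)))"
    if z: "z \<in> lev n" "g \<otimes> z n \<in> F n" for n i z
  proof -
    have "(g \<otimes> z n) \<otimes> tw n i z = g \<otimes> emb n i z (n + i)"
      using g(1) F_closed[of "z n" n] z W_closed[OF tw_W[OF z(1), of i]]
      by (simp add: emb_head m_assoc lev_iff)
    then show ?thesis using in_emb[OF lev_upd[OF z], of i] emb_upd[OF z, of i] by simp
  qed
  show "y = inn n (z(n := g \<otimes> z n))" using step[OF z g(2), of i] step[OF u(1,3), of j] ij u by simp
qed (use assms in blast)

text \<open>By \<open>dom\<close>, each g acts on \<open>x\<close> at some level by changing only
  the head; conversely the change of head from \<open>z n\<close> to \<open>h\<close> is the action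
  of \<open>h\<close> times the inverse of \<open>z n\<close>.\<close>

lemma orbit_eq:
  assumes dom: "cf_dom_all G C F = pts" and x: "x \<in> pts"
  shows "cf_orbit G C F x = {y. \<exists>n. tail_eq n x y}"
proof (intro equalityI subsetI)
  fix y assume "y \<in> cf_orbit G C F x"
  then obtain g where g: "g \<in> carrier G" "y = cf_act G C F g x" by (auto simp: cf_orbit_def)
  then have "x \<in> cf_dom G C F g" using x dom unfolding cf_dom_all_def by blast
  then obtain n z where z: "z \<in> lev n" "g \<otimes> z n \<in> F n" "x = inn n z" by (auto simp: cf_dom_def)
  then have "tail_eq n x y" unfolding tail_eq_def using act_in g by blast
  then show "y \<in> {y. \<exists>n. tail_eq n x y}" by blast
next
  fix y assume "y \<in> {y. \<exists>n. tail_eq n x y}"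
  then obtain n z h where z: "z \<in> lev n" "h \<in> F n" "x = inn n z" "y = inn n (z(n := h))"
    by (auto simp: tail_eq_def)
  define g where "g = h \<otimes> inv (z n)"
  have c: "z n \<in> carrier G" "h \<in> carrier G" using z F_closed lev_iff by blast+
  then have g: "g \<in> carrier G" "g \<otimes> z n = h" by (auto simp: g_def m_assoc)
  then have "y = cf_act G C F g x" using act_in z by simp
  then show "y \<in> cf_orbit G C F x" using g unfolding cf_orbit_def by blast
qed

lemma tail_eq_pts: "tail_eq n x y \<Longrightarrow> x \<in> pts \<and> y \<in> pts"
  unfolding tail_eq_def using in_pts lev_upd by blast

end

lemma measurable_sigma_continuous:
  assumes "continuous_map S T f"
  shows "f \<in> measurable (sigma (topspace S) {U. openin S U}) (sigma (topspace T) {U. openin T U})"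
proof (rule measurable_measure_of)
  have S: "{U. openin S U} \<subseteq> Pow (topspace S)" using openin_subset by auto
  show "{U. openin T U} \<subseteq> Pow (topspace T)" using openin_subset by auto
  show "f \<in> space (sigma (topspace S) {U. openin S U}) \<rightarrow> topspace T"
    using assms by (simp add: space_measure_of_conv continuous_map_def)
  fix U assume "U \<in> {U. openin T U}"
  then have "openin S {x \<in> topspace S. f x \<in> U}" using assms by (simp add: continuous_map_def)
  moreover have "{x \<in> topspace S. f x \<in> U} = f -` U \<inter> topspace S" by auto
  ultimately show "f -` U \<inter> space (sigma (topspace S) {U. openin S U})
      \<in> sets (sigma (topspace S) {U. openin S U})"
    using S by (simp add: space_measure_of_conv sigma_sets.Basic)
qed

context cf_space
begin

subsection \<open>Borel sets\<close>

lemma sets_borel: "sets (cf_borel G C F) = sigma_sets pts {U. openin X U}"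
  and space_borel: "space (cf_borel G C F) = pts"
proof -
  have "{U. openin X U} \<subseteq> Pow pts" using openin_subset topspace_X by fastforce
  then show "sets (cf_borel G C F) = sigma_sets pts {U. openin X U}"
    and "space (cf_borel G C F) = pts"
    unfolding cf_borel_def by (auto simp: space_measure_of_conv)
qed

text \<open>The empty set makes the family closed under intersections; the parameter L allows
  measures to be compared along selected levels only.\<close>

definition cylinders where
  "cylinders L = insert {} {cyl n f | n f. n \<in> L \<and> f \<in> F n}"

lemma countable_cylinders: "countable (cylinders L)"
proof -
  have "countable (\<Union>n. cyl n ` F n)" by (simp add: F_finite countable_finite)
  then have "countable (insert {} (\<Union>n. cyl n ` F n))" by simp
  then show ?thesis by (rule countable_subset[rotated]) (auto simp: cylinders_def)
qed

lemma open_Union_cylinders: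
  assumes "infinite L" "openin X U"
  shows "U = \<Union>{A \<in> cylinders L. A \<subseteq> U}"
proof (intro equalityI subsetI)
  fix x assume "x \<in> U"
  then obtain n f where nf: "x \<in> cyl n f" "cyl n f \<subseteq> U" using assms(2) unfolding openin_X by blast
  obtain m where m: "m \<in> L" "m \<ge> n" using assms(1) by (meson infinite_nat_iff_unbounded_le)
  then obtain j where j: "m = n + j" using le_Suc_ex by blast
  obtain w where w: "w \<in> W n j" "x \<in> cyl m (f \<otimes> w)" using cyl_refineE[OF nf(1), of j] j by blast
  then have "cyl m (f \<otimes> w) \<in> cylinders L" using m cyl_F unfolding cylinders_def by blast
  moreover have "cyl m (f \<otimes> w) \<subseteq> U" using cyl_sub[OF w(1) cyl_F[OF nf(1)]] nf j by blast
  ultimately show "x \<in> \<Union>{A \<in> cylinders L. A \<subseteq> U}" using w by blast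
qed blast

lemma borel_cylinders:
  assumes "infinite L"
  shows "sets (cf_borel G C F) = sigma_sets pts (cylinders L)"
  unfolding sets_borel
proof (rule sigma_sets_eqI)
  fix U assume "U \<in> {U. openin X U}"
  then have "U = \<Union>{A \<in> cylinders L. A \<subseteq> U}" using open_Union_cylinders assms by simp
  moreover have "countable {A \<in> cylinders L. A \<subseteq> U}"
    using countable_cylinders by (rule countable_subset[rotated]) auto
  then have "\<Union>{A \<in> cylinders L. A \<subseteq> U} \<in> sigma_sets pts (cylinders L)"
    by (rule sigma_sets_UNION) auto
  ultimately show "U \<in> sigma_sets pts (cylinders L)" by simp
next
  fix A assume "A \<in> cylinders L"
  then show "A \<in> sigma_sets pts {U. openin X U}"
    by (auto simp: cylinders_def cyl_open intro: sigma_sets.Basic)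
qed

lemma cyl_borel: "cyl n f \<in> sets (cf_borel G C F)"
  unfolding sets_borel by (auto intro: sigma_sets.Basic cyl_open)

lemma open_borel: "openin X U \<Longrightarrow> U \<in> sets (cf_borel G C F)"
  unfolding sets_borel by (auto intro: sigma_sets.Basic)

text \<open>Cylinders are nested or disjoint, so those with levels in L form, with the empty set, a
  countable intersection-stable generator. The measure transported by the constructed map will be
  computed only at the levels of odd stages, hence the general L.\<close>

lemma measure_eqI_cylinders:
  assumes L: "infinite L"
    and M: "sets M = sets (cf_borel G C F)" and N: "sets N = sets (cf_borel G C F)"
    and eq: "\<And>n f. n \<in> L \<Longrightarrow> f \<in> F n \<Longrightarrow> emeasure M (cyl n f) = emeasure N (cyl n f)"
    and fin: "\<And>n f. n \<in> L \<Longrightarrow> f \<in> F n \<Longrightarrow> emeasure M (cyl n f) \<noteq> \<infinity>"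
  shows "M = N"
proof (rule measure_eqI_generator_eq_countable)
  show "Int_stable (cylinders L)"
  proof (rule Int_stableI)
    fix A B assume A: "A \<in> cylinders L" and B: "B \<in> cylinders L"
    show "A \<inter> B \<in> cylinders L"
    proof (cases "A \<inter> B = {}")
      case False
      then obtain x n f m h where x: "x \<in> A" "x \<in> B" "A = cyl n f" "B = cyl m h"
        using A B unfolding cylinders_def by blast
      have "A \<subseteq> B \<or> B \<subseteq> A" using cyl_nested[of x n f m h] cyl_nested[of x m h n f] x
        by (metis nle_le)
      then show ?thesis using A B by (metis inf.absorb1 inf.absorb2)
    qed (simp add: cylinders_def)
  qed
  show "cylinders L \<subseteq> Pow pts" using cyl_pts by (auto simp: cylinders_def)
  show "sets M = sigma_sets pts (cylinders L)" "sets N = sigma_sets pts (cylinders L)"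
    using M N borel_cylinders[OF L] by simp_all
  show "cylinders L \<subseteq> cylinders L" "countable (cylinders L)"
    by (simp_all add: countable_cylinders)
  show "\<Union>(cylinders L) = pts"
  proof
    show "\<Union>(cylinders L) \<subseteq> pts" using cyl_pts by (auto simp: cylinders_def)
    have "openin X pts" by (metis openin_topspace topspace_X)
    then show "pts \<subseteq> \<Union>(cylinders L)" using open_Union_cylinders[OF L, of pts] by blast
  qed
qed (use eq fin in \<open>auto simp: cylinders_def\<close>)

subsection \<open>Swapping two cylinders\<close>

text \<open>Exchanges the heads \<open>h\<close> and \<open>h'\<close> on \<open>X_n\<close>, keeps
  the tails, and fixes all points off \<open>X_n\<close>. There are only countably many such maps,
  and any two tail equivalent points are linked by one of them.\<close>

definition swap where
  "swap n h h' x = (if x \<in> inn n ` lev n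
     then let z = inv_into (lev n) (inn n) x in inn n (z(n := Transposition.transpose h h' (z n))) else x)"

lemma swap_in: "z \<in> lev n \<Longrightarrow> swap n h h' (inn n z) = inn n (z(n := Transposition.transpose h h' (z n)))"
proof -
  assume z: "z \<in> lev n"
  have "inj_on (inn n) (lev n)" using in_inj by (auto intro: inj_onI)
  then have "inv_into (lev n) (inn n) (inn n z) = z" using z by (rule inv_into_f_f)
  then show ?thesis using z by (simp add: swap_def)
qed

lemma swap_out: "x \<notin> inn n ` lev n \<Longrightarrow> swap n h h' x = x"
  by (simp add: swap_def)

context
  fixes n h h' assumes h: "h \<in> F n" and h': "h' \<in> F n"
begin

lemma transpose_F: "f \<in> F n \<Longrightarrow> Transposition.transpose h h' f \<in> F n"
  using h h' by (auto simp: Transposition.transpose_def)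

lemma swap_lev:
  assumes "z \<in> lev n"
  shows "z(n := Transposition.transpose h h' (z n)) \<in> lev n"
  using assms lev_upd transpose_F lev_iff by blast

lemma swap_swap: "x \<in> pts \<Longrightarrow> swap n h h' (swap n h h' x) = x"
  by (cases "x \<in> inn n ` lev n") (auto simp: swap_in swap_out swap_lev)

lemma swap_lev_iff: "swap n h h' x \<in> inn n ` lev n \<longleftrightarrow> x \<in> inn n ` lev n"
  by (cases "x \<in> inn n ` lev n") (auto simp: swap_in swap_out swap_lev)

lemma swap_pts: "x \<in> pts \<Longrightarrow> swap n h h' x \<in> pts"
  by (cases "x \<in> inn n ` lev n") (auto simp: swap_in swap_out intro!: in_pts swap_lev)

lemma swap_tail_eq: 
  assumes "x \<in> pts"
  shows "\<exists>m. tail_eq m x (swap n h h' x)"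
proof (cases "x \<in> inn n ` lev n")
  case True
  then obtain z where z: "z \<in> lev n" "x = inn n z" by blast
  then have "Transposition.transpose h h' (z n) \<in> F n" using transpose_F by (simp add: lev_iff)
  then show ?thesis using z swap_in unfolding tail_eq_def by blast
next
  case False
  obtain m z where z: "z \<in> lev m" "x = inn m z" using assms by (auto simp: pts_eq)
  then have "z m \<in> F m" "x = inn m (z(m := z m))" by (auto simp: lev_iff)
  then show ?thesis using z False swap_out unfolding tail_eq_def by metis
qed

lemma swap_cyl_sub:
  assumes w: "w \<in> W n j" and x: "x \<in> cyl (n + j) (f \<otimes> w)" and f: "f \<in> F n"
  shows "swap n h h' x \<in> cyl (n + j) (Transposition.transpose h h' f \<otimes> w)"
proof -
  have "x \<in> cyl n f" using x cyl_sub[OF w f] by blast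
  then obtain z where z: "z \<in> lev n" "x = inn n z" "z n = f" by (rule cylE)
  then have "tw n j z = w"
    using cyl_tail[OF z(1), of j] x cyl_unique FW_inj[OF f f tw_W[OF z(1)] w] by blast
  then show ?thesis using cyl_tail[OF swap_lev[OF z(1)], of j] z by (simp add: swap_in tw_upd)
qed

text \<open>From level n on, preimages of cylinders are cylinders of the same level; this yields
  both continuity and invariance of the Haar measure.\<close>

lemma swap_cyl:
  assumes a: "a \<in> F (n + j)"
  obtains b where "b \<in> F (n + j)" "{x \<in> pts. swap n h h' x \<in> cyl (n + j) a} = cyl (n + j) b"
proof (cases "\<exists>f\<in>F n. \<exists>w\<in>W n j. a = f \<otimes> w")
  case True
  then obtain f w where fw: "f \<in> F n" "w \<in> W n j" "a = f \<otimes> w" by blast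
  let ?b = "Transposition.transpose h h' f \<otimes> w"
  have "{x \<in> pts. swap n h h' x \<in> cyl (n + j) a} = cyl (n + j) ?b"
  proof (intro equalityI subsetI)
    fix x assume "x \<in> {x \<in> pts. swap n h h' x \<in> cyl (n + j) a}"
    then show "x \<in> cyl (n + j) ?b"
      using swap_cyl_sub[OF fw(2), of "swap n h h' x" f] fw swap_swap by simp
  next
    fix x assume x: "x \<in> cyl (n + j) ?b"
    then have "swap n h h' x \<in> cyl (n + j) (Transposition.transpose h h' (Transposition.transpose h h' f) \<otimes> w)"
      using swap_cyl_sub[OF fw(2) _ transpose_F] fw by blast
    then show "x \<in> {x \<in> pts. swap n h h' x \<in> cyl (n + j) a}"
      using fw x cyl_pts by auto
  qed
  then show ?thesis using that FW[OF transpose_F] fw by blast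
next
  case False
  \<comment> \<open>Here \<open>a\<close> does not extend an element of \<open>F n\<close>, so its
    cylinder misses \<open>X_n\<close>, the only place where the swap moves points.\<close>
  have *: "x \<notin> inn n ` lev n" if "x \<in> cyl (n + j) a" for x
  proof
    assume "x \<in> inn n ` lev n"
    then obtain f where f: "f \<in> F n" "x \<in> cyl n f" using cyl_cover by blast
    then show False using cyl_nested[OF f(2) that] False by auto
  qed
  have "{x \<in> pts. swap n h h' x \<in> cyl (n + j) a} = cyl (n + j) a"
  proof (intro equalityI subsetI)
    fix x assume "x \<in> {x \<in> pts. swap n h h' x \<in> cyl (n + j) a}"
    then show "x \<in> cyl (n + j) a" using * swap_lev_iff swap_out by fastforce
  next
    fix x assume "x \<in> cyl (n + j) a"
    then show "x \<in> {x \<in> pts. swap n h h' x \<in> cyl (n + j) a}"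
      using * swap_out cyl_pts by fastforce
  qed
  then show ?thesis using that a by blast
qed

lemma swap_continuous: "continuous_map X X (swap n h h')"
  unfolding continuous_map_def topspace_X
proof (intro conjI allI impI)
  show "swap n h h' \<in> pts \<rightarrow> pts" using swap_pts by blast
  fix U assume U: "openin X U"
  show "openin X {x \<in> pts. swap n h h' x \<in> U}"
  proof (rule openin_X_I)
    fix x assume x: "x \<in> {x \<in> pts. swap n h h' x \<in> U}"
    then obtain m a where m: "m \<ge> n" "swap n h h' x \<in> cyl m a" "cyl m a \<subseteq> U"
      using U unfolding openin_X by blast
    then obtain j where j: "m = n + j" using le_Suc_ex by blast
    then obtain b where "{x \<in> pts. swap n h h' x \<in> cyl m a} = cyl m b"
      using swap_cyl[of a j] cyl_F[OF m(2)] unfolding j by blast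
    then show "\<exists>n' f. x \<in> cyl n' f \<and> cyl n' f \<subseteq> {x \<in> pts. swap n h h' x \<in> U}"
      using m x by blast
  qed auto
qed

end

end

locale cf_haar_space = cf_space +
  fixes \<mu> :: "(nat \<times> (nat \<Rightarrow> 'a)) set measure"
  assumes haar: "cf_haar G C F \<mu>"
begin

subsection \<open>Haar measure\<close>

lemma sets_mu: "sets \<mu> = sets (cf_borel G C F)"
  using haar by (simp add: cf_haar_def)

lemma space_mu: "space \<mu> = pts"
  using sets_eq_imp_space_eq[OF sets_mu] space_borel by simp

abbreviation "tails n \<equiv> (\<Pi>\<^sub>M k\<in>{n<..}. uniform_count_measure (C k))"
abbreviation "glue n \<equiv> (\<lambda>(f, c). inn n (c(n := f)))"

lemma space_tails: "space (tails n) = (\<Pi>\<^sub>E k\<in>{n<..}. C k)"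
  by (simp add: space_PiM space_uniform_count_measure)

lemma space_level: "space (cf_level_measure C F n) = F n \<times> (\<Pi>\<^sub>E k\<in>{n<..}. C k)"
  by (simp add: cf_level_measure_def space_pair_measure space_tails space_point_measure)

lemma glue_lev: "f \<in> F n \<Longrightarrow> c \<in> (\<Pi>\<^sub>E k\<in>{n<..}. C k) \<Longrightarrow> c(n := f) \<in> lev n"
  by (auto simp: lev_iff PiE_iff extensional_def)

text \<open>No sigma-algebra is put on the group, so measurability of the product of head and
  letters is shown by hand: the event is split according to the finitely many values b of the
  shorter product and d of the last letter.\<close>

lemma glue_word_sets:
  "{(f, c) \<in> space (cf_level_measure C F n). f \<otimes> tw n j c = a} \<in> sets (cf_level_measure C F n)"
proof (induction j arbitrary: a)
  case 0
  let ?M = "point_measure (F n) (\<lambda>_. ennreal (1 / real (p n)))"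
  have "{(f, c) \<in> space (cf_level_measure C F n). f \<otimes> tw n 0 c = a} = ({a} \<inter> F n) \<times> space (tails n)"
  proof -
    have one: "f \<otimes> \<one> = f" if "f \<in> F n" for f using F_closed[OF that] by simp
    then show ?thesis by (auto simp: space_level space_tails)
  qed
  moreover have "{a} \<inter> F n \<in> sets ?M" by (simp add: sets_point_measure)
  ultimately show ?case unfolding cf_level_measure_def by (simp add: pair_measureI)
next
  case (Suc j)
  let ?M = "cf_level_measure C F n"
  let ?A = "\<lambda>b. {(f, c) \<in> space ?M. f \<otimes> tw n j c = b}"
  let ?B = "\<lambda>d. {(f, c) \<in> space ?M. c (Suc (n + j)) = d}"
  let ?I = "{(b, d). b \<in> F (n + j) \<and> d \<in> C (Suc (n + j)) \<and> b \<otimes> d = a}"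
  have B: "?B d \<in> sets ?M" if "d \<in> C (Suc (n + j))" for d
  proof -
    let ?N = "uniform_count_measure (C (Suc (n + j)))"
    have "(\<lambda>c. c (Suc (n + j))) \<in> measurable (tails n) ?N"
      by (rule measurable_component_singleton) simp
    then have "(\<lambda>x. snd x (Suc (n + j))) \<in> measurable ?M ?N"
      unfolding cf_level_measure_def by (rule measurable_compose[OF measurable_snd])
    moreover have "{d} \<in> sets ?N" using that by (simp add: sets_uniform_count_measure)
    ultimately have "(\<lambda>x. snd x (Suc (n + j))) -` {d} \<inter> space ?M \<in> sets ?M" by (rule measurable_sets)
    moreover have "(\<lambda>x. snd x (Suc (n + j))) -` {d} \<inter> space ?M = ?B d" by auto
    ultimately show ?thesis by simp
  qed
  have fin: "finite ?I"
    by (rule finite_subset[OF _ finite_cartesian_product[OF F_finite C_finite]]) auto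
  have "{(f, c) \<in> space ?M. f \<otimes> tw n (Suc j) c = a} = (\<Union>(b, d)\<in>?I. ?A b \<inter> ?B d)"
  proof (intro equalityI subsetI)
    fix x assume "x \<in> {(f, c) \<in> space ?M. f \<otimes> tw n (Suc j) c = a}"
    then obtain f c where x: "x = (f, c)" "(f, c) \<in> space ?M" "f \<otimes> tw n (Suc j) c = a" by blast
    then have fc: "f \<in> F n" "c \<in> (\<Pi>\<^sub>E k\<in>{n<..}. C k)" by (auto simp: space_level)
    have W: "tw n j c \<in> W n j" using tw_W[OF glue_lev[OF fc], of j] by (simp add: tw_upd)
    have c: "c (Suc (n + j)) \<in> C (Suc (n + j))" using PiE_mem[OF fc(2)] by simp
    have "(f \<otimes> tw n j c) \<otimes> c (Suc (n + j)) = a"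
      using x(3) W c fc by (simp add: m_assoc F_closed W_closed C_closed)
    then have "(f \<otimes> tw n j c, c (Suc (n + j))) \<in> ?I" using FW[OF fc(1) W] c by simp
    moreover have "x \<in> ?A (f \<otimes> tw n j c) \<inter> ?B (c (Suc (n + j)))" using x by simp
    ultimately show "x \<in> (\<Union>(b, d)\<in>?I. ?A b \<inter> ?B d)" by blast
  next
    fix x assume "x \<in> (\<Union>(b, d)\<in>?I. ?A b \<inter> ?B d)"
    then obtain f c where x: "x = (f, c)" "(f, c) \<in> space ?M"
      "(f \<otimes> tw n j c) \<otimes> c (Suc (n + j)) = a" "c (Suc (n + j)) \<in> C (Suc (n + j))" by blast
    then have fc: "f \<in> F n" "c \<in> (\<Pi>\<^sub>E k\<in>{n<..}. C k)" by (auto simp: space_level)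
    have W: "tw n j c \<in> W n j" using tw_W[OF glue_lev[OF fc], of j] by (simp add: tw_upd)
    show "x \<in> {(f, c) \<in> space ?M. f \<otimes> tw n (Suc j) c = a}"
      using x W fc by (simp add: m_assoc F_closed W_closed C_closed)
  qed
  moreover have "(\<Union>(b, d)\<in>?I. ?A b \<inter> ?B d) \<in> sets ?M"
    using fin by (rule sets.finite_UN) (use Suc B in auto)
  ultimately show ?case by simp
qed

text \<open>It suffices to test the cylinders of levels from n on, which generate the Borel sets;
  their preimages are events fixing a product of head and letters.\<close>

lemma glue_measurable:
  "glue n \<in> measurable (cf_level_measure C F n) (restrict_space (cf_borel G C F) (inn n ` lev n))"
proof (rule measurable_restrict_space2)
  let ?M = "cf_level_measure C F n"
  show g: "glue n \<in> space ?M \<rightarrow> inn n ` lev n" using glue_lev by (auto simp: space_level)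
  show "glue n \<in> measurable ?M (cf_borel G C F)"
  proof (rule measurable_sigma_sets)
    show "sets (cf_borel G C F) = sigma_sets pts (cylinders {n..})"
      by (simp add: borel_cylinders infinite_Ici)
    show "cylinders {n..} \<subseteq> Pow pts" using cyl_pts by (auto simp: cylinders_def)
    show "glue n \<in> space ?M \<rightarrow> pts" 
    proof
      fix x assume "x \<in> space ?M"
      with g have "glue n x \<in> inn n ` lev n" by (rule Pi_mem)
      then show "glue n x \<in> pts" using in_pts by auto
    qed
    fix A assume "A \<in> cylinders {n..}"
    then consider "A = {}" | j a where "A = cyl (n + j) a"
      unfolding cylinders_def by (auto dest: le_Suc_ex)
    then show "glue n -` A \<inter> space ?M \<in> sets ?M"
    proof cases
      case (2 j a)
      have "glue n (f, c) \<in> A \<longleftrightarrow> f \<otimes> tw n j c = a" if "(f, c) \<in> space ?M" for f c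
      proof -
        have l: "c(n := f) \<in> lev n" using glue_lev that by (auto simp: space_level)
        have "glue n (f, c) \<in> cyl (n + j) (f \<otimes> tw n j c)"
          using cyl_tail[OF l, of j] by (simp add: tw_upd)
        then show ?thesis using 2 cyl_unique by blast
      qed
      then have "glue n -` A \<inter> space ?M = {(f, c) \<in> space ?M. f \<otimes> tw n j c = a}" by auto
      then show ?thesis using glue_word_sets by simp
    qed simp
  qed
qed

text \<open>On \<open>X_n\<close> the measure is the image of a product measure, and the cylinder
  pulls back to \<open>{f}\<close> times the whole tail space, which is a probability space.\<close>

lemma haar_cyl:
  assumes f: "f \<in> F n"
  shows "emeasure \<mu> (cyl n f) = ennreal (1 / real (p n))"
proof -
  let ?S = "inn n ` lev n"
  let ?M = "cf_level_measure C F n"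
  have cS: "cyl n f \<subseteq> ?S" by (auto simp: cf_cyl_def)
  have S: "?S \<in> sets \<mu>"
    unfolding sets_mu cyl_cover[symmetric] using F_finite cyl_borel by (intro sets.finite_UN) auto
  have "emeasure \<mu> (cyl n f) = emeasure (restrict_space \<mu> ?S) (cyl n f)"
    using emeasure_restrict_space[OF _ cS, of \<mu>] S by simp
  also have "\<dots> = emeasure (distr ?M (restrict_space (cf_borel G C F) ?S) (glue n)) (cyl n f)"
    using haar by (simp add: cf_haar_def Let_def)
  also have "\<dots> = emeasure ?M (glue n -` cyl n f \<inter> space ?M)"
  proof (rule emeasure_distr[OF glue_measurable])
    show "cyl n f \<in> sets (restrict_space (cf_borel G C F) ?S)"
      using S cS cyl_borel by (subst sets_restrict_space_iff) (auto simp: sets_mu)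
  qed
  also have "glue n -` cyl n f \<inter> space ?M = {f} \<times> space (tails n)"
  proof (intro equalityI subsetI)
    fix x assume x: "x \<in> glue n -` cyl n f \<inter> space ?M"
    then obtain g c where gc: "x = (g, c)" "g \<in> F n" "c \<in> (\<Pi>\<^sub>E k\<in>{n<..}. C k)"
      by (auto simp: space_level)
    then have "g = f" using x cylI[OF glue_lev[OF gc(2,3)]] cyl_unique by auto
    then show "x \<in> {f} \<times> space (tails n)" using gc space_tails by simp
  next
    fix x assume "x \<in> {f} \<times> space (tails n)"
    then obtain c where c: "x = (f, c)" "c \<in> (\<Pi>\<^sub>E k\<in>{n<..}. C k)" using space_tails by auto
    then show "x \<in> glue n -` cyl n f \<inter> space ?M"
      using cylI[OF glue_lev[OF f c(2)]] f by (simp add: space_level)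
  qed
  also have "emeasure ?M ({f} \<times> space (tails n)) = ennreal (1 / real (p n))"
  proof -
    have "finite (C k) \<and> C k \<noteq> {}" if "k > n" for k
      using C_finite[of "k - 1"] C_card[of "k - 1"] that by (auto simp: card_gt_0_iff)
    then interpret T: prob_space "tails n"
      by (intro prob_space_PiM prob_space_uniform_count_measure) auto
    let ?P = "point_measure (F n) (\<lambda>_. ennreal (1 / real (p n)))"
    have "emeasure ?M ({f} \<times> space (tails n)) = emeasure ?P {f} * emeasure (tails n) (space (tails n))"
      unfolding cf_level_measure_def
      by (rule T.emeasure_pair_measure_Times) (use f in \<open>simp_all add: sets_point_measure\<close>)
    also have "\<dots> = ennreal (1 / real (p n))"
      using f by (simp add: T.emeasure_space_1 emeasure_point_measure_finite F_finite)
    finally show ?thesis .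
  qed
  finally show ?thesis .
qed

lemma haar_cyls:
  assumes S: "S \<subseteq> F n"
  shows "emeasure \<mu> (\<Union>h\<in>S. cyl n h) = ennreal (real (card S) / real (p n))"
proof -
  have fin: "finite S" using S F_finite finite_subset by blast
  have "disjoint_family_on (cyl n) S" using cyl_unique by (auto simp: disjoint_family_on_def)
  then have "emeasure \<mu> (\<Union>h\<in>S. cyl n h) = (\<Sum>h\<in>S. emeasure \<mu> (cyl n h))"
    using cyl_borel sets_mu fin by (subst sum_emeasure) auto
  also have "\<dots> = (\<Sum>h\<in>S. ennreal (1 / real (p n)))"
    by (rule sum.cong) (use S haar_cyl in auto)
  also have "\<dots> = ennreal (real (card S) / real (p n))"
    by (simp add: ennreal_of_nat_eq_real_of_nat ennreal_mult'[symmetric])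
  finally show ?thesis .
qed

lemma lev_sets: "inn n ` lev n \<in> sets \<mu>"
  unfolding sets_mu cyl_cover[symmetric] using F_finite cyl_borel by (intro sets.finite_UN) auto

lemma haar_lev: "emeasure \<mu> (inn n ` lev n) = ennreal (real (card (F n)) / real (p n))"
  using haar_cyls[of "F n" n] by (simp add: cyl_cover)

lemma haar_total: "emeasure \<mu> pts = (SUP n. ennreal (real (card (F n)) / real (p n)))"
proof -
  have "(SUP n. emeasure \<mu> (inn n ` lev n)) = emeasure \<mu> pts"
    unfolding pts_eq using lev_sets in_lev_mono by (intro SUP_emeasure_incseq) (auto simp: incseq_def)
  then show ?thesis by (simp add: haar_lev)
qed

lemma haar_lev_mono:
  "n \<le> m \<Longrightarrow> ennreal (real (card (F n)) / real (p n)) \<le> ennreal (real (card (F m)) / real (p m))"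
  using emeasure_mono[OF in_lev_mono lev_sets] by (simp add: haar_lev)

text \<open>Since \<open>X_n\<close> is compact, some point lies outside; a late cylinder around it
  misses \<open>X_n\<close> and has positive measure. Strictness survives the addition because
  \<open>X_n\<close> has finite measure.\<close>

lemma haar_lev_less:
  assumes "\<not> compact_space X"
  shows "ennreal (real (card (F n)) / real (p n)) < emeasure \<mu> pts"
proof -
  have "inn n ` lev n \<noteq> pts"
    using assms compact_in_lev[of n] by (auto simp: compact_space_def topspace_X)
  then obtain x where x: "x \<in> pts" "x \<notin> inn n ` lev n" using in_pts by blast
  obtain N where N: "\<And>m. m \<ge> N \<Longrightarrow> \<exists>f\<in>F m. x \<in> cyl m f" using pts_cyl x(1) by blast
  obtain m f where m: "m \<ge> n" "x \<in> cyl m f" "f \<in> F m" using N[OF max.cobounded2] max.cobounded1 by blast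
  have disj: "inn n ` lev n \<inter> cyl m f = {}"
  proof (rule ccontr)
    assume "inn n ` lev n \<inter> cyl m f \<noteq> {}"
    then obtain y h where "y \<in> cyl m f" "y \<in> cyl n h" unfolding cyl_cover[symmetric] by blast
    then have "cyl m f \<subseteq> cyl n h" using cyl_nested m(1) by metis
    then show False using m x unfolding cyl_cover[symmetric] using cyl_F by blast
  qed
  have "emeasure \<mu> (inn n ` lev n) < emeasure \<mu> (inn n ` lev n) + emeasure \<mu> (cyl m f)"
    using p_pos[of m] by (simp add: haar_lev haar_cyl[OF m(3)] ennreal_add_left_cancel_less
        flip: ennreal_plus) (simp add: ennreal_less_iff)
  also have "\<dots> = emeasure \<mu> (inn n ` lev n \<union> cyl m f)"
    using disj lev_sets cyl_borel sets_mu by (intro plus_emeasure) auto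
  also have "\<dots> \<le> emeasure \<mu> pts"
    using cyl_pts in_pts sets.top[of \<mu>] by (intro emeasure_mono) (auto simp: space_mu)
  finally show ?thesis by (simp add: haar_lev)
qed

text \<open>The swap permutes the cylinders of each level from n on, and cylinders of one level have
  equal measure.\<close>

lemma swap_measure:
  assumes h: "h \<in> F n" "h' \<in> F n"
  shows "distr \<mu> \<mu> (swap n h h') = \<mu>"
proof (rule measure_eqI_cylinders)
  have m: "swap n h h' \<in> measurable \<mu> \<mu>"
    using measurable_sigma_continuous[OF swap_continuous[OF h]] sets_mu
    by (simp add: cf_borel_def topspace_X cong: measurable_cong_sets)
  show "infinite {n..}" by (rule infinite_Ici)
  fix m a assume "m \<in> {n..}" and a: "a \<in> F m"
  then obtain j where j: "m = n + j" by (auto dest: le_Suc_ex)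
  obtain b where b: "b \<in> F m" "{x \<in> pts. swap n h h' x \<in> cyl m a} = cyl m b"
    using swap_cyl[OF h, of a j] a unfolding j by blast
  have "emeasure (distr \<mu> \<mu> (swap n h h')) (cyl m a) = emeasure \<mu> (swap n h h' -` cyl m a \<inter> space \<mu>)"
    by (rule emeasure_distr[OF m]) (simp add: sets_mu cyl_borel)
  also have "swap n h h' -` cyl m a \<inter> space \<mu> = cyl m b" using b by (auto simp: space_mu)
  finally show "emeasure (distr \<mu> \<mu> (swap n h h')) (cyl m a) = emeasure \<mu> (cyl m a)"
    using a b haar_cyl by simp
  then show "emeasure (distr \<mu> \<mu> (swap n h h')) (cyl m a) \<noteq> \<infinity>" using haar_cyl[OF a] by simp
qed (simp_all add: sets_mu)

text \<open>The swap is an involution, so images are preimages.\<close>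

lemma swap_image:
  assumes h: "h \<in> F n" "h' \<in> F n" and E: "E \<in> sets \<mu>"
  shows "swap n h h' ` E \<in> sets \<mu> \<and> emeasure \<mu> (swap n h h' ` E) = emeasure \<mu> E"
proof -
  have m: "swap n h h' \<in> measurable \<mu> \<mu>"
    using measurable_sigma_continuous[OF swap_continuous[OF h]] sets_mu
    by (simp add: cf_borel_def topspace_X cong: measurable_cong_sets)
  have sub: "E \<subseteq> pts" using sets.sets_into_space[OF E] by (simp add: space_mu)
  have "swap n h h' ` E = swap n h h' -` E \<inter> space \<mu>"
  proof (intro equalityI subsetI)
    fix y assume "y \<in> swap n h h' ` E"
    then show "y \<in> swap n h h' -` E \<inter> space \<mu>"
      using sub swap_swap[OF h] swap_pts[OF h] by (auto simp: space_mu)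
  next
    fix y assume "y \<in> swap n h h' -` E \<inter> space \<mu>"
    then show "y \<in> swap n h h' ` E" using swap_swap[OF h, of y] by (auto simp: space_mu intro: rev_image_eqI)
  qed
  then show ?thesis
    using measurable_sets[OF m E] emeasure_distr[OF m E] swap_measure[OF h] by simp
qed

text \<open>A homeomorphism that maps each point into its orbit agrees with one of countably many swaps at
  every point; cutting the space into the Borel sets where a given swap is used, it preserves the
  measure.\<close>

lemma orbit_map_measure:
  assumes cont: "continuous_map X X \<psi>" and inj: "inj_on \<psi> pts"
    and tail: "\<And>x. x \<in> pts \<Longrightarrow> \<exists>n. tail_eq n x (\<psi> x)" and E: "E \<in> sets \<mu>"
  shows "emeasure \<mu> (\<psi> ` E) = emeasure \<mu> E"
proof -
  define I where "I = (SIGMA n:UNIV. F n \<times> F n)"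
  define s where "s = (\<lambda>(n, h, h'). swap n h h')"
  have cI: "countable I" unfolding I_def by (intro countable_SIGMA) (auto simp: F_finite countable_finite)
  have neI: "I \<noteq> {}" using F_nonempty unfolding I_def by blast
  define e where "e = from_nat_into I"
  have eI: "e k \<in> I" for k using neI by (simp add: e_def from_nat_into)
  have si: "A \<in> sets \<mu> \<Longrightarrow> s i ` A \<in> sets \<mu> \<and> emeasure \<mu> (s i ` A) = emeasure \<mu> A"
    if "i \<in> I" for i A using that swap_image by (auto simp: I_def s_def)
  have sc: "continuous_map X X (s i)" if "i \<in> I" for i
    using that swap_continuous by (auto simp: I_def s_def)
  have sub: "E \<subseteq> pts" using sets.sets_into_space[OF E] by (simp add: space_mu)
  define B where "B k = E \<inter> {x \<in> pts. \<psi> x = s (e k) x}" for k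
  have Bs: "B k \<in> sets \<mu>" for k
  proof -
    \<comment> \<open>Two continuous maps into a Hausdorff space agree on a closed set; hence the
      piece on which a given swap represents \<open>\<psi>\<close> is Borel.\<close>
    have "closedin X {x \<in> topspace X. \<psi> x = s (e k) x}"
      using closedin_continuous_maps_eq[OF Hausdorff cont sc[OF eI]] .
    then have "{x \<in> pts. \<psi> x = s (e k) x} \<in> sets \<mu>"
      using sets.compl_sets[of "pts - {x \<in> pts. \<psi> x = s (e k) x}" \<mu>] open_borel
      by (auto simp: closedin_def topspace_X space_mu sets_mu double_diff)
    then show ?thesis using E by (simp add: B_def)
  qed
  have BE: "(\<Union>k. B k) = E"
  proof (intro equalityI subsetI)
    fix x assume x: "x \<in> E"
    then obtain n where "tail_eq n x (\<psi> x)" using tail sub by blast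
    then obtain z h where z: "z \<in> lev n" "h \<in> F n" "x = inn n z" "\<psi> x = inn n (z(n := h))"
      by (auto simp: tail_eq_def)
    then have "\<psi> x = s (n, z n, h) x" by (simp add: s_def swap_in)
    moreover have "(n, z n, h) \<in> I" using z by (simp add: I_def lev_iff)
    then obtain k where "e k = (n, z n, h)" unfolding e_def using cI from_nat_into_surj by metis
    ultimately have "\<psi> x = s (e k) x" by simp
    then have "x \<in> B k" using x sub by (auto simp: B_def)
    then show "x \<in> (\<Union>k. B k)" by blast
  qed (auto simp: B_def)
  \<comment> \<open>The sets \<open>B k\<close> may overlap, as several swaps can agree with
    \<open>\<psi>\<close> at a point; \<open>disjointed\<close> selects the first one.\<close>
  define D where "D = disjointed B"
  have Ds: "range D \<subseteq> sets \<mu>" unfolding D_def using Bs by (intro sets.range_disjointed_sets) auto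
  have DE: "(\<Union>k. D k) = E" using BE by (simp add: D_def UN_disjointed_eq)
  have DB: "D k \<subseteq> B k" for k unfolding D_def by (rule disjointed_subset)
  have disj: "disjoint_family D" unfolding D_def by (rule disjoint_family_disjointed)
  have img: "\<psi> ` D k = s (e k) ` D k" for k using DB[of k] by (auto simp: B_def intro!: image_cong)
  have disj': "disjoint_family (\<lambda>k. \<psi> ` D k)"
    unfolding disjoint_family_on_def
  proof (intro ballI impI)
    fix k l :: nat assume "k \<noteq> l"
    then have "D k \<inter> D l = {}" using disj by (auto simp: disjoint_family_on_def)
    moreover have "D k \<subseteq> pts" "D l \<subseteq> pts" using DE sub by auto
    ultimately show "\<psi> ` D k \<inter> \<psi> ` D l = {}" using inj by (metis image_empty inj_on_image_Int)
  qed
  have "emeasure \<mu> (\<psi> ` E) = emeasure \<mu> (\<Union>k. \<psi> ` D k)" using DE by (metis image_UN)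
  also have "\<dots> = (\<Sum>k. emeasure \<mu> (\<psi> ` D k))"
    using disj' Ds si[OF eI] by (intro suminf_emeasure[symmetric]) (auto simp: img)
  also have "\<dots> = (\<Sum>k. emeasure \<mu> (D k))"
    using si[OF eI] Ds by (simp add: img range_subsetD)
  also have "\<dots> = emeasure \<mu> E"
    using suminf_emeasure[OF Ds disj] DE by simp
  finally show ?thesis .
qed

end

subsection \<open>Finite searches\<close>

lemma map_graph_app_map:
  assumes "distinct xs" "length zs = length xs"
  shows "zip xs zs = map (\<lambda>x. (x, app_map (zip xs zs) x)) xs"
  using assms by (intro nth_equalityI) (auto simp: app_map_def map_of_zip_nth)

lemma app_map_graph: "x \<in> set xs \<Longrightarrow> app_map (map (\<lambda>x. (x, h x)) xs) x = h x"
  by (simp add: app_map_def map_of_map_restrict)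

lemma all_maps_graph: "h ` set xs \<subseteq> set ys \<Longrightarrow> map (\<lambda>x. (x, h x)) xs \<in> set (all_maps xs ys)"
proof -
  assume "h ` set xs \<subseteq> set ys"
  then have "map h xs \<in> set (List.n_lists (length xs) ys)" by (simp add: set_n_lists)
  moreover have "map (\<lambda>x. (x, h x)) xs = zip xs (map h xs)"
    by (simp add: zip_map2 zip_same_conv_map)
  ultimately show ?thesis unfolding all_maps_def by simp
qed

text \<open>Exhibiting one admissible map makes the search succeed. The map found may be a different
  one, so it is known only through P and as the graph of a function on \<open>xs\<close>.\<close>

lemma find_all_maps:
  assumes xs: "distinct xs" and h: "h ` set xs \<subseteq> set ys" and P: "P (map (\<lambda>x. (x, h x)) xs)"
  obtains al where "find P (all_maps xs ys) = Some al" "P al"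
    "al = map (\<lambda>x. (x, app_map al x)) xs" "app_map al ` set xs \<subseteq> set ys"
proof -
  have "find P (all_maps xs ys) \<noteq> None"
    using all_maps_graph[OF h] P by (auto simp: find_None_iff)
  then obtain al where al: "find P (all_maps xs ys) = Some al" by blast
  then have "P al" "al \<in> set (all_maps xs ys)" by (auto simp: find_Some_iff)
  then obtain zs where zs: "length zs = length xs" "set zs \<subseteq> set ys" "al = zip xs zs"
    by (auto simp: all_maps_def set_n_lists)
  have g: "al = map (\<lambda>x. (x, app_map al x)) xs" using map_graph_app_map xs zs by blast
  then have "map snd al = map (app_map al) xs" by (metis (no_types, lifting) map_map comp_def map_cong snd_conv)
  then have "zs = map (app_map al) xs" using zs by simp
  then have "set zs = app_map al ` set xs" by (metis set_map)
  then have "app_map al ` set xs \<subseteq> set ys" using zs(2) by simp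
  then show ?thesis using that al \<open>P al\<close> g by blast
qed

lemma distinct_map_snd_graph:
  "al = map (\<lambda>x. (x, h x)) xs \<Longrightarrow> distinct xs \<Longrightarrow> distinct (map snd al) \<longleftrightarrow> inj_on h (set xs)"
  by (simp add: distinct_map comp_def inj_on_def)

lemma search_level_Some:
  assumes "P m s"
  obtains m' s' where "search_level P = Some (m', s')" "P m' s'"
proof -
  define m' where "m' = (LEAST m. \<exists>s. P m s)"
  have "\<exists>s. P m' s" unfolding m'_def using assms by (intro LeastI[of "\<lambda>m. \<exists>s. P m s" m]) blast
  then have "P m' (LEAST s. P m' s)" using LeastI[of "P m'"] by blast
  moreover have "search_level P = Some (m', LEAST s. P m' s)"
    using assms by (auto simp: search_level_def Let_def m'_def)
  ultimately show ?thesis using that by blast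
qed

text \<open>Outside the prescribed part at least as many values as arguments are left, because
  \<open>g\<close> uses exactly one value per argument.\<close>

lemma extend_injection:
  assumes fin: "finite A" "finite B" and sub: "A0 \<subseteq> A" and card: "card A \<le> card B"
    and g: "inj_on g A0" "g ` A0 \<subseteq> B"
  obtains h where "inj_on h A" "h ` A \<subseteq> B" "\<And>x. x \<in> A0 \<Longrightarrow> h x = g x"
proof -
  have fin0: "finite A0" using sub fin finite_subset by blast
  have "card (A - A0) \<le> card (B - g ` A0)"
    using fin fin0 sub card g card_mono[OF fin(2) g(2)] card_mono[OF fin(1) sub]
    by (simp add: card_Diff_subset card_image)
  then obtain k where k: "k ` (A - A0) \<subseteq> B - g ` A0" "inj_on k (A - A0)"
    using card_le_inj[of "A - A0" "B - g ` A0"] fin by auto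
  define h where "h x = (if x \<in> A0 then g x else k x)" for x
  have "inj_on h (A0 \<union> (A - A0))"
  proof (subst inj_on_Un, intro conjI)
    have 1: "h ` A0 = g ` A0" "h ` (A - A0) = k ` (A - A0)" by (auto simp: h_def)
    show "inj_on h A0" using g(1) by (simp add: h_def inj_on_def)
    show "inj_on h (A - A0)" using k(2) by (simp add: h_def inj_on_def)
    show "h ` (A0 - (A - A0)) \<inter> h ` (A - A0 - A0) = {}" using 1 k(1) by auto
  qed
  then have "inj_on h A" using sub by (simp add: Un_absorb1)
  moreover have "h ` A \<subseteq> B" using k g(2) by (auto simp: h_def)
  ultimately show ?thesis using that by (simp add: h_def)
qed

subsection \<open>Stages\<close>

lemma cf_enum_p: "cf_enum C F Cl Fl \<Longrightarrow> cf_p (set \<circ> Cl) n = cf_p C n"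
  unfolding cf_p_def cf_enum_def by (intro prod.cong) auto

lemma cf_enum_F:
  assumes "cf_enum C F Cl Fl"
  shows "set (Fl n) = F n" "distinct (Fl n)" "length (Fl n) = card (F n)"
proof -
  show 1: "set (Fl n) = F n" and 2: "distinct (Fl n)" using assms unfolding cf_enum_def by auto
  show "length (Fl n) = card (F n)" using distinct_card[OF 2] 1 by simp
qed

lemma cf_enum_words: "cf_enum C F Cl Fl \<Longrightarrow> set (cf_words G Cl n j) = cf_W G C n j"
proof (induction j)
  case (Suc j)
  have "set (Cl (Suc (n + j))) = C (Suc (n + j))" using Suc.prems unfolding cf_enum_def by simp
  then show ?case using Suc by (auto simp: set_mult_def)
qed simp

text \<open>The first clause amounts to \<open>1 / p_src = d * mult / p'_tgt\<close>: a source
  cylinder has the \<open>d\<close>-scaled measure of its pieces.\<close>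

definition stage_ok ::
    "(nat \<Rightarrow> 'g set) \<Rightarrow> (nat \<Rightarrow> 'g list) \<Rightarrow> (nat \<Rightarrow> 'g set) \<Rightarrow> (nat \<Rightarrow> 'g list) \<Rightarrow> real \<Rightarrow> 'g cf_stage \<Rightarrow> bool"
  where
  "stage_ok C Fl C' Fl' d st \<longleftrightarrow>
     real (cf_p C' (tgt st)) = d * real (cf_p C (src st)) * real (mult st) \<and>
     (let xs = List.product (Fl (src st)) [0..<mult st] in
      inj_map st = map (\<lambda>x. (x, app_map (inj_map st) x)) xs \<and>
      inj_on (app_map (inj_map st)) (set xs) \<and>
      app_map (inj_map st) ` set xs \<subseteq> set (Fl' (tgt st)))"

lemma stage_ok_set:
  assumes "stage_ok C Fl C' Fl' d st"
  shows "set (inj_map st) =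
    (\<lambda>x. (x, app_map (inj_map st) x)) ` (set (Fl (src st)) \<times> {..<mult st})"
proof -
  have "set (inj_map st) = set (map (\<lambda>x. (x, app_map (inj_map st) x))
      (List.product (Fl (src st)) [0..<mult st]))"
    using assms unfolding stage_ok_def Let_def by argo
  then show ?thesis by (simp add: atLeast0LessThan)
qed

lemma first_stage_ok:
  assumes e: "cf_enum C F Cl Fl" and e': "cf_enum C' F' Cl' Fl'"
    and fit: "cf_fits Cl Fl Cl' Fl' d 0 m s"
  obtains st where "cf_first_stage Cl Fl Cl' Fl' d = Some st"
    "stage_ok C Fl C' Fl' d st"
proof -
  obtain m s where ms: "search_level (cf_fits Cl Fl Cl' Fl' d 0) = Some (m, s)"
    "cf_fits Cl Fl Cl' Fl' d 0 m s"
    using fit by (rule search_level_Some)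
  let ?xs = "List.product (Fl 0) [0..<s]"
  have dx: "distinct ?xs" using cf_enum_F[OF e] by (simp add: distinct_product)
  have "card (set ?xs) \<le> card (set (Fl' m))"
    using ms(2) cf_enum_F[OF e] cf_enum_F[OF e'] by (simp add: cf_fits_def card_cartesian_product)
  then obtain h where h: "h ` set ?xs \<subseteq> set (Fl' m)" "inj_on h (set ?xs)"
    using card_le_inj[of "set ?xs" "set (Fl' m)"] by auto
  let ?P = "\<lambda>\<alpha>. distinct (map snd \<alpha>)"
  have "?P (map (\<lambda>x. (x, h x)) ?xs)" using distinct_map_snd_graph[OF refl dx] h by blast
  then obtain \<alpha> where \<alpha>: "find ?P (all_maps ?xs (Fl' m)) = Some \<alpha>" "?P \<alpha>"
    "\<alpha> = map (\<lambda>x. (x, app_map \<alpha> x)) ?xs" "app_map \<alpha> ` set ?xs \<subseteq> set (Fl' m)"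
    using find_all_maps[OF dx h(1), of ?P] by blast
  let ?st = "\<lparr>src = 0, tgt = m, mult = s, inj_map = \<alpha>\<rparr>"
  have "cf_first_stage Cl Fl Cl' Fl' d = Some ?st"
    using ms(1) \<alpha>(1) by (simp add: cf_first_stage_def)
  moreover have "stage_ok C Fl C' Fl' d ?st"
    using \<alpha> ms(2) distinct_map_snd_graph[OF \<alpha>(3) dx] cf_enum_p[OF e] cf_enum_p[OF e']
    by (simp add: stage_ok_def cf_fits_def)
  ultimately show ?thesis using that by simp
qed

text \<open>The stage \<open>st\<close> leads from the primed to the unprimed space, the new one
  leads back. The composition law prescribes the new map on the values of \<open>st\<close>; unique
  factorization makes this part injective, and the room granted by \<open>cf_fits\<close> lets it be
  extended to the remaining pieces.\<close>

lemma next_stage_ok: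
  assumes S: "cf_space G C F" and S': "cf_space G C' F'"
    and e: "cf_enum C F Cl Fl" and e': "cf_enum C' F' Cl' Fl'"
    and st: "stage_ok C' Fl' C Fl d0 st" and d: "d0 * d = 1"
    and fit: "src st < m" "cf_fits Cl Fl Cl' Fl' d (tgt st) m s"
  obtains st' \<theta> where "cf_next_stage G Cl Fl Cl' Fl' d st = Some st'" "src st' = tgt st"
    "src st < tgt st'" "stage_ok C Fl C' Fl' d st'"
    "bij_betw \<theta> ({..<mult st} \<times> {..<mult st'}) (cf_W G C' (src st) (tgt st' - src st))"
    "\<And>f l k. f \<in> F' (src st) \<Longrightarrow> l < mult st \<Longrightarrow> k < mult st' \<Longrightarrow>
       app_map (inj_map st') (app_map (inj_map st) (f, l), k) = f \<otimes>\<^bsub>G\<^esub> \<theta> (l, k)"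
proof -
  interpret S: cf_space G C F by (rule S)
  interpret S': cf_space G C' F' by (rule S')
  let ?Q = "\<lambda>m s. src st < m \<and> cf_fits Cl Fl Cl' Fl' d (tgt st) m s"
  obtain m s where ms: "search_level ?Q = Some (m, s)" "?Q m s"
    using search_level_Some[of ?Q m s] fit by blast
  define n where "n = src st"
  define a where "a = app_map (inj_map st)"
  define Wd where "Wd = cf_words G Cl' n (m - n)"
  have W: "set Wd = cf_W G C' n (m - n)" unfolding Wd_def using cf_enum_words[OF e'] .
  have nm: "n + (m - n) = m" using ms(2) by (simp add: n_def)
  have inj_a: "inj_on a (F' n \<times> {..<mult st})" and a_F: "a ` (F' n \<times> {..<mult st}) \<subseteq> F (tgt st)"
    using st cf_enum_F[OF e] cf_enum_F[OF e']
    by (simp_all add: stage_ok_def Let_def a_def n_def atLeast0LessThan)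
  \<comment> \<open>The measure identities of both stages give
    \<open>card Wd = p'_m / p'_n = d0 * d * mult st * s\<close>, where the scale factors
    cancel.\<close>
  have "real (cf_p C' n) * real (card (set Wd)) = real (cf_p C' m)"
    using S'.card_W[of n "m - n"] nm W by (metis of_nat_mult)
  also have "\<dots> = d * real (cf_p C (tgt st)) * real s"
    using ms(2) cf_enum_p[OF e] cf_enum_p[OF e'] by (simp add: cf_fits_def)
  also have "real (cf_p C (tgt st)) = d0 * real (cf_p C' n) * real (mult st)"
    using st by (simp add: stage_ok_def n_def)
  also have "d * (d0 * real (cf_p C' n) * real (mult st)) * real s
      = (d0 * d) * (real (cf_p C' n) * real (mult st * s))" by simp
  finally have cW: "card (set Wd) = mult st * s"
    using S'.p_pos[of n] d by (simp del: of_nat_mult)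
  let ?ys = "List.product [0..<mult st] [0..<s]"
  have dy: "distinct ?ys" by (simp add: distinct_product)
  have "card (set ?ys) = card (set Wd)" by (simp add: cW card_cartesian_product)
  then obtain t where t: "bij_betw t (set ?ys) (set Wd)"
    using finite_same_card_bij[of "set ?ys" "set Wd"] by blast
  let ?P1 = "\<lambda>\<theta>. distinct (map snd \<theta>) \<and> set (map snd \<theta>) = set Wd"
  have ti: "t ` set ?ys \<subseteq> set Wd" using bij_betw_imp_surj_on[OF t] by (rule equalityD1)
  have tP: "?P1 (map (\<lambda>x. (x, t x)) ?ys)"
    using t distinct_map_snd_graph[OF refl dy, of t]
    by (auto simp: bij_betw_def image_image)
  obtain \<theta> where \<theta>: "find ?P1 (all_maps ?ys Wd) = Some \<theta>" "?P1 \<theta>"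
    "\<theta> = map (\<lambda>x. (x, app_map \<theta> x)) ?ys" "app_map \<theta> ` set ?ys \<subseteq> set Wd"
    by (rule find_all_maps[OF dy ti, of ?P1, OF tP])
  define th where "th = app_map \<theta>"
  have "set (map snd \<theta>) = th ` set ?ys" by (subst \<theta>(3)) (simp add: th_def image_image del: set_product)
  then have bij: "bij_betw th ({..<mult st} \<times> {..<s}) (cf_W G C' n (m - n))"
    using \<theta>(2) distinct_map_snd_graph[OF \<theta>(3) dy] W
    by (simp add: bij_betw_def th_def atLeast0LessThan)
  then have thW: "th (l, k) \<in> cf_W G C' n (m - n)" if "l < mult st" "k < s" for l k
    using that by (auto dest: bij_betwE)
  let ?xs = "List.product (Fl (tgt st)) [0..<s]"
  have dx: "distinct ?xs" using cf_enum_F[OF e] by (simp add: distinct_product)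
  have sx: "set ?xs = F (tgt st) \<times> {..<s}" using cf_enum_F[OF e] by (simp add: atLeast0LessThan)
  define ia where "ia = inv_into (F' n \<times> {..<mult st}) a"
  have ia: "ia (a (f, l)) = (f, l)" if "f \<in> F' n" "l < mult st" for f l
    unfolding ia_def using inj_a that by (intro inv_into_f_f) auto
  \<comment> \<open>The part of the new map forced by the composition law: decode a value of
    \<open>st\<close> into \<open>(f, l)\<close>, then append the word \<open>th (l, k)\<close> to
    \<open>f\<close>.\<close>
  define g where "g = (\<lambda>(b, k). fst (ia b) \<otimes>\<^bsub>G\<^esub> th (snd (ia b), k))"
  have g: "g (a (f, l), k) = f \<otimes>\<^bsub>G\<^esub> th (l, k)" if "f \<in> F' n" "l < mult st" for f l k
    using that by (simp add: g_def ia)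
  let ?A0 = "a ` (F' n \<times> {..<mult st}) \<times> {..<s}"
  have gi: "inj_on g ?A0"
  proof (rule inj_onI)
    fix x y assume "x \<in> ?A0" "y \<in> ?A0" and eq: "g x = g y"
    then obtain f l k f' l' k' where x: "x = (a (f, l), k)" "f \<in> F' n" "l < mult st" "k < s"
      and y: "y = (a (f', l'), k')" "f' \<in> F' n" "l' < mult st" "k' < s" by auto
    have "f = f' \<and> th (l, k) = th (l', k')"
      using S'.FW_inj[OF x(2) y(2) thW[OF x(3,4)] thW[OF y(3,4)]] eq x y g by simp
    moreover from this have "(l, k) = (l', k')"
      using bij x y by (auto simp: bij_betw_def dest!: inj_onD)
    ultimately show "x = y" using x y by simp
  qed
  have gF: "g ` ?A0 \<subseteq> F' m"
    using S'.FW[OF _ thW] nm by (auto simp: g)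
  have cle: "card (F (tgt st) \<times> {..<s}) \<le> card (F' m)"
    using ms(2) cf_enum_F[OF e] cf_enum_F[OF e'] by (simp add: cf_fits_def card_cartesian_product)
  have A0: "?A0 \<subseteq> F (tgt st) \<times> {..<s}" using a_F by auto
  have finA: "finite (F (tgt st) \<times> {..<s})" using S.F_finite by simp
  obtain h where h: "inj_on h (F (tgt st) \<times> {..<s})" "h ` (F (tgt st) \<times> {..<s}) \<subseteq> F' m"
    "\<And>x. x \<in> ?A0 \<Longrightarrow> h x = g x"
    using extend_injection[OF finA S'.F_finite A0 cle gi gF] by blast
  let ?P2 = "\<lambda>\<alpha>. distinct (map snd \<alpha>) \<and> (\<forall>((f, l), b)\<in>set (inj_map st). \<forall>k<s.
                 app_map \<alpha> (b, k) = f \<otimes>\<^bsub>G\<^esub> app_map \<theta> (l, k))"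
  have set_st: "set (inj_map st) = (\<lambda>x. (x, a x)) ` (F' n \<times> {..<mult st})"
    using stage_ok_set[OF st] cf_enum_F(1)[OF e'] by (simp add: a_def n_def)
  have "?P2 (map (\<lambda>x. (x, h x)) ?xs)"
  proof (intro conjI)
    show "distinct (map snd (map (\<lambda>x. (x, h x)) ?xs))"
      using distinct_map_snd_graph[OF refl dx, of h] h(1) sx by simp
    have "app_map (map (\<lambda>x. (x, h x)) ?xs) (a (f, l), k) = f \<otimes>\<^bsub>G\<^esub> th (l, k)"
      if "f \<in> F' n" "l < mult st" "k < s" for f l k
    proof -
      have "(a (f, l), k) \<in> ?A0" using that by auto
      moreover from this have "(a (f, l), k) \<in> set ?xs" using sx a_F by blast
      ultimately show ?thesis using h(3) g that by (simp add: app_map_graph del: set_product)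
    qed
    then show "\<forall>((f, l), b)\<in>set (inj_map st). \<forall>k<s.
                 app_map (map (\<lambda>x. (x, h x)) ?xs) (b, k) = f \<otimes>\<^bsub>G\<^esub> app_map \<theta> (l, k)"
      unfolding set_st th_def by auto
  qed
  note hP = this
  have hi: "h ` set ?xs \<subseteq> set (Fl' m)" using h(2) sx cf_enum_F(1)[OF e'] by simp
  obtain \<alpha> where \<alpha>: "find ?P2 (all_maps ?xs (Fl' m)) = Some \<alpha>" "?P2 \<alpha>"
    "\<alpha> = map (\<lambda>x. (x, app_map \<alpha> x)) ?xs" "app_map \<alpha> ` set ?xs \<subseteq> set (Fl' m)"
    by (rule find_all_maps[OF dx hi, of ?P2, OF hP])
  let ?st = "\<lparr>src = tgt st, tgt = m, mult = s, inj_map = \<alpha>\<rparr>"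
  have 1: "cf_next_stage G Cl Fl Cl' Fl' d st = Some ?st"
    using ms(1) \<theta>(1) \<alpha>(1) unfolding cf_next_stage_def Wd_def n_def by simp
  have 2: "stage_ok C Fl C' Fl' d ?st"
    using \<alpha> ms(2) distinct_map_snd_graph[OF \<alpha>(3) dx] cf_enum_p[OF e] cf_enum_p[OF e']
    by (simp add: stage_ok_def cf_fits_def)
  have 3: "app_map \<alpha> (a (f, l), k) = f \<otimes>\<^bsub>G\<^esub> th (l, k)"
    if "f \<in> F' n" "l < mult st" "k < s" for f l k
  proof -
    have "((f, l), a (f, l)) \<in> set (inj_map st)" using set_st that by auto
    then show ?thesis using \<alpha>(2) that unfolding th_def by blast
  qed
  show ?thesis
    by (rule that[of ?st th]) (use 1 2 3 bij ms(2) in \<open>simp_all add: n_def a_def\<close>)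
qed

subsection \<open>Existence of admissible levels\<close>

text \<open>From \<open>1 / p_n \<in> d D'\<close> comes \<open>p'_k = d p_n z\<close> with an
  integer z, positive because the other factors are. Passing to a later level multiplies
  \<open>p'_k\<close> by a number of words, so the divisibility persists.\<close>

lemma cf_D_cofinal:
  assumes S': "cf_space G C' F'" and D: "cf_D C = (\<lambda>x. d * x) ` cf_D C'" and d: "d > 0"
    and p: "cf_p C n > 0"
  obtains k where "\<And>m. m \<ge> k \<Longrightarrow> \<exists>s::nat. real (cf_p C' m) = d * real (cf_p C n) * real s"
proof -
  interpret S': cf_space G C' F' by (rule S')
  have "real_of_int 1 / real (cf_p C n) \<in> cf_D C" unfolding cf_D_def by blast
  then obtain z :: int and k where zk: "1 / real (cf_p C n) = d * (real_of_int z / real (cf_p C' k))"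
    unfolding D by (auto simp: cf_D_def)
  have pk: "real (cf_p C' k) = d * real (cf_p C n) * real_of_int z"
    using zk p S'.p_pos[of k] by (simp add: field_simps)
  then have "0 < (d * real (cf_p C n)) * real_of_int z" using S'.p_pos[of k] by simp
  moreover have "d * real (cf_p C n) > 0" using d p by simp
  ultimately have "z > 0" using zero_less_mult_pos by fastforce
  then obtain q where q: "z = int q" using pos_int_cases by blast
  have "\<exists>s::nat. real (cf_p C' m) = d * real (cf_p C n) * real s" if "m \<ge> k" for m
  proof -
    obtain j where "m = k + j" using \<open>m \<ge> k\<close> le_Suc_ex by blast
    then have "real (cf_p C' m) = d * real (cf_p C n) * real (q * card (cf_W G C' k j))"
      using S'.card_W[of k j, symmetric] pk q by simp
    then show ?thesis by blast
  qed
  then show ?thesis using that by blast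
qed

text \<open>The supremum over m of the \<open>d\<close>-scaled measures of \<open>X'_m\<close> is
  the total measure of X, which exceeds that of \<open>X_n\<close>; so some level exceeds it, and
  then all later ones. This persistence lets room be combined with divisibility and with
  \<open>N < m\<close>. Infinite total measure is included.\<close>

lemma fits_exists:
  assumes S: "cf_haar_space G C F \<mu>" and S': "cf_haar_space G C' F' \<mu>'"
    and e: "cf_enum C F Cl Fl" and e': "cf_enum C' F' Cl' Fl'"
    and nc: "\<not> compact_space (cf_top G C F)" and d: "d > 0"
    and D: "cf_D C = (\<lambda>x. d * x) ` cf_D C'"
    and mu: "emeasure \<mu> (cf_points G C F) = ennreal d * emeasure \<mu>' (cf_points G C' F')"
  obtains m s where "N < m" "cf_fits Cl Fl Cl' Fl' d n m s"
proof -
  interpret S: cf_haar_space G C F \<mu> by (rule S)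
  interpret S': cf_haar_space G C' F' \<mu>' by (rule S')
  obtain k where k: "\<And>m. m \<ge> k \<Longrightarrow> \<exists>s::nat. real (cf_p C' m) = d * real (cf_p C n) * real s"
    using cf_D_cofinal[OF S'.cf_space_axioms D d S.p_pos] by blast
  let ?r = "\<lambda>m. ennreal (real (card (F' m)) / real (cf_p C' m))"
  have "ennreal (real (card (F n)) / real (cf_p C n)) < (SUP m. ennreal d * ?r m)"
    using S.haar_lev_less[OF nc, of n] unfolding mu S'.haar_total by (simp add: SUP_mult_left_ennreal)
  then obtain m0 where m0: "ennreal (real (card (F n)) / real (cf_p C n)) < ennreal d * ?r m0"
    by (auto simp: less_SUP_iff)
  define m where "m = max (Suc N) (max k m0)"
  obtain s where s: "real (cf_p C' m) = d * real (cf_p C n) * real s" using k[of m] unfolding m_def by fastforce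
  have "ennreal (real (card (F n)) / real (cf_p C n)) < ennreal d * ?r m"
    using m0 mult_left_mono[OF S'.haar_lev_mono[of m0 m], of "ennreal d"]
    by (rule less_le_trans) (simp_all add: m_def)
  then have lt: "real (card (F n)) / real (cf_p C n) < d * (real (card (F' m)) / real (cf_p C' m))"
    using d by (simp add: ennreal_mult'[symmetric] ennreal_less_iff)
  have pn: "real (cf_p C n) > 0" and pm: "real (cf_p C' m) > 0" using S.p_pos S'.p_pos by simp_all
  have "0 < real s" using pm pn d s by (simp add: zero_less_mult_iff)
  have "d * (real (card (F' m)) / real (cf_p C' m)) = real (card (F' m)) / (real (cf_p C n) * real s)"
    using d pn \<open>0 < real s\<close> unfolding s by (simp add: field_simps)
  then have "real (card (F n)) / real (cf_p C n) < real (card (F' m)) / (real (cf_p C n) * real s)"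
    using lt by simp
  then have "real (card (F n)) * real s < real (card (F' m))"
    using pn \<open>0 < real s\<close> by (simp add: field_simps)
  then have 1: "card (F n) * s < card (F' m)" by (metis of_nat_less_iff of_nat_mult)
  \<comment> \<open>The bound on \<open>s\<close> in \<open>cf_fits\<close> keeps the search for it
    finite; it follows from the room condition because \<open>F n\<close> is nonempty.\<close>
  have "card (F n) \<ge> 1" using S.F_nonempty S.F_finite by (simp add: Suc_le_eq card_gt_0_iff)
  then have "s \<le> card (F n) * s" by simp
  then have "s \<le> card (F' m)" using 1 by linarith
  then have "cf_fits Cl Fl Cl' Fl' d n m s"
    using 1 s cf_enum_F[OF e] cf_enum_F[OF e'] cf_enum_p[OF e] cf_enum_p[OF e']
    by (simp add: cf_fits_def)
  moreover have "N < m" by (simp add: m_def)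
  ultimately show ?thesis using that by blast
qed

subsection \<open>Back and forth\<close>

text \<open>The two spaces are indexed by the parity of the stages that start in them: stage \<open>i\<close> cuts the cylinders
  of level \<open>lv i\<close> into \<open>mu i\<close> pieces and maps piece \<open>l\<close> of \<open>f\<close> onto the cylinder \<open>al i (f, l)\<close>.\<close>

locale zigzag =
  fixes G :: "('g, 'b) monoid_scheme" (structure)
    and CC FF :: "bool \<Rightarrow> nat \<Rightarrow> 'g set"
    and lv mu :: "nat \<Rightarrow> nat" and al :: "nat \<Rightarrow> 'g \<times> nat \<Rightarrow> 'g" and th :: "nat \<Rightarrow> nat \<times> nat \<Rightarrow> 'g"
  assumes space: "cf_space G (CC b) (FF b)"
    and lv: "lv i < lv (Suc (Suc i))"
    and al_F: "f \<in> FF (even i) (lv i) \<Longrightarrow> l < mu i \<Longrightarrow> al i (f, l) \<in> FF (odd i) (lv (Suc i))"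
    and th: "bij_betw (th i) ({..<mu i} \<times> {..<mu (Suc i)})
               (cf_W G (CC (even i)) (lv i) (lv (Suc (Suc i)) - lv i))"
    and comp: "f \<in> FF (even i) (lv i) \<Longrightarrow> l < mu i \<Longrightarrow> k < mu (Suc i) \<Longrightarrow>
               al (Suc i) (al i (f, l), k) = f \<otimes> th i (l, k)"
begin

sublocale sp: cf_space G "CC b" "FF b" for b
  by (rule space)

lemma lv_add: "lv i + j \<le> lv (i + 2 * j)"
proof (induction j)
  case (Suc j)
  then show ?case using lv[of "i + 2 * j"] by simp
qed simp

lemma lv_large:
  obtains i where "i \<ge> N" "even i = b" "lv i \<ge> K"
proof -
  define i where "i = (if even N = b then N else Suc N) + 2 * K"
  have "i \<ge> N" "even i = b" by (auto simp: i_def)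
  moreover have "lv i \<ge> K" using lv_add[of _ K] unfolding i_def by (meson le_add2 order_trans)
  ultimately show ?thesis using that by blast
qed

text \<open>The alternating sequence of cylinders \<open>e i\<close> that is run through by a point and its image; \<open>l i\<close> is the
  number of the piece of \<open>e i\<close> that contains the next member.\<close>

definition thread :: "nat \<Rightarrow> (nat \<Rightarrow> 'g) \<Rightarrow> (nat \<Rightarrow> nat) \<Rightarrow> bool" where
  "thread N e l \<longleftrightarrow> e N \<in> FF (even N) (lv N) \<and> (\<forall>i\<ge>N. l i < mu i \<and> e (Suc i) = al i (e i, l i))"

lemma thread_F:
  assumes t: "thread N e l" and i: "i \<ge> N"
  shows "e i \<in> FF (even i) (lv i)"
  using i
proof (induction i rule: nat_induct_at_least)
  case base
  then show ?case using t by (simp add: thread_def)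
next
  case (Suc i)
  then show ?case using t al_F[of "e i" i "l i"] by (simp add: thread_def)
qed

lemma thread_mono: "thread N e l \<Longrightarrow> N \<le> M \<Longrightarrow> thread M e l"
  using thread_F unfolding thread_def by simp

lemma thread_step:
  assumes "thread N e l" "i \<ge> N"
  shows "e (Suc (Suc i)) = e i \<otimes> th i (l i, l (Suc i))"
  using comp[OF thread_F[OF assms], of "l i" "l (Suc i)"] assms by (simp add: thread_def)

lemma th_W: "l < mu i \<Longrightarrow> k < mu (Suc i) \<Longrightarrow>
    th i (l, k) \<in> cf_W G (CC (even i)) (lv i) (lv (Suc (Suc i)) - lv i)"
  using bij_betwE[OF th] by blast

lemma thread_th_W: "thread N e l \<Longrightarrow> i \<ge> N \<Longrightarrow>
    th i (l i, l (Suc i)) \<in> cf_W G (CC (even i)) (lv i) (lv (Suc (Suc i)) - lv i)"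
  by (rule th_W) (simp_all add: thread_def)

lemma thread_nested:
  assumes "thread N e l" "i \<ge> N"
  shows "sp.cyl (even i) (lv (Suc (Suc i))) (e (Suc (Suc i))) \<subseteq> sp.cyl (even i) (lv i) (e i)"
  using sp.cyl_sub[OF thread_th_W[OF assms] thread_F[OF assms]] thread_step[OF assms] lv[of i] by simp

text \<open>The appended words depend on the piece numbers only, not on the starting cylinder; this
  is why tails are carried to tails.\<close>

lemma thread_words:
  assumes "thread N e l" "thread N e' l"
  shows "\<exists>w\<in>cf_W G (CC (even N)) (lv N) (lv (N + 2 * j) - lv N).
    e (N + 2 * j) = e N \<otimes> w \<and> e' (N + 2 * j) = e' N \<otimes> w"
proof (induction j)
  case 0
  have "e N \<in> carrier G" "e' N \<in> carrier G"
    using sp.F_closed thread_F assms by blast+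
  then show ?case by simp
next
  case (Suc j)
  let ?i = "N + 2 * j"
  obtain w where w: "w \<in> cf_W G (CC (even N)) (lv N) (lv ?i - lv N)"
    "e ?i = e N \<otimes> w" "e' ?i = e' N \<otimes> w" using Suc by blast
  let ?v = "th ?i (l ?i, l (Suc ?i))"
  have le: "lv N \<le> lv ?i" using lv_add[of N j] by simp
  have v: "?v \<in> cf_W G (CC (even N)) (lv N + (lv ?i - lv N)) (lv (Suc (Suc ?i)) - lv ?i)"
    using thread_th_W[OF assms(1), of ?i] le by simp
  have "w \<otimes> ?v \<in> cf_W G (CC (even N)) (lv N) ((lv ?i - lv N) + (lv (Suc (Suc ?i)) - lv ?i))"
    using sp.W_append[OF w(1) v] .
  moreover have "(lv ?i - lv N) + (lv (Suc (Suc ?i)) - lv ?i) = lv (N + 2 * Suc j) - lv N"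
    using le lv[of ?i] by simp
  moreover have "a \<otimes> w \<otimes> ?v = a \<otimes> (w \<otimes> ?v)" if "a \<in> FF (even N) (lv N)" for a
    using that sp.F_closed sp.W_closed[OF w(1)] sp.W_closed[OF v] sp.m_assoc by blast
  ultimately show ?case
    using thread_step[OF assms(1), of ?i] thread_step[OF assms(2), of ?i] w
      thread_F[OF assms(1), of N] thread_F[OF assms(2), of N]
    by (intro bexI[of _ "w \<otimes> ?v"]) simp_all
qed

lemma thread_exists:
  assumes f: "f \<in> FF (even N) (lv N)" and l: "\<And>i. i \<ge> N \<Longrightarrow> l i < mu i"
  obtains e where "thread N e l" "e N = f"
proof -
  define r where "r = rec_nat f (\<lambda>k x. al (N + k) (x, l (N + k)))"
  have "thread N (\<lambda>i. r (i - N)) l"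
    using f l unfolding thread_def r_def by (auto simp: Suc_diff_le)
  moreover have "r (N - N) = f" by (simp add: r_def)
  ultimately show ?thesis using that[of "\<lambda>i. r (i - N)"] by blast
qed

text \<open>Members of even index are cylinders of the space \<open>True\<close>, those of odd index
  of the space \<open>False\<close>; a point follows the members that lie in its own space.\<close>

definition follows :: "bool \<Rightarrow> nat \<Rightarrow> (nat \<Rightarrow> 'g) \<Rightarrow> (nat \<times> (nat \<Rightarrow> 'g)) set \<Rightarrow> bool" where
  "follows b N e x \<longleftrightarrow> x \<in> sp.pts b \<and> (\<forall>i\<ge>N. even i = b \<longrightarrow> x \<in> sp.cyl b (lv i) (e i))"

lemma followsD: "follows b N e x \<Longrightarrow> i \<ge> N \<Longrightarrow> even i = b \<Longrightarrow> x \<in> sp.cyl b (lv i) (e i)"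
  by (simp add: follows_def)

lemma point_of_thread:
  assumes t: "thread N e l"
  obtains x where "follows b N e x"
proof -
  \<comment> \<open>The first index from N on whose member lies in the space b.\<close>
  define i0 where "i0 = (if even N = b then N else Suc N)"
  have i0: "i0 \<ge> N" "even i0 = b" by (auto simp: i0_def)
  let ?c = "\<lambda>j. sp.cyl b (lv (i0 + 2 * j)) (e (i0 + 2 * j))"
  have "?c j \<noteq> {}" for j
    using sp.cyl_nonempty[OF thread_F[OF t, of "i0 + 2 * j"]] i0 by simp
  moreover have "?c (Suc j) \<subseteq> ?c j" for j
    using thread_nested[OF t, of "i0 + 2 * j"] i0 by simp
  ultimately obtain x where x: "x \<in> sp.pts b" "\<And>j. x \<in> ?c j"
    using sp.nested_cylinders[of b "\<lambda>j. lv (i0 + 2 * j)" "\<lambda>j. e (i0 + 2 * j)"] by blast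
  have "x \<in> sp.cyl b (lv i) (e i)" if i: "i \<ge> N" "even i = b" for i
  proof -
    have "i \<ge> i0" using i by (auto simp: i0_def intro: Suc_leI le_neq_implies_less)
    moreover have "even (i - i0)" using i i0 \<open>i \<ge> i0\<close> by simp
    ultimately obtain j where "i = i0 + 2 * j" by (metis dvdE le_add_diff_inverse)
    then show ?thesis using x by simp
  qed
  then show ?thesis using that x unfolding follows_def by blast
qed

text \<open>The words that refine the cylinders of \<open>x\<close>, two stages at a time, are
  decoded through the bijections \<open>th\<close> into pairs of piece numbers; these numbers
  determine the thread.\<close>

lemma thread_of_point:
  assumes x: "x \<in> sp.cyl (even N) (lv N) f"
  obtains e l where "thread N e l" "e N = f" "follows (even N) N e x"
proof -
  let ?b = "even N"
  have "\<exists>h. x \<in> sp.cyl ?b (lv (N + 2 * j)) h" for j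
  proof -
    have "lv N + (lv (N + 2 * j) - lv N) = lv (N + 2 * j)" using lv_add[of N j] by simp
    then show ?thesis using sp.cyl_refineE[OF x, of "lv (N + 2 * j) - lv N"] by metis
  qed
  then obtain g where g: "\<And>j. x \<in> sp.cyl ?b (lv (N + 2 * j)) (g j)" by metis
  have g0: "g 0 = f" using g[of 0] sp.cyl_unique x by fastforce
  have "\<exists>q. fst q < mu (N + 2 * j) \<and> snd q < mu (Suc (N + 2 * j)) \<and>
      g (Suc j) = g j \<otimes> th (N + 2 * j) q" for j
  proof -
    let ?i = "N + 2 * j"
    have "lv ?i \<le> lv (N + 2 * Suc j)" using lv[of ?i] by simp
    then obtain w where w: "w \<in> cf_W G (CC ?b) (lv ?i) (lv (N + 2 * Suc j) - lv ?i)" "g (Suc j) = g j \<otimes> w"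
      using sp.cyl_nested[OF g[of j] g[of "Suc j"]] by blast
    then have "w \<in> th ?i ` ({..<mu ?i} \<times> {..<mu (Suc ?i)})"
      using bij_betw_imp_surj_on[OF th[of ?i]] by simp
    then show ?thesis using w(2) by force
  qed
  then obtain q where q: "\<And>j. fst (q j) < mu (N + 2 * j)" "\<And>j. snd (q j) < mu (Suc (N + 2 * j))"
    "\<And>j. g (Suc j) = g j \<otimes> th (N + 2 * j) (q j)" by metis
  \<comment> \<open>Each pair supplies the piece numbers of two consecutive stages, at even and at
    odd distance from N.\<close>
  define l where "l i = (if even (i - N) then fst (q ((i - N) div 2)) else snd (q ((i - N) div 2)))" for i
  have l0: "l (N + 2 * j) = fst (q j)" and l1: "l (Suc (N + 2 * j)) = snd (q j)" for j
    by (auto simp: l_def Suc_diff_le)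
  have "l i < mu i" if i: "i \<ge> N" for i
  proof (cases "even (i - N)")
    case True
    then obtain j where "i = N + 2 * j" using i by (metis dvdE le_add_diff_inverse)
    then show ?thesis using l0 q by simp
  next
    case False
    then obtain j where "i - N = 2 * j + 1" by (meson oddE)
    then have "i = Suc (N + 2 * j)" using i by simp
    then show ?thesis using l1 q by simp
  qed
  then obtain e where e: "thread N e l" "e N = f"
    using thread_exists[OF sp.cyl_F[OF x]] by blast
  have eg: "e (N + 2 * j) = g j" for j
  proof (induction j)
    case 0
    then show ?case using e g0 by simp
  next
    case (Suc j)
    then show ?case using thread_step[OF e(1), of "N + 2 * j"] l0 l1 q by simp
  qed
  have "x \<in> sp.cyl ?b (lv i) (e i)" if i: "i \<ge> N" "even i = ?b" for i
  proof -
    have "even (i - N)" using i by simp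
    then obtain j where "i = N + 2 * j" using i by (metis dvdE le_add_diff_inverse)
    then show ?thesis using g eg by simp
  qed
  then have "follows ?b N e x" using x sp.cyl_pts unfolding follows_def by blast
  then show ?thesis using that e by blast
qed

section \<open>The pairing of points along common threads\<close>

definition matched :: "bool \<Rightarrow> (nat \<times> (nat \<Rightarrow> 'g)) set \<Rightarrow> (nat \<times> (nat \<Rightarrow> 'g)) set \<Rightarrow> bool" where
  "matched b x y \<longleftrightarrow> (\<exists>N e l. thread N e l \<and> follows b N e x \<and> follows (\<not> b) N e y)"

lemma matchedI: "thread N e l \<Longrightarrow> follows b N e x \<Longrightarrow> follows (\<not> b) N e y \<Longrightarrow> matched b x y"
  unfolding matched_def by blast

text \<open>Both spaces enter the definition alike, so the inverse map needs no construction of its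
  own.\<close>

lemma matched_sym: "matched b x y \<Longrightarrow> matched (\<not> b) y x"
  unfolding matched_def by auto

lemma matched_pts: "matched b x y \<Longrightarrow> x \<in> sp.pts b \<and> y \<in> sp.pts (\<not> b)"
  unfolding matched_def follows_def by blast

lemma matched_thread:
  assumes x: "x \<in> sp.cyl (even N) (lv N) f"
  obtains e l y where "thread N e l" "e N = f" "follows (even N) N e x" "follows (odd N) N e y"
    "matched (even N) x y"
proof -
  obtain e l where e: "thread N e l" "e N = f" "follows (even N) N e x"
    using x by (rule thread_of_point)
  obtain y where y: "follows (odd N) N e y" using e(1) by (rule point_of_thread)
  show ?thesis using that e y matchedI[OF e(1,3)] by simp
qed

text \<open>Threads followed by the same \<open>x\<close> eventually share their members of parity
  b. Injectivity of \<open>th\<close> then forces equal piece numbers there, hence equal members of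
  the other parity, and these determine the image.\<close>

lemma matched_unique:
  assumes "matched b x y" "matched b x y'"
  shows "y = y'"
proof -
  obtain N e l where e: "thread N e l" "follows b N e x" "follows (\<not> b) N e y"
    using assms(1) unfolding matched_def by blast
  obtain N' e' l' where e': "thread N' e' l'" "follows b N' e' x" "follows (\<not> b) N' e' y'"
    using assms(2) unfolding matched_def by blast
  have eq: "e i = e' i" if "i \<ge> N" "i \<ge> N'" "even i = b" for i
    using e(2) e'(2) that sp.cyl_unique unfolding follows_def by blast
  have eq': "e (Suc i) = e' (Suc i)" if i: "i \<ge> N" "i \<ge> N'" "even i = b" for i
  proof -
    have "e i \<otimes> th i (l i, l (Suc i)) = e' i \<otimes> th i (l' i, l' (Suc i))"
      using thread_step[OF e(1), of i] thread_step[OF e'(1), of i] eq[of "Suc (Suc i)"] i by simp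
    then have "th i (l i, l (Suc i)) = th i (l' i, l' (Suc i))"
      using sp.FW_inj thread_F[OF e(1), of i] thread_F[OF e'(1), of i]
        thread_th_W[OF e(1), of i] thread_th_W[OF e'(1), of i] i by blast
    moreover have "(l i, l (Suc i)) \<in> {..<mu i} \<times> {..<mu (Suc i)}"
      "(l' i, l' (Suc i)) \<in> {..<mu i} \<times> {..<mu (Suc i)}"
      using e(1) e'(1) i by (auto simp: thread_def)
    ultimately have "l i = l' i" using th[of i] by (auto simp: bij_betw_def dest: inj_onD)
    then show ?thesis using eq[OF i] e(1) e'(1) i by (simp add: thread_def)
  qed
  show ?thesis
  proof (rule sp.separation)
    show "y \<in> sp.pts (\<not> b)" "y' \<in> sp.pts (\<not> b)" using e e' by (auto simp: follows_def)
    fix K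
    obtain i where i: "i \<ge> Suc (max N N')" "even i = (\<not> b)" "lv i \<ge> K" by (rule lv_large)
    then obtain k where k: "i = Suc k" by (cases i) auto
    have "e i = e' i" using eq'[of k] i k by auto
    moreover have "y \<in> sp.cyl (\<not> b) (lv i) (e i)" "y' \<in> sp.cyl (\<not> b) (lv i) (e' i)"
      using e(3) e'(3) i by (auto simp: follows_def)
    ultimately show "\<exists>n\<ge>K. \<exists>f. y \<in> sp.cyl (\<not> b) n f \<and> y' \<in> sp.cyl (\<not> b) n f" using i(3) by metis
  qed
qed

lemma matched_exists:
  assumes x: "x \<in> sp.pts b"
  obtains y where "matched b x y"
proof -
  obtain N where N: "\<And>n. n \<ge> N \<Longrightarrow> \<exists>f\<in>FF b n. x \<in> sp.cyl b n f" using sp.pts_cyl[OF x] by blast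
  obtain i where i: "even i = b" "lv i \<ge> N" using lv_large by metis
  then obtain f where f: "x \<in> sp.cyl (even i) (lv i) f" using N by blast
  obtain e l y where "thread i e l" "e i = f" "follows (even i) i e x" "follows (odd i) i e y"
    "matched (even i) x y" using f by (rule matched_thread)
  then show ?thesis using that i(1) by simp
qed

text \<open>A thread of \<open>x\<close> that starts at stage j + 1 can be prolonged backwards by
  \<open>a\<close> with piece number k; nestedness then puts \<open>y\<close> into the cylinder of
  \<open>a\<close>.\<close>

lemma matched_cyl_forward:
  assumes m: "matched b x y" and j: "even j = (\<not> b)" and a: "a \<in> FF (even j) (lv j)" "k < mu j"
    and x: "x \<in> sp.cyl b (lv (Suc j)) (al j (a, k))"
  shows "y \<in> sp.cyl (\<not> b) (lv j) a"
proof -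
  have b: "even (Suc j) = b" using j by simp
  have x': "x \<in> sp.cyl (even (Suc j)) (lv (Suc j)) (al j (a, k))" using x b by simp
  obtain e l y' where e: "thread (Suc j) e l" "e (Suc j) = al j (a, k)"
    "follows (even (Suc j)) (Suc j) e x"
    "follows (odd (Suc j)) (Suc j) e y'" "matched (even (Suc j)) x y'"
    using x' by (rule matched_thread)
  have y: "y' = y" using matched_unique[OF m] e(5) b by simp
  let ?e = "e(j := a)" and ?l = "l(j := k)"
  have "thread j ?e ?l"
    unfolding thread_def
  proof (intro conjI allI impI)
    show "?e j \<in> FF (even j) (lv j)" using a by simp
    fix i assume "i \<ge> j"
    show "?l i < mu i"
    proof (cases "i = j")
      case False
      then show ?thesis using e(1) \<open>i \<ge> j\<close> by (simp add: thread_def)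
    qed (use a in simp)
    show "?e (Suc i) = al i (?e i, ?l i)"
    proof (cases "i = j")
      case False
      then show ?thesis using e(1) \<open>i \<ge> j\<close> by (simp add: thread_def)
    qed (use e(2) in simp)
  qed
  then have "sp.cyl (even j) (lv (Suc (Suc j))) (e (Suc (Suc j))) \<subseteq> sp.cyl (even j) (lv j) a"
    using thread_nested[of j ?e ?l j] by simp
  moreover have "y' \<in> sp.cyl (even j) (lv (Suc (Suc j))) (e (Suc (Suc j)))"
    using e(4) by (simp add: follows_def)
  ultimately show ?thesis using y j by auto
qed

text \<open>The thread is started at \<open>y\<close> instead; symmetry and uniqueness identify its
  other point with \<open>x\<close>.\<close>

lemma matched_cyl_backward:
  assumes m: "matched b x y" and j: "even j = (\<not> b)" and y: "y \<in> sp.cyl (\<not> b) (lv j) a"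
  obtains k where "k < mu j" "x \<in> sp.cyl b (lv (Suc j)) (al j (a, k))"
proof -
  have y': "y \<in> sp.cyl (even j) (lv j) a" using y j by simp
  obtain e l x' where e: "thread j e l" "e j = a" "follows (even j) j e y"
    "follows (odd j) j e x'" "matched (even j) y x'"
    using y' by (rule matched_thread)
  have "matched (\<not> b) y x" using matched_sym[OF m] .
  then have "x' = x" using matched_unique[of "\<not> b" y x' x] e(5) j by simp
  moreover have "x' \<in> sp.cyl b (lv (Suc j)) (e (Suc j))" using e(4) j by (simp add: follows_def)
  ultimately show ?thesis using that[of "l j"] e(1,2) by (simp add: thread_def)
qed

text \<open>The thread that starts at the head of \<open>x'\<close> with the piece numbers of the
  thread of \<open>x\<close> is followed by \<open>x'\<close>, hence by \<open>y'\<close>. From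
  stage i + 1 on both threads append the same words, so \<open>y\<close> and \<open>y'\<close> have
  a common tail.\<close>

lemma matched_tail_eq:
  assumes m: "matched b x y" and m': "matched b x' y'" and t: "sp.tail_eq b n x x'"
  obtains k where "sp.tail_eq (\<not> b) k y y'"
proof -
  obtain i where i: "even i = b" "lv i \<ge> n" using lv_large by metis
  have t': "sp.tail_eq b (lv i) x x'" using sp.tail_eq_mono[OF t i(2)] .
  obtain f h where fh: "f \<in> FF b (lv i)" "h \<in> FF b (lv i)" "x \<in> sp.cyl b (lv i) f"
    "x' \<in> sp.cyl b (lv i) h"
    "\<forall>j. \<exists>w\<in>cf_W G (CC b) (lv i) j. x \<in> sp.cyl b (lv i + j) (f \<otimes> w) \<and> x' \<in> sp.cyl b (lv i + j) (h \<otimes> w)"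
    by (rule sp.tail_eq_cyl[OF t'])
  have x: "x \<in> sp.cyl (even i) (lv i) f" using fh(3) i by simp
  obtain e l y1 where e: "thread i e l" "e i = f" "follows (even i) i e x" "follows (odd i) i e y1"
    "matched (even i) x y1" using x by (rule matched_thread)
  have y1: "y1 = y" using matched_unique[OF m] e(5) i by simp
  obtain e' where e': "thread i e' l" "e' i = h"
  proof (rule thread_exists)
    show "h \<in> FF (even i) (lv i)" using fh(2) i(1) by simp
    show "\<And>k. k \<ge> i \<Longrightarrow> l k < mu k" using e(1) by (simp add: thread_def)
  qed
  have "x' \<in> sp.cyl b (lv k) (e' k)" if k: "k \<ge> i" "even k = b" for k
  proof -
    have "even (k - i)" using k i by simp
    then obtain j where j: "k = i + 2 * j" using k by (metis dvdE le_add_diff_inverse)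
    obtain v where v: "v \<in> cf_W G (CC b) (lv i) (lv k - lv i)" "e k = f \<otimes> v" "e' k = h \<otimes> v"
      using thread_words[OF e(1) e'(1), of j] e(2) e'(2) i j by auto
    have le: "lv i + (lv k - lv i) = lv k" using lv_add[of i j] j by simp
    obtain w where w: "w \<in> cf_W G (CC b) (lv i) (lv k - lv i)" "x \<in> sp.cyl b (lv k) (f \<otimes> w)"
      "x' \<in> sp.cyl b (lv k) (h \<otimes> w)" using fh(5)[rule_format, of "lv k - lv i"] le by auto
    have "follows b i e x" using e(3) i(1) by simp
    then have "x \<in> sp.cyl b (lv k) (e k)" using k by (rule followsD)
    then have "x \<in> sp.cyl b (lv k) (f \<otimes> v)" using v by simp
    \<comment> \<open>\<open>x\<close> lies in only one cylinder of this level, so the word shared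
      by \<open>x\<close> and \<open>x'\<close> is the one appended by the thread.\<close>
    then have "w = v" using sp.cyl_unique w(2) sp.FW_inj[OF fh(1) fh(1) w(1) v(1)] by blast
    then show ?thesis using w(3) v(3) by simp
  qed
  then have f': "follows b i e' x'" using fh(4) sp.cyl_pts unfolding follows_def by blast
  obtain y2 where y2: "follows (\<not> b) i e' y2" using e'(1) by (rule point_of_thread)
  have "y2 = y'" using matched_unique[OF m'] matchedI[OF e'(1) f' y2] by simp
  note fy = e(4)[unfolded y1] and fy' = y2[unfolded this]
  let ?j = "Suc i"
  have ys: "y \<in> sp.cyl (\<not> b) (lv k) (e k)" "y' \<in> sp.cyl (\<not> b) (lv k) (e' k)"
    if "k \<ge> i" "even k = (\<not> b)" for k
    using fy fy' that i by (auto simp: follows_def)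
  have ts: "thread ?j e l" "thread ?j e' l" using thread_mono e(1) e'(1) by simp_all
  have "sp.tail_eq (\<not> b) (lv ?j) y y'"
  proof (rule sp.tail_eqI)
    show "y \<in> sp.cyl (\<not> b) (lv ?j) (e ?j)" "y' \<in> sp.cyl (\<not> b) (lv ?j) (e' ?j)"
      using ys[of ?j] i by auto
    fix N
    let ?k = "?j + 2 * N"
    have le: "lv ?j + (lv ?k - lv ?j) = lv ?k" "lv ?k - lv ?j \<ge> N"
      using lv_add[of ?j N] by simp_all
    obtain w where w: "w \<in> cf_W G (CC (\<not> b)) (lv ?j) (lv ?k - lv ?j)"
      "e ?k = e ?j \<otimes> w" "e' ?k = e' ?j \<otimes> w"
      using thread_words[OF ts, of N] i by auto
    have "y \<in> sp.cyl (\<not> b) (lv ?k) (e ?k)" "y' \<in> sp.cyl (\<not> b) (lv ?k) (e' ?k)"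
      using ys[of ?k] i by auto
    then show "\<exists>j'\<ge>N. \<exists>w\<in>cf_W G (CC (\<not> b)) (lv ?j) j'. y \<in> sp.cyl (\<not> b) (lv ?j + j') (e ?j \<otimes> w) \<and>
        y' \<in> sp.cyl (\<not> b) (lv ?j + j') (e' ?j \<otimes> w)"
      using w le by (intro exI[of _ "lv ?k - lv ?j"] conjI bexI[of _ w]) auto
  qed
  then show ?thesis using that by blast
qed

section \<open>The homeomorphism defined by the pairing\<close>

definition mate :: "bool \<Rightarrow> (nat \<times> (nat \<Rightarrow> 'g)) set \<Rightarrow> (nat \<times> (nat \<Rightarrow> 'g)) set" where
  "mate b x = (THE y. matched b x y)"

lemma mate_matched: "x \<in> sp.pts b \<Longrightarrow> matched b x (mate b x)"
  unfolding mate_def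
proof (rule theI')
  assume "x \<in> sp.pts b"
  then obtain y where y: "matched b x y" by (rule matched_exists)
  show "\<exists>!y. matched b x y" by (rule ex1I[of "matched b x", OF y]) (erule matched_unique, rule y)
qed

lemma mate_eq:
  assumes y: "matched b x y"
  shows "mate b x = y"
  unfolding mate_def by (rule the_equality[where P = "matched b x", OF y]) (erule matched_unique, rule y)

lemma mate_pts: "x \<in> sp.pts b \<Longrightarrow> mate b x \<in> sp.pts (\<not> b)"
  using mate_matched matched_pts by blast

lemma mate_mate: "x \<in> sp.pts b \<Longrightarrow> mate (\<not> b) (mate b x) = x"
  using mate_matched matched_sym mate_eq by blast

text \<open>The preimage consists of the pieces that stage j assigns to the cylinder. Continuity and
  the transported measure are both read off from this.\<close>

lemma mate_cyl:
  assumes j: "even j = (\<not> b)" and a: "a \<in> FF (\<not> b) (lv j)"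
  shows "{x \<in> sp.pts b. mate b x \<in> sp.cyl (\<not> b) (lv j) a} =
    (\<Union>k<mu j. sp.cyl b (lv (Suc j)) (al j (a, k)))"
proof (intro equalityI subsetI)
  fix x assume "x \<in> {x \<in> sp.pts b. mate b x \<in> sp.cyl (\<not> b) (lv j) a}"
  then show "x \<in> (\<Union>k<mu j. sp.cyl b (lv (Suc j)) (al j (a, k)))"
    using matched_cyl_backward[OF mate_matched j] by blast
next
  fix x assume "x \<in> (\<Union>k<mu j. sp.cyl b (lv (Suc j)) (al j (a, k)))"
  then obtain k where k: "k < mu j" "x \<in> sp.cyl b (lv (Suc j)) (al j (a, k))" by blast
  then have "x \<in> sp.pts b" using sp.cyl_pts by blast
  then show "x \<in> {x \<in> sp.pts b. mate b x \<in> sp.cyl (\<not> b) (lv j) a}"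
    using matched_cyl_forward[OF mate_matched j _ k] a j by simp
qed

lemma mate_continuous: "continuous_map (sp.X b) (sp.X (\<not> b)) (mate b)"
  unfolding continuous_map_def sp.topspace_X
proof (intro conjI allI impI)
  show "mate b \<in> sp.pts b \<rightarrow> sp.pts (\<not> b)" using mate_pts by blast
  fix U assume U: "openin (sp.X (\<not> b)) U"
  show "openin (sp.X b) {x \<in> sp.pts b. mate b x \<in> U}"
  proof (rule sp.openin_X_I)
    fix x assume x: "x \<in> {x \<in> sp.pts b. mate b x \<in> U}"
    then obtain n f where nf: "mate b x \<in> sp.cyl (\<not> b) n f" "sp.cyl (\<not> b) n f \<subseteq> U"
      using U unfolding sp.openin_X by blast
    obtain j where j: "even j = (\<not> b)" "lv j \<ge> n" using lv_large by metis
    then obtain d where d: "lv j = n + d" using le_Suc_ex by blast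
    obtain w where w: "w \<in> cf_W G (CC (\<not> b)) n d" "mate b x \<in> sp.cyl (\<not> b) (lv j) (f \<otimes> w)"
      using sp.cyl_refineE[OF nf(1), of d] d by metis
    let ?a = "f \<otimes> w"
    have a: "?a \<in> FF (\<not> b) (lv j)" "sp.cyl (\<not> b) (lv j) ?a \<subseteq> U"
      using sp.cyl_F[OF w(2)] sp.cyl_sub[OF w(1) sp.cyl_F[OF nf(1)]] nf(2) d by auto
    have "x \<in> (\<Union>k<mu j. sp.cyl b (lv (Suc j)) (al j (?a, k)))"
      using mate_cyl[OF j(1) a(1)] x w(2) by blast
    then obtain k where k: "k < mu j" "x \<in> sp.cyl b (lv (Suc j)) (al j (?a, k))" by blast
    then have "sp.cyl b (lv (Suc j)) (al j (?a, k)) \<subseteq> {x \<in> sp.pts b. mate b x \<in> U}"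
      using mate_cyl[OF j(1) a(1)] a(2) by blast
    then show "\<exists>n f. x \<in> sp.cyl b n f \<and> sp.cyl b n f \<subseteq> {x \<in> sp.pts b. mate b x \<in> U}"
      using k(2) by blast
  qed auto
qed

lemma mate_homeomorphic: "homeomorphic_map (sp.X b) (sp.X (\<not> b)) (mate b)"
proof (rule homeomorphic_maps_imp_map)
  show "homeomorphic_maps (sp.X b) (sp.X (\<not> b)) (mate b) (mate (\<not> b))"
    unfolding homeomorphic_maps_def sp.topspace_X
    using mate_continuous[of b] mate_continuous[of "\<not> b"] mate_mate[of _ b] mate_mate[of _ "\<not> b"] by simp
qed

lemma mate_tail_eq:
  assumes "x \<in> sp.pts b"
  shows "mate b ` {y. \<exists>n. sp.tail_eq b n x y} = {y. \<exists>n. sp.tail_eq (\<not> b) n (mate b x) y}"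
proof (intro equalityI subsetI)
  fix y assume "y \<in> mate b ` {y. \<exists>n. sp.tail_eq b n x y}"
  then obtain x' n where x': "y = mate b x'" "sp.tail_eq b n x x'" by blast
  then have "x' \<in> sp.pts b" using sp.tail_eq_pts by blast
  then show "y \<in> {y. \<exists>n. sp.tail_eq (\<not> b) n (mate b x) y}"
    using matched_tail_eq[OF mate_matched[OF assms] mate_matched x'(2)] x'(1) by blast
next
  fix y assume "y \<in> {y. \<exists>n. sp.tail_eq (\<not> b) n (mate b x) y}"
  then obtain n where n: "sp.tail_eq (\<not> b) n (mate b x) y" by blast
  then have y: "y \<in> sp.pts (\<not> b)" using sp.tail_eq_pts by blast
  have 1: "matched (\<not> b) (mate b x) x" using mate_matched[OF assms] matched_sym by blast
  obtain k where "sp.tail_eq b k x (mate (\<not> b) y)"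
    using matched_tail_eq[OF 1 mate_matched[OF y] n] by auto
  moreover have "mate b (mate (\<not> b) y) = y" using mate_mate[OF y] by simp
  ultimately show "y \<in> mate b ` {y. \<exists>n. sp.tail_eq b n x y}" by (metis (mono_tags, lifting) image_eqI mem_Collect_eq)
qed

text \<open>The condition is the one in \<open>cf_phi\<close>. It determines \<open>y\<close>,
  because by \<open>matched_cyl_backward\<close> it places \<open>y\<close> in a cylinder around
  \<open>mate b x\<close> at cofinally many levels.\<close>

lemma mate_characterized:
  assumes x: "x \<in> sp.pts b"
  shows "(THE y. y \<in> sp.pts (\<not> b) \<and> (\<forall>i. even i = (\<not> b) \<longrightarrow>
      (\<forall>a\<in>FF (\<not> b) (lv i). \<forall>k<mu i. x \<in> sp.cyl b (lv (Suc i)) (al i (a, k)) \<longrightarrow>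
         y \<in> sp.cyl (\<not> b) (lv i) a))) = mate b x"
proof (rule the_equality)
  show "mate b x \<in> sp.pts (\<not> b) \<and> (\<forall>i. even i = (\<not> b) \<longrightarrow>
      (\<forall>a\<in>FF (\<not> b) (lv i). \<forall>k<mu i. x \<in> sp.cyl b (lv (Suc i)) (al i (a, k)) \<longrightarrow>
         mate b x \<in> sp.cyl (\<not> b) (lv i) a))"
    using mate_pts[OF x] matched_cyl_forward[OF mate_matched[OF x]] by simp
next
  fix y assume y: "y \<in> sp.pts (\<not> b) \<and> (\<forall>i. even i = (\<not> b) \<longrightarrow>
      (\<forall>a\<in>FF (\<not> b) (lv i). \<forall>k<mu i. x \<in> sp.cyl b (lv (Suc i)) (al i (a, k)) \<longrightarrow>
         y \<in> sp.cyl (\<not> b) (lv i) a))"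
  show "y = mate b x"
  proof (rule sp.separation)
    show "y \<in> sp.pts (\<not> b)" "mate b x \<in> sp.pts (\<not> b)" using y mate_pts[OF x] by auto
    fix K
    obtain N where N: "\<And>n. n \<ge> N \<Longrightarrow> \<exists>f\<in>FF (\<not> b) n. mate b x \<in> sp.cyl (\<not> b) n f"
      using sp.pts_cyl[OF mate_pts[OF x]] by blast
    obtain j where j: "even j = (\<not> b)" "lv j \<ge> max K N" using lv_large by metis
    then obtain a where a: "a \<in> FF (\<not> b) (lv j)" "mate b x \<in> sp.cyl (\<not> b) (lv j) a"
      using N[of "lv j"] by auto
    then obtain k where "k < mu j" "x \<in> sp.cyl b (lv (Suc j)) (al j (a, k))"
      using matched_cyl_backward[OF mate_matched[OF x] j(1)] by blast
    then have "y \<in> sp.cyl (\<not> b) (lv j) a" using y j(1) a(1) by blast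
    then show "\<exists>n\<ge>K. \<exists>f. y \<in> sp.cyl (\<not> b) n f \<and> mate b x \<in> sp.cyl (\<not> b) n f"
      using a(2) j(2) by auto
  qed
qed

end

subsection \<open>The constructed orbit equivalence\<close>

text \<open>An enumeration says nothing about \<open>C 0\<close>, so the two families of factors are
  known to agree only on the index set \<open>{n..}\<close>; hence the comparison through open
  sets.\<close>

lemma cf_enum_level_top:
  assumes "cf_enum C F Cl Fl"
  shows "cf_level_top (set \<circ> Cl) (set \<circ> Fl) n = cf_level_top C F n"
proof -
  let ?T = "\<lambda>k. discrete_topology (if k = n then F n else C k)"
  let ?T' = "\<lambda>k. discrete_topology (if k = n then (set \<circ> Fl) n else (set \<circ> Cl) k)"
  have eq: "?T' k = ?T k" if "k \<in> {n..}" for k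
    using assms that by (auto simp: cf_enum_def)
  have "{k \<in> {n..}. U k \<noteq> topspace (?T' k)} = {k \<in> {n..}. U k \<noteq> topspace (?T k)}" for U
    by (rule Collect_cong, rule conj_cong, rule refl) (simp only: eq)
  moreover have "(\<forall>k\<in>{n..}. openin (?T' k) (U k)) \<longleftrightarrow> (\<forall>k\<in>{n..}. openin (?T k) (U k))" for U
    by (rule ball_cong, rule refl) (simp only: eq)
  ultimately show ?thesis
    unfolding cf_level_top_def topology_eq openin_product_topology_alt by (simp only: simp_thms)
qed

lemma cf_enum_points:
  assumes "cf_enum C F Cl Fl"
  shows "cf_points G (set \<circ> Cl) (set \<circ> Fl) = cf_points G C F"
    and "cf_cyl G (set \<circ> Cl) (set \<circ> Fl) = cf_cyl G C F"
proof -
  note top = cf_enum_level_top[OF assms]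
  have rel: "cf_rel G (set \<circ> Cl) (set \<circ> Fl) = cf_rel G C F" by (simp add: cf_rel_def top)
  show "cf_points G (set \<circ> Cl) (set \<circ> Fl) = cf_points G C F" by (simp add: cf_points_def rel top)
  show "cf_cyl G (set \<circ> Cl) (set \<circ> Fl) = cf_cyl G C F"
    by (intro ext) (simp add: cf_cyl_def cf_in_def rel top)
qed

text \<open>The spaces are indexed by \<open>bool\<close>, with \<open>True\<close> for the domain
  of the map, so that stages in both directions are instances of one statement.\<close>

locale cf_enum_pair =
  fixes G :: "('g, 'b) monoid_scheme" (structure)
    and CC FF :: "bool \<Rightarrow> nat \<Rightarrow> 'g set" and CL FL :: "bool \<Rightarrow> nat \<Rightarrow> 'g list"
    and MU :: "bool \<Rightarrow> (nat \<times> (nat \<Rightarrow> 'g)) set measure" and c :: real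
  assumes haar_space: "cf_haar_space G (CC b) (FF b) (MU b)"
    and enum: "cf_enum (CC b) (FF b) (CL b) (FL b)"
    and noncompact: "\<not> compact_space (cf_top G (CC b) (FF b))"
    and c: "c > 0"
    and D: "cf_D (CC True) = (\<lambda>d. c * d) ` cf_D (CC False)"
    and total: "emeasure (MU True) (cf_points G (CC True) (FF True)) =
       ennreal c * emeasure (MU False) (cf_points G (CC False) (FF False))"
begin

sublocale hs: cf_haar_space G "CC b" "FF b" "MU b" for b
  by (rule haar_space)

definition scale :: "bool \<Rightarrow> real" where
  "scale b = (if b then c else 1 / c)"

lemma scale_pos: "scale b > 0" and scale_inverse: "scale (\<not> b) * scale b = 1"
  using c by (auto simp: scale_def)

text \<open>The hypotheses are symmetric under exchanging the spaces and replacing c by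
  \<open>1 / c\<close>, so one search lemma serves both directions.\<close>

lemma D_scale: "cf_D (CC b) = (\<lambda>d. scale b * d) ` cf_D (CC (\<not> b))"
proof (cases b)
  case False
  have "(\<lambda>d. 1 / c * d) ` cf_D (CC True) = cf_D (CC False)"
    unfolding D image_image using c by simp
  then show ?thesis using False by (simp add: scale_def)
qed (simp add: D scale_def)

lemma total_scale: "emeasure (MU b) (hs.pts b) = ennreal (scale b) * emeasure (MU (\<not> b)) (hs.pts (\<not> b))"
proof (cases b)
  case False
  have "ennreal (1 / c) * emeasure (MU True) (hs.pts True) =
      (ennreal (1 / c) * ennreal c) * emeasure (MU False) (hs.pts False)"
    unfolding total by (simp add: mult.assoc)
  also have "ennreal (1 / c) * ennreal c = 1" using c by (simp add: ennreal_mult'[symmetric])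
  finally show ?thesis using False by (simp add: scale_def)
qed (simp add: total scale_def)

lemma fits:
  obtains m s where "N < m" "cf_fits (CL b) (FL b) (CL (\<not> b)) (FL (\<not> b)) (scale b) n m s"
  using fits_exists[OF haar_space haar_space enum enum noncompact scale_pos D_scale total_scale] by blast

abbreviation stages where
  "stages \<equiv> cf_stages G (CL True) (FL True) (CL False) (FL False) c"

abbreviation ok where
  "ok i \<equiv> stage_ok (CC (even i)) (FL (even i)) (CC (odd i)) (FL (odd i)) (scale (even i))"

lemma stages_Suc:
  "stages (Suc i) = Option.bind (stages i)
     (cf_next_stage G (CL (odd i)) (FL (odd i)) (CL (even i)) (FL (even i)) (scale (odd i)))"
  by (simp add: scale_def)

lemma next_stage:
  assumes "ok i st"
  obtains st' \<theta> where
    "cf_next_stage G (CL (odd i)) (FL (odd i)) (CL (even i)) (FL (even i)) (scale (odd i)) st = Some st'"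
    "src st' = tgt st" "src st < tgt st'" "ok (Suc i) st'"
    "bij_betw \<theta> ({..<mult st} \<times> {..<mult st'}) (cf_W G (CC (even i)) (src st) (tgt st' - src st))"
    "\<forall>f\<in>FF (even i) (src st). \<forall>l<mult st. \<forall>k<mult st'.
       app_map (inj_map st') (app_map (inj_map st) (f, l), k) = f \<otimes> \<theta> (l, k)"
proof -
  obtain m s where ms: "src st < m"
    "cf_fits (CL (odd i)) (FL (odd i)) (CL (even i)) (FL (even i)) (scale (odd i)) (tgt st) m s"
    using fits[of "src st" "odd i" "tgt st"] by auto
  have d: "scale (even i) * scale (odd i) = 1" using scale_inverse[of "odd i"] by simp
  show ?thesis
    by (rule next_stage_ok[OF hs.cf_space_axioms hs.cf_space_axioms enum enum assms d ms])
      (rule that, simp_all, blast)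
qed

lemma stages_ok: "\<exists>st. stages i = Some st \<and> ok i st"
proof (induction i)
  case 0
  obtain m s where "0 < m" "cf_fits (CL True) (FL True) (CL (\<not> True)) (FL (\<not> True)) (scale True) 0 m s"
    by (rule fits)
  then have ms: "cf_fits (CL True) (FL True) (CL False) (FL False) (scale True) 0 m s" by simp
  obtain st where "cf_first_stage (CL True) (FL True) (CL False) (FL False) (scale True) = Some st"
    "stage_ok (CC True) (FL True) (CC False) (FL False) (scale True) st"
    by (rule first_stage_ok[OF enum enum ms])
  then show ?case by (simp add: scale_def)
next
  case (Suc i)
  then obtain st where st: "stages i = Some st" "ok i st" by blast
  obtain st' where "cf_next_stage G (CL (odd i)) (FL (odd i)) (CL (even i)) (FL (even i)) (scale (odd i)) st = Some st'"
    "ok (Suc i) st'" using next_stage[OF st(2)] by metis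
  then show ?case unfolding stages_Suc st(1) by simp
qed

definition stage :: "nat \<Rightarrow> 'g cf_stage" where
  "stage i = the (stages i)"

lemma stages_eq: "stages i = Some (stage i)" and stage_ok: "ok i (stage i)"
  using stages_ok[of i] by (auto simp: stage_def)

text \<open>The bijection found by the search is not stored in the stage; one with the same
  properties is recovered by choice.\<close>

definition theta :: "nat \<Rightarrow> nat \<times> nat \<Rightarrow> 'g" where
  "theta i = (SOME \<theta>. bij_betw \<theta> ({..<mult (stage i)} \<times> {..<mult (stage (Suc i))})
       (cf_W G (CC (even i)) (src (stage i)) (tgt (stage (Suc i)) - src (stage i))) \<and>
     (\<forall>f\<in>FF (even i) (src (stage i)). \<forall>l<mult (stage i). \<forall>k<mult (stage (Suc i)).
       app_map (inj_map (stage (Suc i))) (app_map (inj_map (stage i)) (f, l), k) = f \<otimes> \<theta> (l, k)))"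

lemma stage_Suc:
  "src (stage (Suc i)) = tgt (stage i)" (is ?A)
  "src (stage i) < tgt (stage (Suc i))" (is ?B)
  "bij_betw (theta i) ({..<mult (stage i)} \<times> {..<mult (stage (Suc i))})
     (cf_W G (CC (even i)) (src (stage i)) (tgt (stage (Suc i)) - src (stage i)))" (is ?C)
  "\<forall>f\<in>FF (even i) (src (stage i)). \<forall>l<mult (stage i). \<forall>k<mult (stage (Suc i)).
     app_map (inj_map (stage (Suc i))) (app_map (inj_map (stage i)) (f, l), k) = f \<otimes> theta i (l, k)" (is ?E)
proof -
  obtain st' \<theta> where n:
    "cf_next_stage G (CL (odd i)) (FL (odd i)) (CL (even i)) (FL (even i)) (scale (odd i)) (stage i) = Some st'"
    "src st' = tgt (stage i)" "src (stage i) < tgt st'" "ok (Suc i) st'"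
    "bij_betw \<theta> ({..<mult (stage i)} \<times> {..<mult st'})
       (cf_W G (CC (even i)) (src (stage i)) (tgt st' - src (stage i)))"
    "\<forall>f\<in>FF (even i) (src (stage i)). \<forall>l<mult (stage i). \<forall>k<mult st'.
       app_map (inj_map st') (app_map (inj_map (stage i)) (f, l), k) = f \<otimes> \<theta> (l, k)"
    by (rule next_stage[OF stage_ok[of i]])
  have st': "st' = stage (Suc i)" using stages_eq[of "Suc i"] n(1) unfolding stages_Suc stages_eq[of i] by simp
  show ?A ?B using n(2,3) st' by auto
  have "?C \<and> ?E" unfolding theta_def
    by (rule someI[of _ \<theta>]) (use n(5,6) st' in simp)
  then show ?C ?E by blast+
qed

lemma stage_maps:
  "inj_on (app_map (inj_map (stage i))) (FF (even i) (src (stage i)) \<times> {..<mult (stage i)})"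
  "app_map (inj_map (stage i)) ` (FF (even i) (src (stage i)) \<times> {..<mult (stage i)})
     \<subseteq> FF (odd i) (tgt (stage i))"
  using stage_ok[of i] unfolding stage_ok_def
  by (simp_all add: Let_def atLeast0LessThan cf_enum_F(1)[OF enum])

sublocale zz: zigzag G CC FF "\<lambda>i. src (stage i)" "\<lambda>i. mult (stage i)"
  "\<lambda>i. app_map (inj_map (stage i))" theta
proof
  fix i l k f
  show "src (stage i) < src (stage (Suc (Suc i)))" using stage_Suc(1,2) by simp
  show "bij_betw (theta i) ({..<mult (stage i)} \<times> {..<mult (stage (Suc i))})
      (cf_W G (CC (even i)) (src (stage i)) (src (stage (Suc (Suc i))) - src (stage i)))"
    using stage_Suc(1)[of "Suc i"] stage_Suc(3)[of i] by simp
  assume f: "f \<in> FF (even i) (src (stage i))" and l: "l < mult (stage i)"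
  then show "app_map (inj_map (stage i)) (f, l) \<in> FF (odd i) (src (stage (Suc i)))"
    using stage_maps(2)[of i] stage_Suc(1)[of i] by auto
  assume "k < mult (stage (Suc i))"
  then show "app_map (inj_map (stage (Suc i))) (app_map (inj_map (stage i)) (f, l), k) = f \<otimes> theta i (l, k)"
    using f l stage_Suc(4)[of i] by blast
qed

abbreviation phi where
  "phi \<equiv> zz.mate True"

lemma cf_phi_eq:
  assumes x: "x \<in> hs.pts True"
  shows "cf_phi G (CL True) (FL True) (CL False) (FL False) c x = phi x"
proof -
  have set_map: "set (inj_map (stage i)) = (\<lambda>q. (q, app_map (inj_map (stage i)) q)) `
      (FF (even i) (src (stage i)) \<times> {..<mult (stage i)})" for i
    using stage_ok_set[OF stage_ok] cf_enum_F(1)[OF enum] by simp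
  have "(\<forall>i st. odd i \<longrightarrow> stages i = Some st \<longrightarrow> (\<forall>((a, l), f)\<in>set (inj_map st).
        x \<in> hs.cyl True (tgt st) f \<longrightarrow> y \<in> hs.cyl False (src st) a)) \<longleftrightarrow>
      (\<forall>i. even i = (\<not> True) \<longrightarrow> (\<forall>a\<in>FF (\<not> True) (src (stage i)). \<forall>k<mult (stage i).
         x \<in> hs.cyl True (src (stage (Suc i))) (app_map (inj_map (stage i)) (a, k)) \<longrightarrow>
         y \<in> hs.cyl (\<not> True) (src (stage i)) a))" for y
    by (auto simp: stages_eq set_map stage_Suc(1))
  then show ?thesis
    unfolding cf_phi_def cf_enum_points[OF enum] zz.mate_characterized[OF x, symmetric] by simp
qed

lemma phi_measurable: "phi \<in> measurable (MU True) (MU False)"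
  using measurable_sigma_continuous[OF zz.mate_continuous[of True]] hs.sets_mu
  by (simp add: cf_borel_def hs.topspace_X cong: measurable_cong_sets)

text \<open>At the level of an odd stage the preimage of a cylinder consists of \<open>mult\<close>
  cylinders, whose total measure is c times that of the cylinder by the measure identity of the
  stage. Such levels are unbounded, which suffices.\<close>

lemma phi_measure: "distr (MU True) (MU False) phi = scale_measure (ennreal c) (MU False)"
proof (rule hs.measure_eqI_cylinders)
  let ?L = "{src (stage j) | j. odd j}"
  show "infinite ?L"
    unfolding infinite_nat_iff_unbounded_le
  proof
    fix m
    obtain i where "i \<ge> 0" "even i = False" "src (stage i) \<ge> m" by (rule zz.lv_large)
    then show "\<exists>n\<ge>m. n \<in> ?L" by auto
  qed
  show "sets (distr (MU True) (MU False) phi) = sets (cf_borel G (CC False) (FF False))"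
    "sets (scale_measure (ennreal c) (MU False)) = sets (cf_borel G (CC False) (FF False))"
    by (simp_all add: hs.sets_mu)
  fix n a assume "n \<in> ?L" and a: "a \<in> FF False n"
  then obtain j where j: "odd j" "n = src (stage j)" by blast
  let ?al = "app_map (inj_map (stage j))" and ?m = "src (stage (Suc j))" and ?s = "mult (stage j)"
  have m: "?m = tgt (stage j)" by (rule stage_Suc)
  let ?S = "(\<lambda>k. ?al (a, k)) ` {..<?s}"
  have S: "?S \<subseteq> FF True ?m" using stage_maps(2)[of j] a j m by auto
  have "inj_on (\<lambda>k. ?al (a, k)) {..<?s}"
    using stage_maps(1)[of j] a j by (auto simp: inj_on_def)
  then have cS: "card ?S = ?s" by (simp add: card_image)
  have "emeasure (distr (MU True) (MU False) phi) (hs.cyl False n a) =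
      emeasure (MU True) (phi -` hs.cyl False n a \<inter> space (MU True))"
    by (rule emeasure_distr[OF phi_measurable]) (simp add: hs.sets_mu hs.cyl_borel)
  also have "phi -` hs.cyl False n a \<inter> space (MU True) = (\<Union>f\<in>?S. hs.cyl True ?m f)"
    using zz.mate_cyl[of j True a] j a by (auto simp: hs.space_mu)
  also have "emeasure (MU True) \<dots> = ennreal (real ?s / real (hs.p True ?m))"
    using hs.haar_cyls[OF S] cS by simp
  also have "real ?s / real (hs.p True ?m) = c * (1 / real (hs.p False n))"
  proof -
    have "real (hs.p True ?m) = 1 / c * real (hs.p False n) * real ?s"
      using stage_ok[of j] j m by (simp add: stage_ok_def scale_def)
    moreover have "real (hs.p True ?m) > 0" "real (hs.p False n) > 0" using hs.p_pos by auto
    ultimately show ?thesis using c by (auto simp: field_simps)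
  qed
  also have "ennreal \<dots> = emeasure (scale_measure (ennreal c) (MU False)) (hs.cyl False n a)"
    using c hs.haar_cyl[OF a] by (simp add: ennreal_mult'[symmetric])
  finally show "emeasure (distr (MU True) (MU False) phi) (hs.cyl False n a) =
      emeasure (scale_measure (ennreal c) (MU False)) (hs.cyl False n a)" .
  then show "emeasure (distr (MU True) (MU False) phi) (hs.cyl False n a) \<noteq> \<infinity>"
    using hs.haar_cyl[OF a] by (simp add: ennreal_mult_eq_top_iff)
qed

end

lemma constructed_orbit_equivalence:
  assumes S: "cf_haar_space G C F \<mu>" and S': "cf_haar_space G C' F' \<mu>'"
    and nc: "\<not> compact_space (cf_top G C F)" "\<not> compact_space (cf_top G C' F')"
    and dom: "cf_dom_all G C F = topspace (cf_top G C F)"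
      "cf_dom_all G C' F' = topspace (cf_top G C' F')"
    and c: "c > 0" and D: "cf_D C = (\<lambda>d. c * d) ` cf_D C'"
    and total: "emeasure \<mu> (topspace (cf_top G C F)) =
      ennreal c * emeasure \<mu>' (topspace (cf_top G C' F'))"
    and enum: "cf_enum C F Cl Fl" "cf_enum C' F' Cl' Fl'"
    and \<phi>: "\<phi> = cf_phi G Cl Fl Cl' Fl' c"
  shows "cf_stages G Cl Fl Cl' Fl' c i \<noteq> None"
    and "homeomorphic_map (cf_top G C F) (cf_top G C' F') \<phi>"
    and "x \<in> topspace (cf_top G C F) \<Longrightarrow> \<phi> ` cf_orbit G C F x = cf_orbit G C' F' (\<phi> x)"
    and "distr \<mu> \<mu>' \<phi> = scale_measure (ennreal c) \<mu>'"
proof -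
  interpret P: cf_enum_pair G "\<lambda>b. if b then C else C'" "\<lambda>b. if b then F else F'"
    "\<lambda>b. if b then Cl else Cl'" "\<lambda>b. if b then Fl else Fl'" "\<lambda>b. if b then \<mu> else \<mu>'" c
    by (rule cf_enum_pair.intro) (use assms in \<open>simp_all add: topspace_cf_top split: if_split\<close>)
  interpret S: cf_haar_space G C F \<mu> by (rule S)
  interpret S': cf_haar_space G C' F' \<mu>' by (rule S')
  have eq: "\<phi> x = P.phi x" if "x \<in> S.pts" for x
    using P.cf_phi_eq[of x] that by (simp add: \<phi>)
  show "cf_stages G Cl Fl Cl' Fl' c i \<noteq> None" using P.stages_eq[of i] by simp
  have "homeomorphic_map (cf_top G C F) (cf_top G C' F') P.phi"
    using P.zz.mate_homeomorphic[of True] by simp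
  then show "homeomorphic_map (cf_top G C F) (cf_top G C' F') \<phi>"
    by (rule homeomorphic_map_eq) (simp add: eq S.topspace_X)
  show "\<phi> ` cf_orbit G C F x = cf_orbit G C' F' (\<phi> x)" if "x \<in> topspace (cf_top G C F)"
  proof -
    have x: "x \<in> S.pts" using that by (simp add: S.topspace_X)
    have x': "\<phi> x \<in> S'.pts" using P.zz.mate_pts[of x True] x eq by simp
    have sub: "{y. \<exists>n. S.tail_eq n x y} \<subseteq> S.pts" using S.tail_eq_pts by blast
    have "\<phi> ` {y. \<exists>n. S.tail_eq n x y} = P.phi ` {y. \<exists>n. S.tail_eq n x y}"
      using eq sub by (intro image_cong) auto
    also have "\<dots> = {y. \<exists>n. S'.tail_eq n (\<phi> x) y}"
      using P.zz.mate_tail_eq[of x True] x eq by simp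
    finally show ?thesis
      using S.orbit_eq[OF dom(1)[unfolded S.topspace_X] x] S'.orbit_eq[OF dom(2)[unfolded S'.topspace_X] x']
      by simp
  qed
  have "distr \<mu> \<mu>' \<phi> = distr \<mu> \<mu>' P.phi"
    by (rule distr_cong) (simp_all add: S.space_mu eq)
  then show "distr \<mu> \<mu>' \<phi> = scale_measure (ennreal c) \<mu>'"
    using P.phi_measure by simp
qed

subsection \<open>Invariants of orbit equivalence\<close>

lemma cf_D_mult:
  assumes "d \<in> cf_D C"
  shows "real_of_int z * d \<in> cf_D C"
proof -
  obtain y n where "d = real_of_int y / real (cf_p C n)" using assms by (auto simp: cf_D_def)
  then have "real_of_int z * d = real_of_int (z * y) / real (cf_p C n)" by simp
  then show ?thesis unfolding cf_D_def by blast
qed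

text \<open>\<open>cf_D\<close> is closed under integer multiples, so it is enough to test the
  generators \<open>1 / p_n\<close>.\<close>

lemma cf_D_subset:
  assumes "\<And>n. a / real (cf_p C n) \<in> cf_D C'"
  shows "(\<lambda>d. a * d) ` cf_D C \<subseteq> cf_D C'"
proof
  fix x assume "x \<in> (\<lambda>d. a * d) ` cf_D C"
  then obtain z n where "x = a * (real_of_int z / real (cf_p C n))" by (auto simp: cf_D_def)
  then have "x = real_of_int z * (a / real (cf_p C n))" by simp
  then show "x \<in> cf_D C'" using cf_D_mult[OF assms[of n], of z] by simp
qed

context cf_haar_space
begin

lemma haar_compact_open:
  assumes "compactin X K" "openin X K"
  obtains r where "r \<ge> 0" "r \<in> cf_D C" "emeasure \<mu> K = ennreal r" "K \<noteq> {} \<Longrightarrow> r > 0"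
proof -
  obtain N where N: "\<And>m. m \<ge> N \<Longrightarrow> K = (\<Union>h\<in>{h \<in> F m. cyl m h \<subseteq> K}. cyl m h)"
    using compact_open_cylinders[OF assms] by blast
  define S where "S = {h \<in> F N. cyl N h \<subseteq> K}"
  have K: "K = (\<Union>h\<in>S. cyl N h)" using N[of N] by (simp add: S_def)
  define r where "r = real (card S) / real (p N)"
  have S: "S \<subseteq> F N" by (auto simp: S_def)
  have "emeasure \<mu> K = ennreal r" unfolding r_def using haar_cyls[OF S] K by simp
  moreover have "r = real_of_int (int (card S)) / real (p N)" by (simp add: r_def)
  then have "r \<in> cf_D C" unfolding cf_D_def by blast
  moreover have "r > 0" if "K \<noteq> {}"
  proof -
    have "S \<noteq> {}" using that K by auto
    then have "card S > 0" using finite_subset[OF S F_finite] by (simp add: card_gt_0_iff)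
    then show ?thesis using p_pos by (simp add: r_def)
  qed
  moreover have "r \<ge> 0" by (simp add: r_def)
  ultimately show ?thesis using that by blast
qed

text \<open>The base cylinder is the disjoint union of \<open>card (W 0 n) = p n\<close> cylinders
  of level n. The product form avoids division in \<open>ennreal\<close>.\<close>

lemma emeasure_equal_cyls:
  assumes f: "f \<in> F n" and f0: "F 0 = {f0}" and \<nu>: "sets \<nu> = sets \<mu>"
    and eq: "\<And>h. h \<in> F n \<Longrightarrow> emeasure \<nu> (cyl n h) = emeasure \<nu> (cyl n f)"
  shows "of_nat (p n) * emeasure \<nu> (cyl n f) = emeasure \<nu> (cyl 0 f0)"
proof -
  have W: "f0 \<otimes> w \<in> F n" if "w \<in> W 0 n" for w using FW[of f0 0 w n] that f0 by simp
  have inj: "w = w'" if "w \<in> W 0 n" "w' \<in> W 0 n" "f0 \<otimes> w = f0 \<otimes> w'" for w w'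
    using FW_inj[of f0 0 f0 w n w'] that f0 by simp
  have "disjoint_family_on (\<lambda>w. cyl n (f0 \<otimes> w)) (W 0 n)"
    using cyl_unique inj unfolding disjoint_family_on_def by blast
  then have "(\<Sum>w\<in>W 0 n. emeasure \<nu> (cyl n (f0 \<otimes> w))) = emeasure \<nu> (\<Union>w\<in>W 0 n. cyl n (f0 \<otimes> w))"
    using cyl_borel W_finite by (intro sum_emeasure) (auto simp: \<nu> sets_mu)
  also have "(\<Union>w\<in>W 0 n. cyl n (f0 \<otimes> w)) = cyl 0 f0" using cyl_refine[of f0 0 n] f0 by simp
  also have "(\<Sum>w\<in>W 0 n. emeasure \<nu> (cyl n (f0 \<otimes> w))) = (\<Sum>w\<in>W 0 n. emeasure \<nu> (cyl n f))"
    by (rule sum.cong[OF refl]) (rule eq[OF W])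
  also have "\<dots> = of_nat (p n) * emeasure \<nu> (cyl n f)"
    using card_W[of 0 n] by (simp add: cf_p_def)
  finally show ?thesis by simp
qed

end

lemma orbit_equivalence_invariants:
  assumes S: "cf_haar_space G C F \<mu>" and S': "cf_haar_space G C' F' \<mu>'"
    and dom: "cf_dom_all G C F = topspace (cf_top G C F)"
      "cf_dom_all G C' F' = topspace (cf_top G C' F')"
    and hom: "homeomorphic_map (cf_top G C F) (cf_top G C' F') \<phi>"
    and orb: "\<And>x. x \<in> topspace (cf_top G C F) \<Longrightarrow> \<phi> ` cf_orbit G C F x = cf_orbit G C' F' (\<phi> x)"
  shows "\<exists>c>0. cf_D C = (\<lambda>d. c * d) ` cf_D C' \<and>
    emeasure \<mu> (topspace (cf_top G C F)) = ennreal c * emeasure \<mu>' (topspace (cf_top G C' F'))"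
proof -
  interpret S: cf_haar_space G C F \<mu> by (rule S)
  interpret S': cf_haar_space G C' F' \<mu>' by (rule S')
  obtain \<psi> where maps: "homeomorphic_maps S.X S'.X \<phi> \<psi>" using hom homeomorphic_map_maps by blast
  then have cont: "continuous_map S.X S'.X \<phi>" "continuous_map S'.X S.X \<psi>"
    and inv: "\<And>x. x \<in> S.pts \<Longrightarrow> \<psi> (\<phi> x) = x" "\<And>y. y \<in> S'.pts \<Longrightarrow> \<phi> (\<psi> y) = y"
    by (auto simp: homeomorphic_maps_def S.topspace_X S'.topspace_X)
  have hom': "homeomorphic_map S'.X S.X \<psi>"
    using maps homeomorphic_maps_imp_map homeomorphic_maps_sym by blast
  have \<phi>: "\<phi> x \<in> S'.pts" if "x \<in> S.pts" for x
    using cont(1) that by (auto simp: continuous_map_def S.topspace_X S'.topspace_X)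
  have \<psi>: "\<psi> y \<in> S.pts" if "y \<in> S'.pts" for y
    using cont(2) that by (auto simp: continuous_map_def S.topspace_X S'.topspace_X)
  have meas: "\<phi> \<in> measurable \<mu> \<mu>'"
    using measurable_sigma_continuous[OF cont(1)] S.sets_mu S'.sets_mu
    by (simp add: cf_borel_def S.topspace_X S'.topspace_X cong: measurable_cong_sets)
  define \<nu> where "\<nu> = distr \<mu> \<mu>' \<phi>"
  have vim: "\<phi> -` B \<inter> space \<mu> = \<psi> ` B" if "B \<subseteq> S'.pts" for B
  proof (intro equalityI subsetI)
    fix x assume "x \<in> \<phi> -` B \<inter> space \<mu>"
    then show "x \<in> \<psi> ` B" using inv(1)[of x] by (auto simp: S.space_mu intro: rev_image_eqI)
  next
    fix x assume "x \<in> \<psi> ` B"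
    then show "x \<in> \<phi> -` B \<inter> space \<mu>" using that inv(2) \<psi> by (auto simp: S.space_mu)
  qed
  have \<nu>: "emeasure \<nu> B = emeasure \<mu> (\<psi> ` B)" if "B \<in> sets \<mu>'" for B
    using emeasure_distr[OF meas that] vim[of B] sets.sets_into_space[OF that]
    by (simp add: \<nu>_def S'.space_mu)
  have cylset: "S'.cyl n f \<in> sets \<mu>'" for n f by (simp add: S'.sets_mu S'.cyl_borel)

  have same: "emeasure \<nu> (S'.cyl n f) = emeasure \<nu> (S'.cyl n f')" if f: "f \<in> F' n" "f' \<in> F' n" for n f f'
  proof -
    let ?s = "S'.swap n f f'"
    \<comment> \<open>The conjugate of a swap; it moves each point within its own orbit because
      \<open>\<phi>\<close> maps orbits onto orbits.\<close>
    let ?\<kappa> = "\<psi> \<circ> ?s \<circ> \<phi>"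
    have s: "?s y \<in> S'.pts" "?s (?s y) = y" if "y \<in> S'.pts" for y
      using S'.swap_pts[OF f that] S'.swap_swap[OF f that] by auto
    have "emeasure \<mu> (?\<kappa> ` (\<psi> ` S'.cyl n f)) = emeasure \<mu> (\<psi> ` S'.cyl n f)"
    proof (rule S.orbit_map_measure)
      show "continuous_map S.X S.X ?\<kappa>"
        using cont S'.swap_continuous[OF f] by (intro continuous_map_compose)
      show "inj_on ?\<kappa> S.pts"
      proof (rule inj_onI)
        fix x y assume x: "x \<in> S.pts" and y: "y \<in> S.pts" and "?\<kappa> x = ?\<kappa> y"
        then have "\<phi> (\<psi> (?s (\<phi> x))) = \<phi> (\<psi> (?s (\<phi> y)))" by simp
        then have "?s (?s (\<phi> x)) = ?s (?s (\<phi> y))" using inv(2) s \<phi> x y by simp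
        then have "\<psi> (\<phi> x) = \<psi> (\<phi> y)" using s \<phi> x y by simp
        then show "x = y" using inv x y by simp
      qed
      fix x assume x: "x \<in> S.pts"
      have "?s (\<phi> x) \<in> cf_orbit G C' F' (\<phi> x)"
        using S'.orbit_eq[OF dom(2)[unfolded S'.topspace_X] \<phi>[OF x]] S'.swap_tail_eq[OF f \<phi>[OF x]] by simp
      then obtain u where u: "u \<in> cf_orbit G C F x" "?s (\<phi> x) = \<phi> u"
        using orb[of x] x by (auto simp: S.topspace_X)
      then obtain m where m: "S.tail_eq m x u"
        using S.orbit_eq[OF dom(1)[unfolded S.topspace_X] x] by blast
      then have "u \<in> S.pts" using S.tail_eq_pts by blast
      then have "?\<kappa> x = u" using u(2) inv by simp
      then show "\<exists>n. S.tail_eq n x (?\<kappa> x)" using m by blast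
    next
      show "\<psi> ` S'.cyl n f \<in> sets \<mu>"
        using vim[OF S'.cyl_pts] measurable_sets[OF meas cylset] by metis
    qed
    \<comment> \<open>The conjugate carries the preimage of \<open>[f]_n\<close> onto that of
      \<open>[f']_n\<close>, so the two preimages have the same measure.\<close>
    moreover have "?\<kappa> ` (\<psi> ` S'.cyl n f) = \<psi> ` S'.cyl n f'"
    proof -
      have c: "g \<in> F' n \<Longrightarrow> y \<in> S'.cyl n g \<Longrightarrow> ?s y \<in> S'.cyl n (Transposition.transpose f f' g)" for g y
        using S'.swap_cyl_sub[OF f, of "\<one>\<^bsub>G\<^esub>" 0 y g] S'.transpose_F[OF f, of g] S'.F_closed by simp
      have "?s ` S'.cyl n f = S'.cyl n f'"
      proof (intro equalityI subsetI)
        fix y assume "y \<in> ?s ` S'.cyl n f"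
        then show "y \<in> S'.cyl n f'" using c[OF f(1)] by auto
      next
        fix y assume y: "y \<in> S'.cyl n f'"
        then have "?s y \<in> S'.cyl n f" using c[OF f(2)] by fastforce
        moreover have "y \<in> S'.pts" using y S'.cyl_pts by blast
        ultimately show "y \<in> ?s ` S'.cyl n f" using s(2) by (metis image_eqI)
      qed
      moreover have "\<phi> ` \<psi> ` S'.cyl n f = S'.cyl n f"
        using inv(2) S'.cyl_pts[of n f] by (force simp: image_image)
      ultimately show ?thesis by (metis image_comp)
    qed
    ultimately show ?thesis by (simp add: \<nu> cylset)
  qed

  obtain f0 where f0: "F' 0 = {f0}" using S'.F_0_card by (meson card_1_singletonE)
  have co: "compactin S.X (\<psi> ` S'.cyl n f)" "openin S.X (\<psi> ` S'.cyl n f)" for n f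
    using S'.compact_cyl S'.cyl_open S'.cyl_pts S'.topspace_X homeomorphic_map_compactness[OF hom']
      homeomorphic_map_openness[OF hom'] by metis+
  \<comment> \<open>The base cylinder has Haar measure 1, so c can only be its transported measure;
    this is finite and positive since the preimage is compact open and nonempty.\<close>
  obtain c where c: "c > 0" "emeasure \<nu> (S'.cyl 0 f0) = ennreal c"
    using S.haar_compact_open[OF co] S'.cyl_nonempty[of f0 0] f0 by (metis \<nu> cylset image_is_empty insertI1)
  have \<nu>_cyl: "emeasure \<nu> (S'.cyl n f) = ennreal (c / real (S'.p n))" if f: "f \<in> F' n" for n f
  proof -
    have "of_nat (S'.p n) * emeasure \<nu> (S'.cyl n f) = ennreal c"
      using S'.emeasure_equal_cyls[OF f f0 _ same[OF _ f]] c by (simp add: \<nu>_def)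
    obtain r where r: "r \<ge> 0" "emeasure \<nu> (S'.cyl n f) = ennreal r"
      using S.haar_compact_open[OF co] \<nu> cylset by metis
    have "ennreal (real (S'.p n) * r) = ennreal c"
      using \<open>of_nat (S'.p n) * emeasure \<nu> (S'.cyl n f) = ennreal c\<close> r
      by (simp add: ennreal_mult ennreal_of_nat_eq_real_of_nat)
    then have "real (S'.p n) * r = c" using r c by (simp add: ennreal_inj)
    then have "r = c / real (S'.p n)" using S'.p_pos[of n] by (simp add: field_simps)
    then show ?thesis using r by simp
  qed
  have eq: "\<nu> = scale_measure (ennreal c) \<mu>'"
  proof (rule S'.measure_eqI_cylinders)
    show "infinite (UNIV :: nat set)" by simp
    show "sets \<nu> = sets (cf_borel G C' F')" "sets (scale_measure (ennreal c) \<mu>') = sets (cf_borel G C' F')"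
      by (simp_all add: \<nu>_def S'.sets_mu)
    fix n f assume f: "f \<in> F' n"
    show "emeasure \<nu> (S'.cyl n f) = emeasure (scale_measure (ennreal c) \<mu>') (S'.cyl n f)"
      using \<nu>_cyl[OF f] S'.haar_cyl[OF f] c by (simp add: ennreal_mult'[symmetric])
    show "emeasure \<nu> (S'.cyl n f) \<noteq> \<infinity>" using \<nu>_cyl[OF f] by simp
  qed
  have total: "emeasure \<mu> S.pts = ennreal c * emeasure \<mu>' S'.pts"
  proof -
    have "\<psi> ` S'.pts = S.pts" using \<psi> inv(1) \<phi> by force
    then have "emeasure \<mu> S.pts = emeasure \<nu> S'.pts"
      using \<nu>[of S'.pts] sets.top[of \<mu>'] by (simp add: S'.space_mu)
    then show ?thesis by (simp add: eq)
  qed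
  \<comment> \<open>The preimage of a cylinder of level n is compact open, so its measure
    \<open>c / p'_n\<close> lies in \<open>cf_D C\<close>.\<close>
  have "(\<lambda>d. c * d) ` cf_D C' \<subseteq> cf_D C"
  proof (rule cf_D_subset)
    fix n
    obtain f where f: "f \<in> F' n" using S'.F_nonempty by blast
    obtain r where r: "r \<ge> 0" "r \<in> cf_D C" "emeasure \<nu> (S'.cyl n f) = ennreal r"
      using S.haar_compact_open[OF co] \<nu> cylset by metis
    then have "r = c / real (S'.p n)" using \<nu>_cyl[OF f] c by (simp add: ennreal_inj)
    then show "c / real (S'.p n) \<in> cf_D C" using r by simp
  qed
  \<comment> \<open>The reverse inclusion uses images of cylinders: \<open>1 / p_n\<close> is c
    times the measure of \<open>?K\<close>, and the latter lies in \<open>cf_D C'\<close>.\<close>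
  moreover have "(\<lambda>d. (1 / c) * d) ` cf_D C \<subseteq> cf_D C'"
  proof (rule cf_D_subset)
    fix n
    obtain f where f: "f \<in> F n" using S.F_nonempty by blast
    let ?K = "\<phi> ` S.cyl n f"
    have K: "compactin S'.X ?K" "openin S'.X ?K"
      using S.compact_cyl S.cyl_open S.cyl_pts S.topspace_X homeomorphic_map_compactness[OF hom]
        homeomorphic_map_openness[OF hom] by metis+
    obtain r where r: "r \<ge> 0" "r \<in> cf_D C'" "emeasure \<mu>' ?K = ennreal r"
      using S'.haar_compact_open[OF K] by metis
    have "?K \<in> sets \<mu>'" using S'.open_borel[OF K(2)] by (simp add: S'.sets_mu)
    then have "emeasure \<nu> ?K = emeasure \<mu> (\<psi> ` ?K)" by (rule \<nu>)
    also have "\<psi> ` ?K = S.cyl n f" using inv(1) S.cyl_pts[of n f] by (force simp: image_image)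
    finally have "ennreal (c * r) = ennreal (1 / real (S.p n))"
      using r c S.haar_cyl[OF f] by (simp add: eq ennreal_mult)
    then have "c * r = 1 / real (S.p n)" using c r by (simp add: ennreal_inj)
    then have "r = 1 / c / real (S.p n)" using c S.p_pos[of n] by (simp add: field_simps)
    then show "1 / c / real (S.p n) \<in> cf_D C'" using r by simp
  qed
  then have "cf_D C \<subseteq> (\<lambda>d. c * d) ` cf_D C'"
    using c(1) by (force simp: image_subset_iff intro!: rev_image_eqI)
  ultimately show ?thesis using c(1) total by (auto simp: S.topspace_X S'.topspace_X)
qed

section \<open>Enumerations and the combination of both directions\<close>

lemma cf_enum_exists:
  assumes "cf_sequence G C F"
  obtains Cl Fl where "cf_enum C F Cl Fl"
proof -
  have "\<exists>l. n \<ge> 1 \<longrightarrow> distinct l \<and> set l = C n" for n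
    using assms finite_distinct_list unfolding cf_sequence_def by metis
  then obtain Cl where Cl: "\<And>n. n \<ge> 1 \<longrightarrow> distinct (Cl n) \<and> set (Cl n) = C n" by metis
  have "\<exists>l. distinct l \<and> set l = F n" for n
    using assms finite_distinct_list unfolding cf_sequence_def by metis
  then obtain Fl where "\<And>n. distinct (Fl n) \<and> set (Fl n) = F n" by metis
  with Cl have "cf_enum C F Cl Fl" unfolding cf_enum_def by blast
  then show ?thesis using that by blast
qed

theorem theoremB:
  fixes G :: "('g, 'b) monoid_scheme"
    and C F C' F' :: "nat \<Rightarrow> 'g set"
    and \<mu> \<mu>' :: "(nat \<times> (nat \<Rightarrow> 'g)) set measure"
  assumes "group G" and "countable (carrier G)" and "infinite (carrier G)"
    and "cf_sequence G C F" and "cf_sequence G C' F'"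
    and "\<not> compact_space (cf_top G C F)" and "\<not> compact_space (cf_top G C' F')"
    and "cf_dom_all G C F = topspace (cf_top G C F)"
    and "cf_dom_all G C' F' = topspace (cf_top G C' F')"
    and "cf_haar G C F \<mu>" and "cf_haar G C' F' \<mu>'"
  shows
    "((\<exists>\<phi>. homeomorphic_map (cf_top G C F) (cf_top G C' F') \<phi> \<and>
           (\<forall>x\<in>topspace (cf_top G C F). \<phi> ` cf_orbit G C F x = cf_orbit G C' F' (\<phi> x)))
      \<longleftrightarrow>
      (\<exists>c>0. cf_D C = (\<lambda>d. c * d) ` cf_D C' \<and>
             emeasure \<mu> (topspace (cf_top G C F)) =
               ennreal c * emeasure \<mu>' (topspace (cf_top G C' F'))))
     \<and>
     (\<forall>c>0. cf_D C = (\<lambda>d. c * d) ` cf_D C' \<and>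
            emeasure \<mu> (topspace (cf_top G C F)) =
              ennreal c * emeasure \<mu>' (topspace (cf_top G C' F'))
        \<longrightarrow>
        (\<forall>Cl Fl Cl' Fl'. cf_enum C F Cl Fl \<and> cf_enum C' F' Cl' Fl' \<longrightarrow>
          (\<forall>i. cf_stages G Cl Fl Cl' Fl' c i \<noteq> None) \<and>
          (let \<phi> = cf_phi G Cl Fl Cl' Fl' c in
             homeomorphic_map (cf_top G C F) (cf_top G C' F') \<phi> \<and>
             (\<forall>x\<in>topspace (cf_top G C F). \<phi> ` cf_orbit G C F x = cf_orbit G C' F' (\<phi> x)) \<and>
             distr \<mu> \<mu>' \<phi> = scale_measure (ennreal c) \<mu>')))"
    (is "(?L \<longleftrightarrow> ?R) \<and> ?constr")
proof -
  have S: "cf_haar_space G C F \<mu>" and S': "cf_haar_space G C' F' \<mu>'"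
    using assms by (auto simp: cf_haar_space_def cf_haar_space_axioms_def cf_space_def cf_space_axioms_def)
  let ?G = "\<lambda>c. c > 0 \<and> cf_D C = (\<lambda>d. c * d) ` cf_D C' \<and>
    emeasure \<mu> (topspace (cf_top G C F)) = ennreal c * emeasure \<mu>' (topspace (cf_top G C' F'))"
  let ?E = "\<lambda>\<phi>. homeomorphic_map (cf_top G C F) (cf_top G C' F') \<phi> \<and>
    (\<forall>x\<in>topspace (cf_top G C F). \<phi> ` cf_orbit G C F x = cf_orbit G C' F' (\<phi> x))"
  have constr: "(\<forall>i. cf_stages G Cl Fl Cl' Fl' c i \<noteq> None) \<and> ?E (cf_phi G Cl Fl Cl' Fl' c) \<and>
      distr \<mu> \<mu>' (cf_phi G Cl Fl Cl' Fl' c) = scale_measure (ennreal c) \<mu>'"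
    if "?G c" "cf_enum C F Cl Fl" "cf_enum C' F' Cl' Fl'" for c Cl Fl Cl' Fl'
  proof -
    have "c > 0" "cf_D C = (\<lambda>d. c * d) ` cf_D C'" "emeasure \<mu> (topspace (cf_top G C F)) =
      ennreal c * emeasure \<mu>' (topspace (cf_top G C' F'))" using that(1) by auto
    note * = constructed_orbit_equivalence[OF S S' assms(6-9) this that(2,3) refl]
    show ?thesis by (intro conjI allI ballI) (rule * | assumption)+
  qed
  have ?constr
    unfolding Let_def
  proof (intro allI impI)
    fix c :: real and Cl Fl Cl' Fl'
    assume "c > 0" "cf_D C = (\<lambda>d. c * d) ` cf_D C' \<and> emeasure \<mu> (topspace (cf_top G C F)) =
      ennreal c * emeasure \<mu>' (topspace (cf_top G C' F'))" "cf_enum C F Cl Fl \<and> cf_enum C' F' Cl' Fl'"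
    then show "(\<forall>i. cf_stages G Cl Fl Cl' Fl' c i \<noteq> None) \<and>
        homeomorphic_map (cf_top G C F) (cf_top G C' F') (cf_phi G Cl Fl Cl' Fl' c) \<and>
        (\<forall>x\<in>topspace (cf_top G C F). cf_phi G Cl Fl Cl' Fl' c ` cf_orbit G C F x =
           cf_orbit G C' F' (cf_phi G Cl Fl Cl' Fl' c x)) \<and>
        distr \<mu> \<mu>' (cf_phi G Cl Fl Cl' Fl' c) = scale_measure (ennreal c) \<mu>'"
      using constr[of c Cl Fl Cl' Fl'] by simp
  qed
  moreover have ?L if R: ?R
  proof -
    obtain c where c: "?G c" using R by blast
    obtain Cl Fl where e: "cf_enum C F Cl Fl" using assms(4) by (rule cf_enum_exists)
    obtain Cl' Fl' where e': "cf_enum C' F' Cl' Fl'" using assms(5) by (rule cf_enum_exists)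
    have "?E (cf_phi G Cl Fl Cl' Fl' c)" using constr[OF c e e'] by simp
    then show ?L by blast
  qed
  moreover have ?R if L: ?L
  proof -
    obtain \<phi> where "?E \<phi>" using L by blast
    then show ?R using orbit_equivalence_invariants[OF S S' assms(8,9), of \<phi>] by simp
  qed
  ultimately show ?thesis by blast
qed

end
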